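(* Let $f$ be an inner function with $f(0)=0$ which is not a rotation. Then $$\frac{1}{\sqrt{2N}}\sum_{n=1}^{N}f^n$$ converges in distribution, as $N\to\infty$, to a complex normal variable with mean $0$ and variance $\sigma^2$ given by $$\sigma^2=\mathrm{Re}\,\frac{1+f'(0)}{1-f'(0)},$$ that is, for any measurable set $K\subset\mathbb{C}$, we have $$\lim_{N\to\infty}m\left(\left\{z\in\partial\mathbb{D}: (2N)^{-1/2}\sum_{n=1}^{N}f^n(z)\in K\right\}\right)=\frac{1}{2\pi\sigma^2}\int_K e^{-|w|^2/(2\sigma^2)}\,dA(w).$$
   Context: $\mathbb{D}$ is the open unit disc, $m$ is normalized Lebesgue measure on the unit circle $\partial\mathbb{D}$, and $dA$ is area measure on $\mathbb{C}$. An inner function is an analytic map $f:\mathbb{D}\to\mathbb{D}$ whose radial limits have modulus one at $m$-almost every point of $\partial\mathbb{D}$; the boundary function, defined $m$-a.e. by $f(z)=\lim_{r\to1}f(rz)$, is also denoted $f$. A rotation is a map $z\mapsto cz$ with $|c|=1$. $f^n$ denotes the $n$-th iterate of $f$ (not the power), regarded here as a function defined $m$-a.e. on $\partial\mathbb{D}$.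
   Formalization: The normalizing factor 1/sqrt(2N) is corrected to sqrt(2/N) (the original fails, e.g. for f(z)=z^2), and "any measurable set K" is restricted to Borel sets K whose topological boundary has zero area, since the formula fails for general measurable K. *)

theory Defs
  imports "HOL-Complex_Analysis.Complex_Analysis" "HOL-Probability.Probability"
begin

definition circle_measure :: "complex measure" where
  "circle_measure =
     distr (uniform_measure lborel {0..<2 * pi}) (restrict_space borel (sphere 0 1)) cis"

lemma space_circle_measure [simp]: "space circle_measure = sphere 0 1"
  by (simp add: circle_measure_def space_restrict_space)

lemma sets_circle_measure [measurable_cong]:
  "sets circle_measure = sets (restrict_space borel (sphere 0 1))"
  by (simp add: circle_measure_def)

lemma prob_space_circle_measure: "prob_space circle_measure"
proof -
  have "prob_space (uniform_measure lborel {0..<2 * pi})"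
    by (rule prob_space_uniform_measure) auto
  moreover have "cis \<in> uniform_measure lborel {0..<2 * pi} \<rightarrow>\<^sub>M
      restrict_space borel (sphere 0 1)"
  proof (rule measurable_restrict_space2)
    have "cis \<in> borel_measurable borel"
      by (intro borel_measurable_continuous_onI continuous_intros)
    then show "cis \<in> borel_measurable (uniform_measure lborel {0..<2 * pi})"
      by (simp cong: measurable_cong_sets)
  qed auto
  ultimately show ?thesis
    unfolding circle_measure_def by (rule prob_space.prob_space_distr)
qed

definition inner_function :: "(complex \<Rightarrow> complex) \<Rightarrow> bool" where
  "inner_function f \<longleftrightarrow>
     f holomorphic_on ball 0 1 \<and>
     f ` ball 0 1 \<subseteq> ball 0 1 \<and>
     (AE z in circle_measure.
        \<exists>w. ((\<lambda>r. f (of_real r * z)) \<longlongrightarrow> w) (at_left (1::real)) \<and> cmod w = 1)"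

definition is_rotation :: "(complex \<Rightarrow> complex) \<Rightarrow> bool" where
  "is_rotation f \<longleftrightarrow> (\<exists>c. cmod c = 1 \<and> (\<forall>z\<in>ball 0 1. f z = c * z))"

(* For inner f the value 0 is taken only on a null set of the circle; for inner f with f 0 = 0
   the boundary map preserves circle_measure, so its compositional iterates
   (boundary f ^^ n) do not depend, up to a null set, on this choice. *)
definition boundary :: "(complex \<Rightarrow> complex) \<Rightarrow> complex \<Rightarrow> complex" where
  "boundary f z =
     (if \<exists>w. ((\<lambda>r. f (of_real r * z)) \<longlongrightarrow> w) (at_left (1::real))
      then Lim (at_left (1::real)) (\<lambda>r. f (of_real r * z)) else 0)"

(* The variance parameter v is that of each of the real and imaginary parts, which are
   independent; hence the second absolute moment is 2 * v. *)
definition complex_normal :: "real \<Rightarrow> complex measure" where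
  "complex_normal v =
     density lborel (\<lambda>w. ennreal (1 / (2 * pi * v) * exp (- (cmod w)\<^sup>2 / (2 * v))))"

definition converges_in_distribution ::
    "'a measure \<Rightarrow> (nat \<Rightarrow> 'a \<Rightarrow> complex) \<Rightarrow> complex measure \<Rightarrow> bool" where
  "converges_in_distribution M X \<mu> \<longleftrightarrow>
     (\<forall>g :: complex \<Rightarrow> real. continuous_on UNIV g \<and> bounded (range g) \<longrightarrow>
        (\<lambda>N. \<integral>z. g (X N z) \<partial>M) \<longlonglongrightarrow> (\<integral>w. g w \<partial>\<mu>))"

end

theory Submission
  imports Defs
begin

text \<open>
Let \<open>a = f'(0)\<close>, let \<open>m\<close> be normalized Lebesgue measure on the circle and let \<open>F\<close> be the boundary
map of the inner function \<open>f\<close>. The central observation is that the orbit \<open>z, F z, F (F z), \<dots>\<close> is a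
reversed martingale up to a linear correction, with conditional variances that can be computed.

\<^bold>\<open>Transfer relations.\<close> Write \<open>f z = z * q z\<close> and \<open>q z = a + z * p z\<close>, and put \<open>b = p 0\<close>. The
integral over the circle of the radial limit of a bounded holomorphic function is its value at 0.
Applied to products of powers of \<open>z\<close>, \<open>f\<close>, \<open>q\<close> and to \<open>p\<close>, this evaluates the integrals of \<open>z ^ j\<close>
against all powers of \<open>F\<close> and of its conjugate, for \<open>j = 0, 1, 2\<close>. In terms of conditional
expectations the result reads: \<open>F\<close> preserves \<open>m\<close>, and \<open>E[z | F] = cnj a * F\<close> and
\<open>E[z\<^sup>2 | F] = (cnj a)\<^sup>2 * F\<^sup>2 + cnj b * F\<close>. Stone-Weierstrass on the circle and the uniqueness of
finite measures extend this from monomials to all bounded Borel functions of \<open>F\<close>; see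
\<open>transfer_borel\<close> and \<open>inner_function_circle_transfer\<close>.

\<^bold>\<open>Martingale differences.\<close> Hence \<open>\<xi> z = z - cnj a * F z\<close> satisfies \<open>E[\<xi> | F] = 0\<close>,
\<open>E[\<bar>\<xi>\<bar>\<^sup>2 | F] = 1 - \<bar>a\<bar>\<^sup>2\<close>, a constant, and \<open>E[\<xi>\<^sup>2 | F] = cnj b * F\<close>. The sum \<open>\<Xi> n\<close> of the first
\<open>n\<close> translates of \<open>\<xi>\<close> along the orbit differs from \<open>(1 - cnj a)\<close> times the sum of the first \<open>n\<close>
iterates by at most 2, and the Schwarz lemma gives \<open>\<bar>a\<bar> < 1\<close> because \<open>f\<close> is not a rotation. So a
central limit theorem for \<open>\<Xi> n\<close> suffices, and the limiting variance is \<open>(1 - \<bar>a\<bar>\<^sup>2) / \<bar>1 - a\<bar>\<^sup>2\<close>,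
which is the real part of \<open>(1 + a) / (1 - a)\<close>.

\<^bold>\<open>Characteristic functions.\<close> Because of stationarity, expanding the first factor of the
characteristic function of \<open>Re (c * \<Xi> (n + 1)) * \<epsilon>\<close> to second order multiplies that of
\<open>Re (c * \<Xi> n) * \<epsilon>\<close> by \<open>1 - s * \<epsilon>\<^sup>2 / 2\<close>, where \<open>s = \<bar>c\<bar>\<^sup>2 * (1 - \<bar>a\<bar>\<^sup>2) / 2\<close>, up to \<open>O(\<epsilon>\<^sup>3)\<close> and
up to \<open>\<epsilon>\<^sup>2\<close> times the correlation of \<open>z\<close> with the exponential, which stems from \<open>E[\<xi>\<^sup>2 | F]\<close>. The
first transfer relation makes that correlation contract by the factor \<open>\<bar>a\<bar>\<close> at each step, so it
stays below \<open>\<bar>a\<bar> ^ n + O(\<epsilon>)\<close> (\<open>correlation_decay\<close>). With \<open>\<epsilon> = 1 / sqrt n\<close> all errors vanish in the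
limit (\<open>charfun_limit\<close>).

\<^bold>\<open>Conclusion.\<close> Second moments of \<open>\<Xi> n\<close> are exact by orthogonality, which gives tightness, and
\<open>levy_continuity_plane\<close> turns convergence of characteristic functions into convergence in
distribution. The statement on Borel sets with null frontier is the portmanteau theorem,
\<open>portmanteau_frontier\<close>.
\<close>

section \<open>Linear combinations of characters\<close>

text \<open>When \<open>E\<close> is closed under multiplication, its complex span is an algebra, and real polynomials in
two coordinates that belong to the span belong to it as well. Polynomial approximation on a
compact set thereby becomes approximation by characters, with \<open>E\<close> the exponentials of the plane or
the monomials on the circle.\<close>

inductive_set char_span :: "('a \<Rightarrow> complex) set \<Rightarrow> ('a \<Rightarrow> complex) set" for E where
  base: "e \<in> E \<Longrightarrow> (\<lambda>x. c * e x) \<in> char_span E"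
| add: "u \<in> char_span E \<Longrightarrow> v \<in> char_span E \<Longrightarrow> (\<lambda>x. u x + v x) \<in> char_span E"

lemma char_span_mult:
  assumes E: "\<And>e e'. e \<in> E \<Longrightarrow> e' \<in> E \<Longrightarrow> (\<lambda>x. e x * e' x) \<in> E"
    and u: "u \<in> char_span E" and v: "v \<in> char_span E"
  shows "(\<lambda>x. u x * v x) \<in> char_span E"
  using u
proof induction
  case (base e c)
  show ?case using v
  proof induction
    case (base e' c')
    have "(\<lambda>x. (c * c') * (e x * e' x)) \<in> char_span E"
      using E \<open>e \<in> E\<close> base by (intro char_span.base)
    then show ?case by (simp add: mult_ac)
  next
    case (add u v)
    then show ?case using char_span.add[OF add.IH] by (simp add: algebra_simps)
  qed
next
  case (add u v)
  then show ?case using char_span.add[OF add.IH] by (simp add: algebra_simps)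
qed

lemma real_polynomial_in_char_span:
  fixes p :: "complex \<Rightarrow> real"
  assumes p: "real_polynomial_function p"
    and E: "\<And>e e'. e \<in> E \<Longrightarrow> e' \<in> E \<Longrightarrow> (\<lambda>x. e x * e' x) \<in> E" and one: "(\<lambda>x. 1) \<in> E"
    and Re: "(\<lambda>x. complex_of_real (Re (\<phi> x))) \<in> char_span E"
    and Im: "(\<lambda>x. complex_of_real (Im (\<phi> x))) \<in> char_span E"
  shows "(\<lambda>x. complex_of_real (p (\<phi> x))) \<in> char_span E"
  using p
proof induction
  have const: "(\<lambda>x. c) \<in> char_span E" for c
    using char_span.base[OF one, of c] by simp
  {
    case (linear l)
    then interpret bounded_linear l .
    have l: "l w = Re w * l 1 + Im w * l \<i>" for w
    proof -
      have "l w = l (Re w *\<^sub>R 1 + Im w *\<^sub>R \<i>)"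
        by (rule arg_cong[where f = l]) (simp add: complex_eq_iff)
      then show ?thesis by (simp only: add scaleR) simp
    qed
    have "(\<lambda>x. complex_of_real (Re (\<phi> x)) * of_real (l 1)
        + complex_of_real (Im (\<phi> x)) * of_real (l \<i>)) \<in> char_span E"
      by (intro char_span.add char_span_mult[where E = E] Re Im const) (fact E)+
    then show ?case by (simp add: l[of "\<phi> _"])
  next
    case (const c)
    show ?case by (rule \<open>\<And>c. (\<lambda>x. c) \<in> char_span E\<close>)
  next
    case (add f g)
    then show ?case using char_span.add[OF add.IH] by simp
  next
    case (mult f g)
    show ?case
      unfolding of_real_mult by (rule char_span_mult) (fact E mult.IH)+
  }
qed

section \<open>Finite measures tested on bounded continuous functions\<close>

text \<open>Tent functions that drop from 1 on \<open>C\<close> to 0 at distance \<open>1/n\<close>: the continuous test functions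
through which integrals determine, or asymptotically bound, the measures of closed sets.\<close>

lemma tendsto_indicator_closed:
  fixes C :: "'a::metric_space set"
  assumes "closed C" "C \<noteq> {}"
  shows "(\<lambda>n. max 0 (1 - real n * infdist x C)) \<longlonglongrightarrow> indicator C x"
proof (cases "x \<in> C")
  case True
  then show ?thesis by simp
next
  case False
  then have d: "infdist x C > 0"
    using assms infdist_pos_not_in_closed by blast
  have "\<forall>\<^sub>F n in sequentially. max 0 (1 - real n * infdist x C) = 0"
    using eventually_ge_at_top[of "nat \<lceil>1 / infdist x C\<rceil>"]
  proof eventually_elim
    case (elim n)
    then have "1 / infdist x C \<le> real n" by linarith
    then show ?case using d by (simp add: field_simps max_def)
  qed
  then show ?thesis using False by (simp add: tendsto_eventually)
qed

lemma continuous_tent: "continuous_on UNIV (\<lambda>x. max 0 (1 - real n * infdist x C))"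
  by (intro continuous_intros)

lemma bounded_tent: "bounded (range (\<lambda>x. max 0 (1 - real n * infdist x C)))"
  by (rule boundedI[where B = 1]) (auto simp: infdist_nonneg)

lemma integral_tendsto_measure_closed:
  fixes \<mu> :: "'a::metric_space measure"
  assumes "finite_measure \<mu>" and sets: "sets \<mu> = sets borel" and C: "closed C" "C \<noteq> {}"
  shows "(\<lambda>n. \<integral>x. max 0 (1 - real n * infdist x C) \<partial>\<mu>) \<longlonglongrightarrow> measure \<mu> C"
proof -
  interpret finite_measure \<mu> by fact
  have meas: "g \<in> borel_measurable \<mu>" if "g \<in> borel_measurable borel" for g :: "'a \<Rightarrow> real"
    using that by (simp cong: measurable_cong_sets add: sets)
  have "(\<lambda>n. \<integral>x. max 0 (1 - real n * infdist x C) \<partial>\<mu>) \<longlonglongrightarrow> (\<integral>x. indicator C x \<partial>\<mu>)"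
    by (rule integral_dominated_convergence[where w = "\<lambda>_. 1"])
       (use C tendsto_indicator_closed[OF C] in
         \<open>auto simp: infdist_nonneg intro!: meas borel_measurable_continuous_onI[OF continuous_tent]\<close>)
  also have "(\<integral>x. indicator C x \<partial>\<mu>) = measure \<mu> C"
    using C sets sets_eq_imp_space_eq[OF sets] by simp
  finally show ?thesis .
qed

lemma finite_measure_eqI_continuous:
  fixes \<mu> \<nu> :: "'a::metric_space measure"
  assumes \<mu>: "finite_measure \<mu>" "sets \<mu> = sets borel" and \<nu>: "finite_measure \<nu>" "sets \<nu> = sets borel"
    and eq: "\<And>g::'a \<Rightarrow> real. continuous_on UNIV g \<Longrightarrow> bounded (range g) \<Longrightarrow>
               (\<integral>x. g x \<partial>\<mu>) = (\<integral>x. g x \<partial>\<nu>)"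
  shows "\<mu> = \<nu>"
proof -
  interpret \<mu>: finite_measure \<mu> by fact
  interpret \<nu>: finite_measure \<nu> by fact
  have closed: "measure \<mu> C = measure \<nu> C" if "closed C" "C \<noteq> {}" for C
    by (rule LIMSEQ_unique[OF integral_tendsto_measure_closed[OF \<mu> that]])
       (use integral_tendsto_measure_closed[OF \<nu> that] in
         \<open>simp add: eq[OF continuous_tent bounded_tent]\<close>)
  have eq': "emeasure \<mu> C = emeasure \<nu> C" if "closed C" for C
    using closed[OF that] by (cases "C = {}") (simp_all add: \<mu>.emeasure_eq_measure \<nu>.emeasure_eq_measure)
  show ?thesis
  proof (rule measure_eqI_generator_eq[of "Collect closed" UNIV _ _ "\<lambda>_. UNIV"])
    show "Int_stable (Collect (closed :: 'a set \<Rightarrow> bool))"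
      by (auto simp: Int_stable_def)
    show "sets \<mu> = sigma_sets UNIV (Collect closed)" "sets \<nu> = sigma_sets UNIV (Collect closed)"
      by (simp_all add: \<mu> \<nu> borel_eq_closed)
  qed (use eq' in auto)
qed

lemma portmanteau_closed:
  fixes \<mu> :: "nat \<Rightarrow> 'a::metric_space measure"
  assumes \<mu>: "\<And>n. finite_measure (\<mu> n)" "\<And>n. sets (\<mu> n) = sets borel"
    and \<nu>: "finite_measure \<nu>" "sets \<nu> = sets borel"
    and conv: "\<And>g::'a \<Rightarrow> real. continuous_on UNIV g \<Longrightarrow> bounded (range g) \<Longrightarrow>
               (\<lambda>n. \<integral>x. g x \<partial>\<mu> n) \<longlonglongrightarrow> (\<integral>x. g x \<partial>\<nu>)"
    and C: "closed C" and b: "measure \<nu> C < b"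
  shows "\<forall>\<^sub>F n in sequentially. measure (\<mu> n) C < b"
proof (cases "C = {}")
  case True
  then show ?thesis using b by simp
next
  case False
  let ?g = "\<lambda>k x. max 0 (1 - real k * infdist x C)"
  from order_tendstoD(2)[OF integral_tendsto_measure_closed[OF \<nu> C False] b]
  obtain k where k: "(\<integral>x. ?g k x \<partial>\<nu>) < b"
    by (auto simp: eventually_sequentially)
  have "\<forall>\<^sub>F n in sequentially. (\<integral>x. ?g k x \<partial>\<mu> n) < b"
    using order_tendstoD(2)[OF conv[OF continuous_tent bounded_tent] k] .
  then show ?thesis
  proof eventually_elim
    case (elim n)
    interpret finite_measure "\<mu> n" by (rule \<mu>)
    have meas: "g \<in> borel_measurable (\<mu> n)" if "g \<in> borel_measurable borel" for g :: "'a \<Rightarrow> real"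
      using that by (simp cong: measurable_cong_sets add: \<mu>)
    have "measure (\<mu> n) C = (\<integral>x. indicator C x \<partial>\<mu> n)"
      using sets_eq_imp_space_eq[OF \<mu>(2)[of n]] by simp
    also have "\<dots> \<le> (\<integral>x. ?g k x \<partial>\<mu> n)"
      by (rule integral_mono)
         (use C in \<open>auto intro!: integrable_const_bound[where B = 1] meas
               borel_measurable_continuous_onI[OF continuous_tent] simp: infdist_nonneg split:
                   split_indicator\<close>)
    finally show ?case using elim by simp
  qed
qed

text \<open>A null frontier makes \<open>K\<close> as large as its closure under the limit measure; the upper bound for
closed sets then applies both to \<open>K\<close> and to its complement, whose frontier is the same.\<close>

lemma portmanteau_frontier:
  fixes \<mu> :: "nat \<Rightarrow> 'a::metric_space measure"
  assumes \<mu>: "\<And>n. prob_space (\<mu> n)" "\<And>n. sets (\<mu> n) = sets borel"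
    and \<nu>: "prob_space \<nu>" "sets \<nu> = sets borel"
    and conv: "\<And>g::'a \<Rightarrow> real. continuous_on UNIV g \<Longrightarrow> bounded (range g) \<Longrightarrow>
               (\<lambda>n. \<integral>x. g x \<partial>\<mu> n) \<longlonglongrightarrow> (\<integral>x. g x \<partial>\<nu>)"
    and K: "K \<in> sets borel" and null: "frontier K \<in> null_sets \<nu>"
  shows "(\<lambda>n. measure (\<mu> n) K) \<longlonglongrightarrow> measure \<nu> K"
proof -
  interpret \<nu>: prob_space \<nu> by fact
  note fin = prob_space.finite_measure[OF \<mu>(1)] \<mu>(2) prob_space.finite_measure[OF \<nu>(1)] \<nu>(2) conv
  have clos: "measure \<nu> (closure A) \<le> measure \<nu> A" if "A \<in> sets borel" "frontier A = frontier K" for A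
  proof -
    have "measure \<nu> (closure A) \<le> measure \<nu> (A \<union> frontier K)"
    proof (rule \<nu>.finite_measure_mono)
      show "closure A \<subseteq> A \<union> frontier K"
        using closure_Un_frontier[of A] that(2) by simp
    qed (use that(1) null_setsD2[OF null] \<nu>(2) in simp)
    also have "\<dots> = measure \<nu> A"
      by (rule measure_Un_null_set) (use that(1) null \<nu>(2) in auto)
    finally show ?thesis .
  qed
  have upper: "\<forall>\<^sub>F n in sequentially. measure (\<mu> n) A < b"
    if A: "A \<in> sets borel" "frontier A = frontier K" and b: "measure \<nu> A < b" for A b
  proof -
    have "\<forall>\<^sub>F n in sequentially. measure (\<mu> n) (closure A) < b"
      by (rule portmanteau_closed[OF fin]) (use clos[OF A] b in auto)
    then show ?thesis
    proof eventually_elim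
      case (elim n)
      interpret n: prob_space "\<mu> n" by (rule \<mu>)
      have "measure (\<mu> n) A \<le> measure (\<mu> n) (closure A)"
        by (rule n.finite_measure_mono) (auto simp: \<mu>(2) closure_subset)
      then show ?case using elim by simp
    qed
  qed
  show ?thesis
  proof (rule order_tendstoI)
    fix b assume "measure \<nu> K < b"
    then show "\<forall>\<^sub>F n in sequentially. measure (\<mu> n) K < b" using upper[of K b] K by simp
  next
    fix b assume b: "b < measure \<nu> K"
    have "measure \<nu> (- K) = 1 - measure \<nu> K"
      using \<nu>.prob_compl[of K] K \<nu>(2) sets_eq_imp_space_eq[OF \<nu>(2)] by (simp add: Compl_eq_Diff_UNIV)
    then have "\<forall>\<^sub>F n in sequentially. measure (\<mu> n) (- K) < 1 - b"
      using upper[of "- K" "1 - b"] K b by (simp add: frontier_complement)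
    then show "\<forall>\<^sub>F n in sequentially. b < measure (\<mu> n) K"
    proof eventually_elim
      case (elim n)
      interpret n: prob_space "\<mu> n" by (rule \<mu>)
      have "measure (\<mu> n) (- K) = 1 - measure (\<mu> n) K"
        using n.prob_compl[of K] K \<mu>(2) sets_eq_imp_space_eq[OF \<mu>(2)] by (simp add: Compl_eq_Diff_UNIV)
      then show ?case using elim by simp
    qed
  qed
qed

section \<open>Levy's continuity theorem in the plane\<close>

text \<open>The characters of the additive group of the plane: \<open>\<tau> \<bullet> w = Re (cnj \<tau> * w)\<close>.\<close>

definition plane_characters :: "(complex \<Rightarrow> complex) set" where
  "plane_characters = range (\<lambda>\<tau> w. cis (\<tau> \<bullet> w))"

lemma plane_characters_mult:
  "e \<in> plane_characters \<Longrightarrow> e' \<in> plane_characters \<Longrightarrow> (\<lambda>w. e w * e' w) \<in> plane_characters"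
proof -
  assume "e \<in> plane_characters" "e' \<in> plane_characters"
  then obtain \<tau> \<tau>' where "e = (\<lambda>w. cis (\<tau> \<bullet> w))" "e' = (\<lambda>w. cis (\<tau>' \<bullet> w))"
    by (auto simp: plane_characters_def)
  then have "(\<lambda>w. e w * e' w) = (\<lambda>w. cis ((\<tau> + \<tau>') \<bullet> w))"
    by (simp add: cis_mult inner_add_left)
  then show ?thesis by (simp add: plane_characters_def)
qed

lemma sin_in_char_span: "(\<lambda>w. complex_of_real (sin (\<tau> \<bullet> w))) \<in> char_span plane_characters"
proof -
  have "(\<lambda>w. (- \<i> / 2) * cis (\<tau> \<bullet> w) + (\<i> / 2) * cis ((- \<tau>) \<bullet> w)) \<in> char_span plane_characters"
    by (intro char_span.add char_span.base) (unfold plane_characters_def, rule rangeI, rule rangeI)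
  moreover have "(- \<i> / 2) * cis (\<tau> \<bullet> w) + (\<i> / 2) * cis ((- \<tau>) \<bullet> w) = complex_of_real (sin (\<tau> \<bullet> w))" for w
    by (simp add: complex_eq_iff)
  ultimately show ?thesis by simp
qed

text \<open>Approximating \<open>g\<close> on a large disc is not enough, since the approximant must also stay bounded off
the disc. Both are achieved at once by the periodic change of variables \<open>x \<mapsto> sin (x / R)\<close>: the
function \<open>g (R * arcsin s, R * arcsin t)\<close> is continuous on the whole square, a polynomial
approximates it there, and substituting the sines back gives a combination of exponentials that is
bounded everywhere. As \<open>1 < pi / 2\<close>, the arcsine undoes the sine on the disc of radius \<open>R\<close>.\<close>

lemma trigonometric_approximation:
  fixes g :: "complex \<Rightarrow> real"
  assumes cont: "continuous_on UNIV g" and B: "\<And>w. \<bar>g w\<bar> \<le> B" and "R > 0" "\<epsilon> > 0"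
  obtains p where "p \<in> char_span plane_characters"
    "\<And>w. cmod w \<le> R \<Longrightarrow> cmod (of_real (g w) - p w) \<le> \<epsilon>" "\<And>w. cmod (p w) \<le> B + \<epsilon>"
proof -
  \<comment> \<open>The range of the pair of sines, on which the transplanted function is defined by arcsines.\<close>
  define S where "S = cbox (Complex (-1) (-1)) (Complex 1 1)"
  define H where "H z = g (Complex (R * arcsin (Re z)) (R * arcsin (Im z)))" for z
  define \<phi> where "\<phi> w = Complex (sin (Re w / R)) (sin (Im w / R))" for w
  have "continuous_on S H"
    unfolding H_def
    by (rule continuous_on_compose2[OF cont])
       (auto simp: S_def in_cbox_complex_iff intro!: continuous_intros)
  moreover have "compact S" by (simp add: S_def)
  ultimately obtain q where q: "real_polynomial_function q" "\<And>z. z \<in> S \<Longrightarrow> \<bar>H z - q z\<bar> < \<epsilon>"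
    using Stone_Weierstrass_real_polynomial_function[of S H \<epsilon>] \<open>\<epsilon> > 0\<close> by metis
  have \<phi>: "\<phi> w \<in> S" for w
    by (simp add: \<phi>_def S_def in_cbox_complex_iff)
  show thesis
  proof (rule that[of "\<lambda>w. of_real (q (\<phi> w))"])
    have "(\<lambda>w. complex_of_real (Re (\<phi> w))) \<in> char_span plane_characters"
      using sin_in_char_span[of "of_real (1 / R)"] by (simp add: \<phi>_def inner_complex_def)
    moreover have "(\<lambda>w. complex_of_real (Im (\<phi> w))) \<in> char_span plane_characters"
      using sin_in_char_span[of "\<i> * of_real (1 / R)"] by (simp add: \<phi>_def inner_complex_def)
    moreover have "(\<lambda>w. 1) \<in> plane_characters"
      unfolding plane_characters_def by (rule range_eqI[of _ _ 0]) simp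
    ultimately show "(\<lambda>w. complex_of_real (q (\<phi> w))) \<in> char_span plane_characters"
      by (intro real_polynomial_in_char_span[OF q(1)] plane_characters_mult)
  next
    fix w assume w: "cmod w \<le> R"
    have arc: "R * arcsin (sin (x / R)) = x" if "\<bar>x\<bar> \<le> R" for x
    proof -
      have "\<bar>x / R\<bar> \<le> 1" using that \<open>R > 0\<close> by (simp add: field_simps)
      then have "- (pi / 2) \<le> x / R" "x / R \<le> pi / 2"
        using pi_gt3 by linarith+
      then show ?thesis using \<open>R > 0\<close> by (simp add: arcsin_sin)
    qed
    have "H (\<phi> w) = g w"
      using arc[of "Re w"] arc[of "Im w"] w abs_Re_le_cmod[of w] abs_Im_le_cmod[of w]
      by (simp add: H_def \<phi>_def complex_eq_iff)
    then show "cmod (of_real (g w) - of_real (q (\<phi> w))) \<le> \<epsilon>"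
      using q(2)[OF \<phi>, of w] by (simp flip: of_real_diff)
  next
    fix w
    have "\<bar>H (\<phi> w)\<bar> \<le> B" by (simp add: H_def B)
    then show "cmod (of_real (q (\<phi> w))) \<le> B + \<epsilon>"
      using q(2)[OF \<phi>, of w] by simp
  qed
qed

lemma char_span_plane_continuous_bounded:
  assumes "p \<in> char_span plane_characters"
  shows "continuous_on UNIV p \<and> (\<exists>C. \<forall>w. cmod (p w) \<le> C)"
  using assms
proof induction
  case (base e c)
  then show ?case
    by (auto simp: plane_characters_def norm_mult intro!: continuous_intros exI[of _ "cmod c"])
next
  case (add u v)
  then obtain C C' where "\<And>w. cmod (u w) \<le> C" "\<And>w. cmod (v w) \<le> C'" by auto
  then have "\<And>w. cmod (u w + v w) \<le> C + C'"
    by (meson add_mono norm_triangle_le)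
  with add show ?case by (auto intro!: continuous_intros)
qed

lemma integrable_bounded_continuous:
  fixes p :: "'a::metric_space \<Rightarrow> 'b::{banach, second_countable_topology}"
  assumes "finite_measure \<mu>" "sets \<mu> = sets borel" "continuous_on UNIV p" "\<And>w. norm (p w) \<le> C"
  shows "integrable \<mu> p"
proof -
  interpret finite_measure \<mu> by fact
  have "p \<in> borel_measurable \<mu>"
    using borel_measurable_continuous_onI[OF assms(3)] by (simp cong: measurable_cong_sets add: assms(2))
  then show ?thesis using assms(4) by (intro integrable_const_bound) auto
qed

lemma integral_char_span_tendsto:
  fixes \<mu> :: "nat \<Rightarrow> complex measure"
  assumes \<mu>: "\<And>n. finite_measure (\<mu> n)" "\<And>n. sets (\<mu> n) = sets borel"
    and \<nu>: "finite_measure \<nu>" "sets \<nu> = sets borel"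
    and conv: "\<And>\<tau>. (\<lambda>n. \<integral>w. cis (\<tau> \<bullet> w) \<partial>\<mu> n) \<longlonglongrightarrow> (\<integral>w. cis (\<tau> \<bullet> w) \<partial>\<nu>)"
    and p: "p \<in> char_span plane_characters"
  shows "(\<lambda>n. \<integral>w. p w \<partial>\<mu> n) \<longlonglongrightarrow> (\<integral>w. p w \<partial>\<nu>)"
  using p
proof induction
  case (base e c)
  then show ?case using conv by (auto simp: plane_characters_def intro!: tendsto_mult_left)
next
  case (add u v)
  have int: "integrable \<kappa> p"
    if "finite_measure \<kappa>" "sets \<kappa> = sets borel" "p \<in> char_span plane_characters" for \<kappa> p
    using char_span_plane_continuous_bounded[OF that(3)] integrable_bounded_continuous[OF that(1,2)]
        by blast
  show ?case
    using add by (simp add: int \<mu> \<nu>) (intro tendsto_add)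
qed

lemma tail_integral_bound:
  fixes u :: "complex \<Rightarrow> complex"
  assumes \<mu>: "prob_space \<mu>" "sets \<mu> = sets borel" and cont: "continuous_on UNIV u"
    and near: "\<And>w. cmod w \<le> R \<Longrightarrow> cmod (u w) \<le> \<epsilon>" and C: "\<And>w. cmod (u w) \<le> C" and "0 \<le> \<epsilon>"
  shows "cmod (\<integral>w. u w \<partial>\<mu>) \<le> \<epsilon> + C * measure \<mu> {w. R < cmod w}"
proof -
  interpret prob_space \<mu> by fact
  have sp: "space \<mu> = UNIV" using sets_eq_imp_space_eq[OF \<mu>(2)] by simp
  have S: "{w. R < cmod w} \<in> sets \<mu>" unfolding \<mu>(2) by measurable
  have C0: "0 \<le> C" using C[of 0] norm_ge_zero order_trans by blast
  have "cmod (\<integral>w. u w \<partial>\<mu>) \<le> (\<integral>w. cmod (u w) \<partial>\<mu>)" by simp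
  also have "\<dots> \<le> (\<integral>w. \<epsilon> + C * indicator {w. R < cmod w} w \<partial>\<mu>)"
  proof (rule integral_mono)
    show "integrable \<mu> (\<lambda>w. cmod (u w))"
      using integrable_bounded_continuous[OF finite_measure_axioms \<mu>(2) cont C] by simp
    show "integrable \<mu> (\<lambda>w. \<epsilon> + C * indicator {w. R < cmod w} w)"
      using S by (intro Bochner_Integration.integrable_add integrable_mult_right integrable_real_indicator)
        (auto simp: emeasure_eq_measure)
  next
    fix w
    show "cmod (u w) \<le> \<epsilon> + C * indicator {w. R < cmod w} w"
      using near[of w] C[of w] \<open>0 \<le> \<epsilon>\<close> by (cases "cmod w \<le> R") (auto simp: indicator_def)
  qed
  also have "\<dots> = \<epsilon> + C * measure \<mu> {w. R < cmod w}"
    using S sp prob_space by (subst Bochner_Integration.integral_add) (auto simp: emeasure_eq_measure)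
  finally show ?thesis .
qed

lemma tight_finite_measure:
  fixes \<nu> :: "complex measure"
  assumes "finite_measure \<nu>" "sets \<nu> = sets borel" "\<epsilon> > 0"
  shows "\<exists>R. \<forall>R'\<ge>R. measure \<nu> {w. R' < cmod w} \<le> \<epsilon>"
proof -
  interpret finite_measure \<nu> by fact
  have S: "{w. r < cmod w} \<in> sets \<nu>" for r unfolding assms(2) by measurable
  have "(\<lambda>n. measure \<nu> {w. real n < cmod w}) \<longlonglongrightarrow> measure \<nu> (\<Inter>n. {w. real n < cmod w})"
    by (rule finite_Lim_measure_decseq) (use S in \<open>auto simp: decseq_def\<close>)
  also have "(\<Inter>n. {w::complex. real n < cmod w}) = {}"
    using reals_Archimedean2 by (fastforce dest: less_asym)
  finally have "\<forall>\<^sub>F n in sequentially. measure \<nu> {w. real n < cmod w} < \<epsilon>"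
    using \<open>\<epsilon> > 0\<close> order_tendstoD(2) by force
  then obtain n :: nat where n: "measure \<nu> {w. real n < cmod w} < \<epsilon>"
    by (auto simp: eventually_sequentially)
  have "measure \<nu> {w. R' < cmod w} \<le> \<epsilon>" if "R' \<ge> real n" for R'
    using finite_measure_mono[of "{w. R' < cmod w}" "{w. real n < cmod w}"] S that n by fastforce
  then show ?thesis by blast
qed

text \<open>Convergence of characteristic functions passes to combinations of exponentials by linearity. A
bounded continuous \<open>g\<close> is uniformly close to such a combination on a disc outside of which, by
tightness, all the measures have little mass.\<close>

theorem levy_continuity_plane:
  fixes \<mu> :: "nat \<Rightarrow> complex measure" and g :: "complex \<Rightarrow> real"
  assumes \<mu>: "\<And>n. prob_space (\<mu> n)" "\<And>n. sets (\<mu> n) = sets borel"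
    and \<nu>: "prob_space \<nu>" "sets \<nu> = sets borel"
    and tight: "\<And>\<epsilon>. \<epsilon> > 0 \<Longrightarrow> \<exists>R. \<forall>R'\<ge>R. \<forall>n. measure (\<mu> n) {w. R' < cmod w} \<le> \<epsilon>"
    and conv: "\<And>\<tau>. (\<lambda>n. \<integral>w. cis (\<tau> \<bullet> w) \<partial>\<mu> n) \<longlonglongrightarrow> (\<integral>w. cis (\<tau> \<bullet> w) \<partial>\<nu>)"
    and g: "continuous_on UNIV g" "bounded (range g)"
  shows "(\<lambda>n. \<integral>w. g w \<partial>\<mu> n) \<longlonglongrightarrow> (\<integral>w. g w \<partial>\<nu>)"
proof (rule LIMSEQ_I)
  fix r :: real assume "r > 0"
  \<comment> \<open>Each of the two measures contributes an approximation error \<open>2 * \<epsilon>\<close>, the exponential sums a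
    further \<open>\<epsilon>\<close>.\<close>
  define \<epsilon> where "\<epsilon> = r / 5"
  have \<epsilon>: "\<epsilon> > 0" using \<open>r > 0\<close> by (simp add: \<epsilon>_def)
  obtain B where B: "\<And>w. \<bar>g w\<bar> \<le> B" using g(2) by (auto simp: bounded_iff)
  have "B \<ge> 0" using B[of 0] by linarith
  \<comment> \<open>A bound for the distance of \<open>g\<close> and its approximant off the disc; a tail of mass at most \<open>\<epsilon> / C\<close>
    costs \<open>\<epsilon>\<close>.\<close>
  define C where "C = 2 * B + \<epsilon>"
  have C: "C > 0" using \<open>B \<ge> 0\<close> \<epsilon> by (simp add: C_def)
  obtain R1 where R1: "\<And>R' n. R' \<ge> R1 \<Longrightarrow> measure (\<mu> n) {w. R' < cmod w} \<le> \<epsilon> / C"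
    using tight[of "\<epsilon> / C"] \<epsilon> C by auto
  obtain R2 where R2: "\<And>R'. R' \<ge> R2 \<Longrightarrow> measure \<nu> {w. R' < cmod w} \<le> \<epsilon> / C"
    using tight_finite_measure[OF prob_space.finite_measure[OF \<nu>(1)] \<nu>(2), of "\<epsilon> / C"] \<epsilon> C by auto
  define R where "R = max 1 (max R1 R2)"
  obtain p where p: "p \<in> char_span plane_characters"
    "\<And>w. cmod w \<le> R \<Longrightarrow> cmod (of_real (g w) - p w) \<le> \<epsilon>" "\<And>w. cmod (p w) \<le> B + \<epsilon>"
  proof (rule trigonometric_approximation[OF g(1) B])
    show "R > 0" by (simp add: R_def)
  qed (use \<epsilon> in auto)
  have pc: "continuous_on UNIV p" using char_span_plane_continuous_bounded[OF p(1)] by simp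
  have approx: "cmod (of_real (\<integral>w. g w \<partial>\<kappa>) - (\<integral>w. p w \<partial>\<kappa>)) \<le> 2 * \<epsilon>"
    if \<kappa>: "prob_space \<kappa>" "sets \<kappa> = sets borel" and t: "measure \<kappa> {w. R < cmod w} \<le> \<epsilon> / C" for \<kappa>
  proof -
    have fin: "finite_measure \<kappa>" using \<kappa>(1) by (rule prob_space.finite_measure)
    have "integrable \<kappa> p" "integrable \<kappa> g"
      using integrable_bounded_continuous[OF fin \<kappa>(2) pc p(3)]
        integrable_bounded_continuous[OF fin \<kappa>(2) g(1), of B] B by auto
    then have "of_real (\<integral>w. g w \<partial>\<kappa>) - (\<integral>w. p w \<partial>\<kappa>) = (\<integral>w. of_real (g w) - p w \<partial>\<kappa>)"
      by simp
    also have "cmod \<dots> \<le> \<epsilon> + C * measure \<kappa> {w. R < cmod w}"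
    proof (rule tail_integral_bound[OF \<kappa> _ p(2)])
      show "cmod (of_real (g w) - p w) \<le> C" for w
        using norm_triangle_ineq4[of "of_real (g w)" "p w"] B[of w] p(3)[of w] by (simp add: C_def)
    qed (use \<epsilon> g pc in \<open>auto intro!: continuous_intros\<close>)
    also have "\<dots> \<le> \<epsilon> + C * (\<epsilon> / C)"
      using t C by (intro add_left_mono mult_left_mono) auto
    finally show ?thesis using C by simp
  qed
  obtain n0 where n0: "\<And>n. n \<ge> n0 \<Longrightarrow> cmod ((\<integral>w. p w \<partial>\<mu> n) - (\<integral>w. p w \<partial>\<nu>)) < \<epsilon>"
    using LIMSEQ_D[OF integral_char_span_tendsto[OF prob_space.finite_measure[OF \<mu>(1)] \<mu>(2)
        prob_space.finite_measure[OF \<nu>(1)] \<nu>(2) conv p(1)] \<epsilon>] by auto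
  show "\<exists>n0. \<forall>n\<ge>n0. norm ((\<integral>w. g w \<partial>\<mu> n) - (\<integral>w. g w \<partial>\<nu>)) < r"
  proof (intro exI allI impI)
    fix n assume n: "n \<ge> n0"
    let ?g = "\<lambda>\<kappa>. complex_of_real (\<integral>w. g w \<partial>\<kappa>)" and ?p = "\<lambda>\<kappa>. \<integral>w. p w \<partial>\<kappa>"
    have "cmod (?g (\<mu> n) - ?p (\<mu> n)) \<le> 2 * \<epsilon>"
      by (rule approx[OF \<mu> R1]) (simp add: R_def)
    moreover have "cmod (?g \<nu> - ?p \<nu>) \<le> 2 * \<epsilon>"
      by (rule approx[OF \<nu> R2]) (simp add: R_def)
    moreover have "cmod (?g (\<mu> n) - ?g \<nu>)
        \<le> cmod (?g (\<mu> n) - ?p (\<mu> n)) + cmod (?p (\<mu> n) - ?p \<nu>) + cmod (?g \<nu> - ?p \<nu>)"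
      using norm_triangle_ineq4[of "(?g (\<mu> n) - ?p (\<mu> n)) + (?p (\<mu> n) - ?p \<nu>)" "?g \<nu> - ?p \<nu>"]
        norm_triangle_ineq[of "?g (\<mu> n) - ?p (\<mu> n)" "?p (\<mu> n) - ?p \<nu>"] by simp
    ultimately have "cmod (?g (\<mu> n) - ?g \<nu>) < 5 * \<epsilon>"
      using n0[OF n] by linarith
    then show "norm ((\<integral>w. g w \<partial>\<mu> n) - (\<integral>w. g w \<partial>\<nu>)) < r"
      by (simp add: \<epsilon>_def flip: of_real_diff)
  qed
qed

section \<open>The complex normal law\<close>

text \<open>Planar integrals become iterated integrals over the real and imaginary parts.\<close>

lemma lborel_complex_eq_distr:
  "(lborel :: complex measure) = distr (lborel \<Otimes>\<^sub>M lborel) borel (\<lambda>(x, y). Complex x y)"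
proof (rule lborel_eqI)
  fix l u :: complex assume le: "\<And>b. b \<in> Basis \<Longrightarrow> l \<bullet> b \<le> u \<bullet> b"
  have lu: "Re l \<le> Re u" "Im l \<le> Im u"
    using le[of 1] le[of \<i>] by (auto simp: Basis_complex_def)
  have meas: "(\<lambda>(x, y). Complex x y) \<in> borel_measurable (lborel \<Otimes>\<^sub>M lborel)"
    unfolding lborel_prod by (auto intro!: borel_measurable_continuous_onI continuous_intros simp:
        case_prod_beta)
  have "(\<lambda>(x, y). Complex x y) -` box l u = {Re l<..<Re u} \<times> {Im l<..<Im u}"
    by (auto simp: in_box_complex_iff)
  then have "emeasure (distr (lborel \<Otimes>\<^sub>M lborel) borel (\<lambda>(x, y). Complex x y)) (box l u)
      = emeasure (lborel \<Otimes>\<^sub>M lborel) ({Re l<..<Re u} \<times> {Im l<..<Im u})"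
    by (subst emeasure_distr[OF meas]) (auto simp: space_pair_measure)
  also have "\<dots> = ennreal (Re u - Re l) * ennreal (Im u - Im l)"
    using lu by (subst lborel.emeasure_pair_measure_Times) auto
  also have "\<dots> = ennreal (\<Prod>b\<in>Basis. (u - l) \<bullet> b)"
    using lu by (simp add: Basis_complex_def ennreal_mult)
  finally show "emeasure (distr (lborel \<Otimes>\<^sub>M lborel) borel (\<lambda>(x, y). Complex x y)) (box l u)
      = ennreal (\<Prod>b\<in>Basis. (u - l) \<bullet> b)" .
qed simp

text \<open>The density factorizes, so real and imaginary parts are independent centred normal variables of
variance \<open>v\<close>.\<close>

lemma complex_normal_eq_distr:
  assumes "v > 0"
  defines "G \<equiv> density lborel (\<lambda>x. ennreal (normal_density 0 (sqrt v) x))"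
  shows "complex_normal v = distr (G \<Otimes>\<^sub>M G) borel (\<lambda>(x, y). Complex x y)"
proof -
  have meas: "(\<lambda>(x, y). Complex x y) \<in> borel_measurable (lborel \<Otimes>\<^sub>M lborel)"
    unfolding lborel_prod by (auto intro!: borel_measurable_continuous_onI continuous_intros simp:
        case_prod_beta)
  have G: "G \<Otimes>\<^sub>M G = density (lborel \<Otimes>\<^sub>M lborel)
      (\<lambda>(x, y). ennreal (normal_density 0 (sqrt v) x) * ennreal (normal_density 0 (sqrt v) y))"
    unfolding G_def using prob_space_normal_density[of "sqrt v" 0] assms
    by (intro pair_measure_density) (auto simp: sigma_finite_lborel prob_space_imp_sigma_finite)
  have dens: "1 / (2 * pi * v) * exp (- (cmod (Complex x y))\<^sup>2 / (2 * v))
      = normal_density 0 (sqrt v) x * normal_density 0 (sqrt v) y" for x y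
  proof -
    have "sqrt (2 * pi * v) * sqrt (2 * pi * v) = 2 * pi * v"
      using assms by simp
    then show ?thesis using assms
      by (simp add: normal_density_def cmod_power2 add_divide_distrib diff_divide_distrib
          flip: exp_add)
  qed
  have "complex_normal v = density (distr (lborel \<Otimes>\<^sub>M lborel) borel (\<lambda>(x, y). Complex x y))
      (\<lambda>w. ennreal (1 / (2 * pi * v) * exp (- (cmod w)\<^sup>2 / (2 * v))))"
    unfolding complex_normal_def lborel_complex_eq_distr[symmetric] ..
  also have "\<dots> = distr (density (lborel \<Otimes>\<^sub>M lborel) (\<lambda>p. ennreal (1 / (2 * pi * v)
      * exp (- (cmod ((\<lambda>(x, y). Complex x y) p))\<^sup>2 / (2 * v))))) borel (\<lambda>(x, y). Complex x y)"
    by (rule density_distr[OF _ meas]) measurable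
  also have "(\<lambda>p. ennreal (1 / (2 * pi * v) * exp (- (cmod ((\<lambda>(x, y). Complex x y) p))\<^sup>2 / (2 * v))))
      = (\<lambda>(x, y). ennreal (normal_density 0 (sqrt v) x) * ennreal (normal_density 0 (sqrt v) y))"
    by (rule ext) (clarsimp simp only: dens prod.case ennreal_mult normal_density_nonneg split: prod.split)
  finally show ?thesis unfolding G .
qed

lemma measurable_Complex [measurable]:
  "(\<lambda>(x, y). Complex x y) \<in> borel_measurable (borel \<Otimes>\<^sub>M borel)"
  unfolding borel_prod by (auto intro!: borel_measurable_continuous_onI continuous_intros simp:
      case_prod_beta)

lemma prob_space_complex_normal:
  assumes "v > 0"
  shows "prob_space (complex_normal v)"
proof -
  let ?G = "density lborel (\<lambda>x. ennreal (normal_density 0 (sqrt v) x))"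
  interpret G: prob_space ?G using assms by (intro prob_space_normal_density) simp
  interpret GG: pair_prob_space ?G ?G ..
  show ?thesis unfolding complex_normal_eq_distr[OF assms]
    by (intro GG.prob_space_distr) measurable
qed

lemma integral_cis_normal_density:
  assumes "s > 0"
  shows "(\<integral>x. cis (t * x) \<partial>density lborel (\<lambda>x. ennreal (normal_density 0 s x)))
    = of_real (exp (- (s * t)\<^sup>2 / 2))"
proof -
  have "(\<integral>x. cis (t * x) \<partial>density lborel (\<lambda>x. ennreal (normal_density 0 s x)))
      = (\<integral>x. normal_density 0 s x *\<^sub>R cis (t * x) \<partial>lborel)"
    by (rule integral_density) (auto simp: normal_density_nonneg intro!: borel_measurable_continuous_onI
        continuous_intros)
  also have "\<dots> = s *\<^sub>R (\<integral>x. normal_density 0 s (0 + s * x) *\<^sub>R cis (t * (0 + s * x)) \<partial>lborel)"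
    using assms by (subst lborel_integral_real_affine[where c = s and t = 0]) auto
  also have "\<dots> = (\<integral>x. s *\<^sub>R normal_density 0 s (s * x) *\<^sub>R cis (t * (s * x)) \<partial>lborel)"
    by (simp only: integral_scaleR_right add_0)
  also have "\<dots> = (\<integral>x. std_normal_density x *\<^sub>R cis ((s * t) * x) \<partial>lborel)"
  proof (rule Bochner_Integration.integral_cong[OF refl])
    fix x
    have "s * normal_density 0 s (s * x) = std_normal_density x"
      using assms by (simp add: normal_density_def power_mult_distrib real_sqrt_mult)
    then show "s *\<^sub>R normal_density 0 s (s * x) *\<^sub>R cis (t * (s * x))
        = std_normal_density x *\<^sub>R cis ((s * t) * x)"
      by (simp add: mult_ac)
  qed
  also have "\<dots> = (\<integral>x. cis ((s * t) * x) \<partial>std_normal_distribution)"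
    by (rule integral_density[symmetric])
        (auto simp: normal_density_nonneg intro!: borel_measurable_continuous_onI continuous_intros)
  also have "\<dots> = char std_normal_distribution (s * t)"
    by (simp add: char_def cis_conv_exp)
  also have "\<dots> = of_real (exp (- (s * t)\<^sup>2 / 2))"
    by (simp add: char_std_normal_distribution)
  finally show ?thesis .
qed

lemma char_complex_normal:
  assumes "v > 0"
  shows "(\<integral>w. cis (\<tau> \<bullet> w) \<partial>complex_normal v) = of_real (exp (- v * (cmod \<tau>)\<^sup>2 / 2))"
proof -
  let ?G = "density lborel (\<lambda>x. ennreal (normal_density 0 (sqrt v) x))"
  interpret G: prob_space ?G using assms by (intro prob_space_normal_density) simp
  interpret GG: pair_prob_space ?G ?G ..
  have cis[measurable]: "cis \<in> borel_measurable borel"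
    by (intro borel_measurable_continuous_onI continuous_intros)
  have "(\<integral>w. cis (\<tau> \<bullet> w) \<partial>complex_normal v)
      = (\<integral>p. cis (\<tau> \<bullet> (\<lambda>(x, y). Complex x y) p) \<partial>(?G \<Otimes>\<^sub>M ?G))"
    unfolding complex_normal_eq_distr[OF assms] by (rule integral_distr) measurable
  also have "\<dots> = (\<integral>p. cis (Re \<tau> * fst p) * cis (Im \<tau> * snd p) \<partial>(?G \<Otimes>\<^sub>M ?G))"
    by (rule Bochner_Integration.integral_cong) (auto simp: inner_complex_def cis_mult)
  also have "\<dots> = (\<integral>x. \<integral>y. cis (Re \<tau> * x) * cis (Im \<tau> * y) \<partial>?G \<partial>?G)"
    by (subst GG.integral_fst'[symmetric])
      (auto intro!: GG.integrable_const_bound[where B = 1] simp: norm_mult)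
  also have "\<dots> = (\<integral>x. cis (Re \<tau> * x) \<partial>?G) * (\<integral>y. cis (Im \<tau> * y) \<partial>?G)"
    by simp
  also have "\<dots> = of_real (exp (- (sqrt v * Re \<tau>)\<^sup>2 / 2) * exp (- (sqrt v * Im \<tau>)\<^sup>2 / 2))"
    using assms by (simp add: integral_cis_normal_density)
  also have "exp (- (sqrt v * Re \<tau>)\<^sup>2 / 2) * exp (- (sqrt v * Im \<tau>)\<^sup>2 / 2) = exp (- v * (cmod \<tau>)\<^sup>2 / 2)"
    using assms by (simp add: cmod_power2 power_mult_distrib algebra_simps add_divide_distrib
        diff_divide_distrib flip: exp_add)
  finally show ?thesis .
qed

lemma measure_complex_normal:
  assumes "v > 0" "K \<in> sets borel"
  shows "measure (complex_normal v) K
    = 1 / (2 * pi * v) * (LINT w:K|lborel. exp (- (cmod w)\<^sup>2 / (2 * v)))"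
proof -
  interpret prob_space "complex_normal v" by (rule prob_space_complex_normal) fact
  have "measure (complex_normal v) K = (\<integral>w. indicator K w \<partial>complex_normal v)"
    using assms by (simp add: complex_normal_def)
  also have "\<dots> = (\<integral>w. (1 / (2 * pi * v) * exp (- (cmod w)\<^sup>2 / (2 * v))) *\<^sub>R indicator K w \<partial>lborel)"
    unfolding complex_normal_def using assms by (intro integral_density) auto
  also have "\<dots> = (\<integral>w. 1 / (2 * pi * v) * (indicator K w *\<^sub>R exp (- (cmod w)\<^sup>2 / (2 * v))) \<partial>lborel)"
    by (rule Bochner_Integration.integral_cong) (auto simp: mult_ac)
  also have "\<dots> = 1 / (2 * pi * v) * (LINT w:K|lborel. exp (- (cmod w)\<^sup>2 / (2 * v)))"
    unfolding set_lebesgue_integral_def by (rule integral_mult_right_zero)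
  finally show ?thesis .
qed

lemma null_sets_complex_normal: "A \<in> null_sets lborel \<Longrightarrow> A \<in> null_sets (complex_normal v)"
  unfolding complex_normal_def by (subst null_sets_density_iff) (auto dest: AE_not_in)

lemma sets_complex_normal [simp]: "sets (complex_normal v) = sets borel"
  by (simp add: complex_normal_def)

section \<open>Martingale differences for a map of the circle\<close>

lemma cmod_cis_diff_le: "cmod (cis x - cis y) \<le> \<bar>x - y\<bar>"
proof -
  have "cis x - cis y = cis y * (cis (x - y) - 1)"
    by (simp add: right_diff_distrib cis_mult)
  then have "cmod (cis x - cis y) = cmod (cis (x - y) - 1)"
    by (simp add: norm_mult)
  also have "\<dots> \<le> \<bar>x - y\<bar>"
    using iexp_approx1[of "x - y" 0] by (simp add: cis_conv_exp)
  finally show ?thesis .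
qed

lemma cmod_cis_taylor2: "cmod (cis x - (1 + \<i> * x - x\<^sup>2 / 2)) \<le> \<bar>x\<bar> ^ 3 / 6"
proof -
  have "(\<Sum>k\<le>2. (\<i> * complex_of_real x) ^ k / fact k) = 1 + \<i> * x - x\<^sup>2 / 2"
    by (simp add: numeral_2_eq_2 power_mult_distrib)
  then show ?thesis
    using iexp_approx1[of x 2] by (simp add: cis_conv_exp fact_numeral)
qed

text \<open>The measure lives on all Borel sets of the plane and is carried by the circle only almost
everywhere. This makes \<open>F\<close> a total Borel map of the plane, whose iterates are Borel on the same
space.\<close>

locale circle_map = prob_space M for M :: "complex measure" +
  fixes F :: "complex \<Rightarrow> complex"
  assumes sets_M: "sets M = sets borel"
    and measurable_F [measurable]: "F \<in> borel_measurable borel"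
    and cmod_F: "cmod (F z) = 1"
    and circle: "AE z in M. cmod z = 1"
begin

declare sets_M [measurable_cong]

lemma measurable_cnj [measurable]: "cnj \<in> borel_measurable borel"
  by (intro borel_measurable_continuous_onI continuous_intros)

lemma measurable_cis [measurable]: "cis \<in> borel_measurable borel"
  by (intro borel_measurable_continuous_onI continuous_intros)

lemma integrable_circle:
  fixes g :: "complex \<Rightarrow> 'b::{banach, second_countable_topology}"
  assumes "g \<in> borel_measurable borel" "\<And>z. cmod z = 1 \<Longrightarrow> norm (g z) \<le> B"
  shows "integrable M g"
  by (rule integrable_const_bound[where B = B]) (use assms circle in \<open>auto elim: AE_mp\<close>)

lemma integral_circle_cong:
  fixes g h :: "complex \<Rightarrow> 'b::{banach, second_countable_topology}"
  assumes "g \<in> borel_measurable borel" "h \<in> borel_measurable borel" "\<And>z. cmod z = 1 \<Longrightarrow> g z = h z"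
  shows "(\<integral>z. g z \<partial>M) = (\<integral>z. h z \<partial>M)"
  by (rule integral_cong_AE) (use assms circle in \<open>auto elim: AE_mp\<close>)

lemma norm_integral_circle:
  fixes g :: "complex \<Rightarrow> 'b::{banach, second_countable_topology}"
  assumes "g \<in> borel_measurable borel" "\<And>z. cmod z = 1 \<Longrightarrow> norm (g z) \<le> B"
  shows "norm (\<integral>z. g z \<partial>M) \<le> B"
proof -
  have "norm (\<integral>z. g z \<partial>M) \<le> (\<integral>z. norm (g z) \<partial>M)" by simp
  also have "\<dots> \<le> (\<integral>z. B \<partial>M)"
    by (rule integral_mono_AE) (use assms circle integrable_circle[OF assms] in \<open>auto elim: AE_mp\<close>)
  finally show ?thesis by (simp add: prob_space)
qed

end

text \<open>The relations say that \<open>cnj a * F\<close> and \<open>(cnj a)\<^sup>2 * F\<^sup>2 + cnj b * F\<close> are the conditional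
expectations of \<open>z\<close> and \<open>z\<^sup>2\<close> given \<open>F z\<close>, in integrated form and with the right-hand side
transported by invariance. For an inner function fixing 0, \<open>a = f'(0)\<close> and \<open>b = f''(0) / 2\<close>.\<close>

locale circle_transfer = circle_map M F for M :: "complex measure" and F :: "complex \<Rightarrow> complex" +
  fixes a b :: complex
  assumes cmod_a: "cmod a < 1"
    and invariant: "distr M borel F = M"
    and transfer1: "h \<in> borel_measurable borel \<Longrightarrow> (\<And>z. cmod z = 1 \<Longrightarrow> cmod (h z) \<le> B) \<Longrightarrow>
      (\<integral>z. z * h (F z) \<partial>M) = cnj a * (\<integral>z. z * h z \<partial>M)"
    and transfer2: "h \<in> borel_measurable borel \<Longrightarrow> (\<And>z. cmod z = 1 \<Longrightarrow> cmod (h z) \<le> B) \<Longrightarrow>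
      (\<integral>z. z\<^sup>2 * h (F z) \<partial>M) = (\<integral>z. ((cnj a)\<^sup>2 * z\<^sup>2 + cnj b * z) * h z \<partial>M)"
begin

lemma transfer0:
  fixes h :: "complex \<Rightarrow> complex"
  assumes "h \<in> borel_measurable borel"
  shows "(\<integral>z. h (F z) \<partial>M) = (\<integral>z. h z \<partial>M)"
  by (subst (2) invariant[symmetric], subst integral_distr) (use assms in auto)

lemma transfer1_cnj:
  assumes [measurable]: "h \<in> borel_measurable borel" and h: "\<And>z. cmod z = 1 \<Longrightarrow> cmod (h z) \<le> B"
  shows "(\<integral>z. cnj z * h (F z) \<partial>M) = a * (\<integral>z. cnj z * h z \<partial>M)"
proof -
  have "(\<integral>z. z * cnj (h (F z)) \<partial>M) = cnj a * (\<integral>z. z * cnj (h z) \<partial>M)"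
    by (rule transfer1[where B = B]) (use h in auto)
  then have "cnj (\<integral>z. cnj (z * cnj (h (F z))) \<partial>M) = cnj (a * (\<integral>z. cnj (z * cnj (h z)) \<partial>M))"
    unfolding Bochner_Integration.integral_cnj by simp
  then show ?thesis unfolding complex_cnj_cancel_iff by simp
qed

text \<open>The part of the coordinate \<open>z\<close> that is not predicted by \<open>F z\<close>. Along the orbit of \<open>F\<close> these are
the differences of a reversed martingale.\<close>

definition \<xi> :: "complex \<Rightarrow> complex" where "\<xi> z = z - cnj a * F z"

lemma measurable_\<xi> [measurable]: "\<xi> \<in> borel_measurable borel"
  unfolding \<xi>_def by measurable

lemma cmod_\<xi>: "cmod z = 1 \<Longrightarrow> cmod (\<xi> z) \<le> 2"
  unfolding \<xi>_def using norm_triangle_ineq4[of z "cnj a * F z"] cmod_a by (simp add: norm_mult cmod_F)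

context
  fixes h :: "complex \<Rightarrow> complex" and B :: real
  assumes h [measurable]: "h \<in> borel_measurable borel" and hB: "\<And>z. cmod z = 1 \<Longrightarrow> cmod (h z) \<le> B"
begin

lemma integrable_h:
  assumes "\<And>z. cmod z = 1 \<Longrightarrow> cmod (g z) \<le> C" "g \<in> borel_measurable borel"
  shows "integrable M (\<lambda>z. g z * h (F z))" "integrable M (\<lambda>z. g z * h z)"
proof -
  have "integrable M (\<lambda>z. g z * k z)"
    if "\<And>z. cmod z = 1 \<Longrightarrow> cmod (k z) \<le> B" "k \<in> borel_measurable borel" for k
    by (rule integrable_circle[where B = "C * B"])
      (use that assms in \<open>auto simp: norm_mult intro!: mult_mono order_trans[OF norm_ge_zero]\<close>)
  from this[of "\<lambda>z. h (F z)"] this[of h] show "integrable M (\<lambda>z. g z * h (F z))"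
      "integrable M (\<lambda>z. g z * h z)"
    using hB by (auto simp: cmod_F)
qed

lemma hB': "cmod z = 1 \<Longrightarrow> cmod (z * h z) \<le> B" "cmod z = 1 \<Longrightarrow> cmod (cnj z * h z) \<le> B"
  using hB by (auto simp: norm_mult)

text \<open>Orthogonality to every function of \<open>F z\<close>: by invariance \<open>F z * h (F z)\<close> has the integral of
\<open>z * h z\<close>, and the first transfer relation says that \<open>z * h (F z)\<close> integrates to \<open>cnj a\<close> times
that.\<close>

lemma martingale_difference: "(\<integral>z. \<xi> z * h (F z) \<partial>M) = 0"
proof -
  have "(\<integral>z. \<xi> z * h (F z) \<partial>M) = (\<integral>z. z * h (F z) - cnj a * (F z * h (F z)) \<partial>M)"
    by (simp add: \<xi>_def algebra_simps)
  also have "\<dots> = (\<integral>z. z * h (F z) \<partial>M) - cnj a * (\<integral>z. F z * h (F z) \<partial>M)"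
    by (subst Bochner_Integration.integral_diff)
      (auto intro!: integrable_h(1)[where C = 1] simp: cmod_F)
  also have "\<dots> = 0"
    using transfer0[of "\<lambda>z. z * h z"] by (simp add: transfer1[OF h hB])
  finally show ?thesis .
qed

text \<open>The terms containing \<open>(cnj a)\<^sup>2\<close> cancel; only the contribution of the second Taylor coefficient
remains.\<close>

lemma conditional_square: "(\<integral>z. (\<xi> z)\<^sup>2 * h (F z) \<partial>M) = cnj b * (\<integral>z. z * h z \<partial>M)"
proof -
  note int = integrable_h[where C = 1]
  have "(\<integral>z. (\<xi> z)\<^sup>2 * h (F z) \<partial>M)
      = (\<integral>z. z\<^sup>2 * h (F z) - 2 * cnj a * (z * (F z * h (F z))) + (cnj a)\<^sup>2 * ((F z)\<^sup>2 * h (F z)) \<partial>M)"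
    by (simp add: \<xi>_def algebra_simps power2_eq_square)
  also have "\<dots> = (\<integral>z. z\<^sup>2 * h (F z) \<partial>M) - 2 * cnj a * (\<integral>z. z * (F z * h (F z)) \<partial>M)
      + (cnj a)\<^sup>2 * (\<integral>z. (F z)\<^sup>2 * h (F z) \<partial>M)"
  proof -
    have "integrable M (\<lambda>z. z\<^sup>2 * h (F z))" "integrable M (\<lambda>z. (F z)\<^sup>2 * h (F z))"
      by (intro int; simp add: norm_power cmod_F)+
    moreover have "integrable M (\<lambda>z. z * (F z * h (F z)))"
      using int(1)[of "\<lambda>z. z * F z"] by (simp add: norm_mult cmod_F mult_ac)
    ultimately show ?thesis by simp
  qed
  also have "(\<integral>z. z * (F z * h (F z)) \<partial>M) = cnj a * (\<integral>z. z * (z * h z) \<partial>M)"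
    by (rule transfer1) (use hB' in auto)
  also have "(\<integral>z. (F z)\<^sup>2 * h (F z) \<partial>M) = (\<integral>z. z\<^sup>2 * h z \<partial>M)"
    by (rule transfer0) measurable
  also have "(\<integral>z. z\<^sup>2 * h (F z) \<partial>M) = (\<integral>z. (cnj a)\<^sup>2 * (z\<^sup>2 * h z) + cnj b * (z * h z) \<partial>M)"
    by (subst transfer2[OF h hB]) (auto simp: algebra_simps)
  also have "\<dots> = (cnj a)\<^sup>2 * (\<integral>z. z\<^sup>2 * h z \<partial>M) + cnj b * (\<integral>z. z * h z \<partial>M)"
    by (subst Bochner_Integration.integral_add) (auto intro!: int simp: norm_power)
  finally show ?thesis by (simp add: power2_eq_square mult_ac)
qed

text \<open>As \<open>z\<close> and \<open>F z\<close> have modulus 1, the squared modulus of \<open>\<xi>\<close> is a constant minus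
\<open>a * z * cnj (F z)\<close> and the conjugate of this term. The first transfer relation integrates both,
so the conditional variance is constant.\<close>

lemma conditional_norm: "(\<integral>z. of_real ((cmod (\<xi> z))\<^sup>2) * h (F z) \<partial>M)
    = of_real (1 - (cmod a)\<^sup>2) * (\<integral>z. h z \<partial>M)"
proof -
  note int = integrable_h[where C = 1]
  have "(\<integral>z. of_real ((cmod (\<xi> z))\<^sup>2) * h (F z) \<partial>M)
      = (\<integral>z. of_real (1 + (cmod a)\<^sup>2) * h (F z) - a * (z * (cnj (F z) * h (F z)))
          - cnj a * (cnj z * (F z * h (F z))) \<partial>M)"
  proof (rule integral_circle_cong)
    fix z assume z: "cmod z = 1"
    have 1: "z * cnj z = 1" "F z * cnj (F z) = 1" "a * cnj a = of_real ((cmod a)\<^sup>2)"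
      using z by (simp_all add: complex_norm_square[symmetric] cmod_F)
    have "of_real ((cmod (\<xi> z))\<^sup>2) = z * cnj z + (a * cnj a) * (F z * cnj (F z)) - a * (z * cnj (F z))
        - cnj a * (cnj z * F z)"
      unfolding complex_norm_square \<xi>_def by (simp add: algebra_simps)
    also have "\<dots> = of_real (1 + (cmod a)\<^sup>2) - a * (z * cnj (F z)) - cnj a * (cnj z * F z)"
      unfolding 1 by simp
    finally have X: "of_real ((cmod (\<xi> z))\<^sup>2) = of_real (1 + (cmod a)\<^sup>2) - a * (z * cnj (F z))
        - cnj a * (cnj z * F z)" .
    show "of_real ((cmod (\<xi> z))\<^sup>2) * h (F z) = of_real (1 + (cmod a)\<^sup>2) * h (F z)
        - a * (z * (cnj (F z) * h (F z)))
          - cnj a * (cnj z * (F z * h (F z)))"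
      unfolding X by (simp add: algebra_simps del: of_real_add)
  qed measurable
  also have "\<dots> = of_real (1 + (cmod a)\<^sup>2) * (\<integral>z. h (F z) \<partial>M) - a * (\<integral>z. z * (cnj (F z) * h (F z)) \<partial>M)
      - cnj a * (\<integral>z. cnj z * (F z * h (F z)) \<partial>M)"
  proof -
    have "integrable M (\<lambda>z. h (F z))"
      using int(1)[of "\<lambda>_. 1"] by simp
    moreover have "integrable M (\<lambda>z. z * (cnj (F z) * h (F z)))"
        "integrable M (\<lambda>z. cnj z * (F z * h (F z)))"
      using int(1)[of "\<lambda>z. z * cnj (F z)"] int(1)[of "\<lambda>z. cnj z * F z"]
          by (simp_all add: norm_mult cmod_F mult_ac)
    ultimately show ?thesis by simp
  qed
  also have "(\<integral>z. z * (cnj (F z) * h (F z)) \<partial>M) = cnj a * (\<integral>z. z * (cnj z * h z) \<partial>M)"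
    by (rule transfer1) (use hB' in auto)
  also have "(\<integral>z. z * (cnj z * h z) \<partial>M) = (\<integral>z. h z \<partial>M)"
    by (rule integral_circle_cong) (auto simp: complex_norm_square[symmetric] mult.assoc[symmetric])
  also have "(\<integral>z. cnj z * (F z * h (F z)) \<partial>M) = a * (\<integral>z. cnj z * (z * h z) \<partial>M)"
    by (rule transfer1_cnj) (use hB' in auto)
  also have "(\<integral>z. cnj z * (z * h z) \<partial>M) = (\<integral>z. h z \<partial>M)"
    by (rule integral_circle_cong)
      (auto simp: complex_norm_square[symmetric] mult.assoc[symmetric] mult.commute[of "cnj _"])
  also have "(\<integral>z. h (F z) \<partial>M) = (\<integral>z. h z \<partial>M)" by (rule transfer0) measurable
  also have "of_real (1 + (cmod a)\<^sup>2) * (\<integral>z. h z \<partial>M) - a * (cnj a * (\<integral>z. h z \<partial>M))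
      - cnj a * (a * (\<integral>z. h z \<partial>M))
      = of_real (1 - (cmod a)\<^sup>2) * (\<integral>z. h z \<partial>M)"
    by (simp only: of_real_add of_real_diff complex_norm_square) (simp add: algebra_simps)
  finally show ?thesis .
qed

end

lemma conjugate_relations:
  assumes [measurable]: "h \<in> borel_measurable borel" and hB: "\<And>z. cmod z = 1 \<Longrightarrow> cmod (h z) \<le> B"
  shows "(\<integral>z. cnj (\<xi> z) * h (F z) \<partial>M) = 0"
    and "(\<integral>z. (cnj (\<xi> z))\<^sup>2 * h (F z) \<partial>M) = b * (\<integral>z. cnj z * h z \<partial>M)"
proof -
  have h': "(\<lambda>z. cnj (h z)) \<in> borel_measurable borel" "\<And>z. cmod z = 1 \<Longrightarrow> cmod (cnj (h z)) \<le> B"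
    using hB by auto
  have "cnj (\<integral>z. \<xi> z * cnj (h (F z)) \<partial>M) = 0"
    using martingale_difference[OF h'] by simp
  then show "(\<integral>z. cnj (\<xi> z) * h (F z) \<partial>M) = 0"
    by (simp flip: Bochner_Integration.integral_cnj)
  have "cnj (\<integral>z. (\<xi> z)\<^sup>2 * cnj (h (F z)) \<partial>M) = cnj (cnj b * (\<integral>z. z * cnj (h z) \<partial>M))"
    using conditional_square[OF h'] by simp
  then show "(\<integral>z. (cnj (\<xi> z))\<^sup>2 * h (F z) \<partial>M) = b * (\<integral>z. cnj z * h z \<partial>M)"
    by (simp flip: Bochner_Integration.integral_cnj)
qed

text \<open>The real projection of \<open>\<xi>\<close> in the direction prescribed by \<open>c\<close>; characteristic functions of planar
variables are built from such projections.\<close>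

definition \<eta> :: "complex \<Rightarrow> complex \<Rightarrow> real" where "\<eta> c z = Re (c * \<xi> z)"

lemma measurable_\<eta> [measurable]: "\<eta> c \<in> borel_measurable borel"
  unfolding \<eta>_def by measurable

lemma abs_\<eta>: "cmod z = 1 \<Longrightarrow> \<bar>\<eta> c z\<bar> \<le> 2 * cmod c"
  unfolding \<eta>_def using abs_Re_le_cmod[of "c * \<xi> z"] mult_left_mono[OF cmod_\<xi>[of z], of "cmod c"]
  by (simp add: norm_mult)

lemma integral_\<eta>:
  assumes h [measurable]: "h \<in> borel_measurable borel" and hB: "\<And>z. cmod z = 1 \<Longrightarrow> cmod (h z) \<le> B"
  shows "(\<integral>z. of_real (\<eta> c z) * h (F z) \<partial>M) = 0"
proof -
  have Re: "complex_of_real (Re w) = (w + cnj w) / 2" for w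
    by (simp add: complex_eq_iff)
  have int: "integrable M (\<lambda>z. \<xi> z * h (F z))" "integrable M (\<lambda>z. cnj (\<xi> z) * h (F z))"
    by (rule integrable_h(1)[OF h hB, where C = 2]; use cmod_\<xi> in simp)+
  have "(\<integral>z. of_real (\<eta> c z) * h (F z) \<partial>M)
      = (\<integral>z. c / 2 * (\<xi> z * h (F z)) + cnj c / 2 * (cnj (\<xi> z) * h (F z)) \<partial>M)"
    unfolding \<eta>_def Re by (simp add: field_simps)
  also have "\<dots> = c / 2 * (\<integral>z. \<xi> z * h (F z) \<partial>M) + cnj c / 2 * (\<integral>z. cnj (\<xi> z) * h (F z) \<partial>M)"
    using int by simp
  finally show ?thesis
    by (simp add: martingale_difference[OF h hB] conjugate_relations[OF h hB])
qed

lemma integral_\<eta>_square: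
  assumes h [measurable]: "h \<in> borel_measurable borel" and hB: "\<And>z. cmod z = 1 \<Longrightarrow> cmod (h z) \<le> B"
  shows "(\<integral>z. of_real ((\<eta> c z)\<^sup>2) * h (F z) \<partial>M)
    = of_real ((cmod c)\<^sup>2 * (1 - (cmod a)\<^sup>2) / 2) * (\<integral>z. h z \<partial>M)
      + c\<^sup>2 * cnj b / 4 * (\<integral>z. z * h z \<partial>M) + (cnj c)\<^sup>2 * b / 4 * (\<integral>z. cnj z * h z \<partial>M)"
proof -
  have Re: "complex_of_real ((Re w)\<^sup>2) = w\<^sup>2 / 4 + of_real ((cmod w)\<^sup>2) / 2 + (cnj w)\<^sup>2 / 4" for w
    unfolding complex_norm_square by (simp add: complex_eq_iff power2_eq_square field_simps)
  have sq: "cmod (\<xi> z) ^ 2 \<le> 4" if "cmod z = 1" for z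
    using power_mono[OF cmod_\<xi>[OF that], of 2] by simp
  have int: "integrable M (\<lambda>z. (\<xi> z)\<^sup>2 * h (F z))" "integrable M (\<lambda>z. (cnj (\<xi> z))\<^sup>2 * h (F z))"
    "integrable M (\<lambda>z. of_real ((cmod (\<xi> z))\<^sup>2) * h (F z))"
    by (rule integrable_h(1)[OF h hB, where C = 4]; use sq in \<open>simp add: norm_power\<close>)+
  have "(\<integral>z. of_real ((\<eta> c z)\<^sup>2) * h (F z) \<partial>M)
      = (\<integral>z. c\<^sup>2 / 4 * ((\<xi> z)\<^sup>2 * h (F z)) + of_real ((cmod c)\<^sup>2 / 2) * (of_real ((cmod (\<xi> z))\<^sup>2) * h (F z))
          + (cnj c)\<^sup>2 / 4 * ((cnj (\<xi> z))\<^sup>2 * h (F z)) \<partial>M)"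
    unfolding \<eta>_def Re by (simp add: field_simps power_mult_distrib norm_mult)
  also have "\<dots> = c\<^sup>2 / 4 * (\<integral>z. (\<xi> z)\<^sup>2 * h (F z) \<partial>M)
      + of_real ((cmod c)\<^sup>2 / 2) * (\<integral>z. of_real ((cmod (\<xi> z))\<^sup>2) * h (F z) \<partial>M)
      + (cnj c)\<^sup>2 / 4 * (\<integral>z. (cnj (\<xi> z))\<^sup>2 * h (F z) \<partial>M)"
    using int by simp
  also have "\<dots> = of_real ((cmod c)\<^sup>2 * (1 - (cmod a)\<^sup>2) / 2) * (\<integral>z. h z \<partial>M)
      + c\<^sup>2 * cnj b / 4 * (\<integral>z. z * h z \<partial>M) + (cnj c)\<^sup>2 * b / 4 * (\<integral>z. cnj z * h z \<partial>M)"
  proof -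
    have sq: "(\<integral>z. (\<xi> z)\<^sup>2 * h (F z) \<partial>M) = cnj b * (\<integral>z. z * h z \<partial>M)"
      by (rule conditional_square[OF h]) (rule hB)
    have nrm: "(\<integral>z. of_real ((cmod (\<xi> z))\<^sup>2) * h (F z) \<partial>M) = of_real (1 - (cmod a)\<^sup>2) * (\<integral>z. h z \<partial>M)"
      by (rule conditional_norm[OF h]) (rule hB)
    have csq: "(\<integral>z. (cnj (\<xi> z))\<^sup>2 * h (F z) \<partial>M) = b * (\<integral>z. cnj z * h z \<partial>M)"
      by (rule conjugate_relations(2)[OF h]) (rule hB)
    show ?thesis unfolding sq nrm csq by (simp add: field_simps)
  qed
  finally show ?thesis .
qed

definition proj_sum :: "complex \<Rightarrow> nat \<Rightarrow> complex \<Rightarrow> real" where "proj_sum c n z = (\<Sum>k<n. \<eta> c ((F ^^ k) z))"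

lemma measurable_funpow_F [measurable]: "(F ^^ n) \<in> borel_measurable borel"
  by (induction n) (auto intro: measurable_compose[OF _ measurable_F] simp: comp_def)

lemma measurable_proj_sum [measurable]: "proj_sum c n \<in> borel_measurable borel"
  unfolding proj_sum_def by measurable

lemma proj_sum_0 [simp]: "proj_sum c 0 z = 0" and proj_sum_Suc: "proj_sum c (Suc n) z = \<eta> c z
    + proj_sum c n (F z)"
  unfolding proj_sum_def by (simp, subst sum.lessThan_Suc_shift, simp add: funpow_Suc_right del:
      funpow.simps(2))

text \<open>Splitting off the first factor of the exponential costs at most \<open>\<bar>\<epsilon>\<bar> * 2\<bar>c\<bar>\<close>; what remains is a
function of \<open>F z\<close>, on which the first transfer relation contracts the correlation with \<open>z\<close> by
\<open>\<bar>a\<bar>\<close>. Summing the costs with geometric weights gives the second term.\<close>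

lemma correlation_decay:
  "cmod (\<integral>z. z * cis (\<epsilon> * proj_sum c n z) \<partial>M) \<le> cmod a ^ n + \<bar>\<epsilon>\<bar> * (2 * cmod c) / (1 - cmod a)"
proof (induction n)
  case 0
  have "cmod (\<integral>z. z * cis (\<epsilon> * proj_sum c 0 z) \<partial>M) \<le> 1"
    by (rule norm_integral_circle) auto
  moreover have "0 \<le> \<bar>\<epsilon>\<bar> * (2 * cmod c) / (1 - cmod a)" using cmod_a by simp
  ultimately show ?case by simp
next
  case (Suc n)
  let ?d = "\<bar>\<epsilon>\<bar> * (2 * cmod c)" and ?E = "\<lambda>z. cis (\<epsilon> * proj_sum c n z)"
  have "(\<integral>z. z * cis (\<epsilon> * proj_sum c (Suc n) z) \<partial>M)
      = (\<integral>z. z * ?E (F z) + z * ((cis (\<epsilon> * \<eta> c z) - 1) * ?E (F z)) \<partial>M)"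
  proof (rule Bochner_Integration.integral_cong[OF refl])
    fix z
    have "cis (\<epsilon> * proj_sum c (Suc n) z) = cis (\<epsilon> * \<eta> c z) * ?E (F z)"
      by (simp add: proj_sum_Suc cis_mult distrib_left)
    then show "z * cis (\<epsilon> * proj_sum c (Suc n) z) = z * ?E (F z) + z * ((cis (\<epsilon> * \<eta> c z) - 1) * ?E (F z))"
      by (simp add: algebra_simps)
  qed
  also have "\<dots> = (\<integral>z. z * ?E (F z) \<partial>M) + (\<integral>z. z * ((cis (\<epsilon> * \<eta> c z) - 1) * ?E (F z)) \<partial>M)"
  proof (rule Bochner_Integration.integral_add)
    show "integrable M (\<lambda>z. z * ?E (F z))"
      by (rule integrable_circle[where B = 1]) (auto simp: norm_mult)
    have "cmod (cis x - 1) \<le> 2" for x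
      using norm_triangle_ineq4[of "cis x" 1] by simp
    then show "integrable M (\<lambda>z. z * ((cis (\<epsilon> * \<eta> c z) - 1) * ?E (F z)))"
      by (intro integrable_circle[where B = 2]) (simp_all add: norm_mult)
  qed
  also have "(\<integral>z. z * ?E (F z) \<partial>M) = cnj a * (\<integral>z. z * ?E z \<partial>M)"
    by (rule transfer1[where B = 1]) auto
  finally have split: "(\<integral>z. z * cis (\<epsilon> * proj_sum c (Suc n) z) \<partial>M)
      = cnj a * (\<integral>z. z * ?E z \<partial>M) + (\<integral>z. z * ((cis (\<epsilon> * \<eta> c z) - 1) * ?E (F z)) \<partial>M)" .
  have "cmod (\<integral>z. z * ((cis (\<epsilon> * \<eta> c z) - 1) * ?E (F z)) \<partial>M) \<le> ?d"
  proof (rule norm_integral_circle)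
    fix z assume z: "cmod z = 1"
    have "cmod (cis (\<epsilon> * \<eta> c z) - 1) \<le> \<bar>\<epsilon>\<bar> * \<bar>\<eta> c z\<bar>"
      using cmod_cis_diff_le[of "\<epsilon> * \<eta> c z" 0] by (simp add: abs_mult)
    also have "\<dots> \<le> ?d" using abs_\<eta>[OF z] by (intro mult_left_mono) auto
    finally show "cmod (z * ((cis (\<epsilon> * \<eta> c z) - 1) * ?E (F z))) \<le> ?d"
      using z by (simp add: norm_mult)
  qed measurable
  moreover have "cmod (cnj a * (\<integral>z. z * ?E z \<partial>M)) \<le> cmod a * (cmod a ^ n + ?d / (1 - cmod a))"
    unfolding norm_mult complex_mod_cnj by (intro mult_left_mono Suc.IH) auto
  moreover have "cmod a * (cmod a ^ n + ?d / (1 - cmod a)) + ?d = cmod a ^ Suc n + ?d / (1 - cmod a)"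
    using cmod_a by (simp add: field_simps)
  ultimately show ?case unfolding split
    using norm_triangle_ineq[of "cnj a * (\<integral>z. z * ?E z \<partial>M)" "\<integral>z. z * ((cis (\<epsilon> * \<eta> c z) - 1) * ?E (F z)) \<partial>M"]
    by linarith
qed

lemma correlation_decay_cnj:
  "cmod (\<integral>z. cnj z * cis (\<epsilon> * proj_sum c n z) \<partial>M) \<le> cmod a ^ n + \<bar>\<epsilon>\<bar> * (2 * cmod c) / (1 - cmod a)"
proof -
  have "(\<integral>z. cnj z * cis (\<epsilon> * proj_sum c n z) \<partial>M) = cnj (\<integral>z. z * cis ((- \<epsilon>) * proj_sum c n z) \<partial>M)"
    by (simp add: cis_cnj flip: Bochner_Integration.integral_cnj)
  then show ?thesis using correlation_decay[of "- \<epsilon>" c n] by simp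
qed

end

section \<open>Characteristic functions and second moments of the martingale\<close>

context circle_transfer begin

definition variance_rate :: "complex \<Rightarrow> real" where
  "variance_rate c = (cmod c)\<^sup>2 * (1 - (cmod a)\<^sup>2) / 2"

text \<open>The error made when one step of the martingale is replaced by its Gaussian counterpart: a term of
order \<open>\<epsilon>\<^sup>2\<close> weighted by the bound of \<open>correlation_decay\<close>, and the cubic Taylor remainder.\<close>

definition step_error :: "complex \<Rightarrow> real \<Rightarrow> nat \<Rightarrow> real" where
  "step_error c \<epsilon> n = \<epsilon>\<^sup>2 * (cmod c)\<^sup>2 * cmod b / 4 * (cmod a ^ n + \<bar>\<epsilon>\<bar> * (2 * cmod c) / (1 - cmod a))
     + (\<bar>\<epsilon>\<bar> * (2 * cmod c)) ^ 3 / 6"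

text \<open>Expand the exponential of the first difference to second order. The linear term vanishes by the
martingale property, the quadratic term yields the factor \<open>1 - s * \<epsilon>\<^sup>2 / 2\<close> through the constant
conditional variance, and the non-constant part of the conditional square is a multiple of a
decaying correlation.\<close>

lemma charfun_step:
  "cmod ((\<integral>z. cis (\<epsilon> * proj_sum c (Suc n) z) \<partial>M)
      - of_real (1 - variance_rate c * \<epsilon>\<^sup>2 / 2) * (\<integral>z. cis (\<epsilon> * proj_sum c n z) \<partial>M))
    \<le> step_error c \<epsilon> n"
proof -
  let ?d = "\<bar>\<epsilon>\<bar> * (2 * cmod c)" and ?E = "\<lambda>z. cis (\<epsilon> * proj_sum c n z)"
  let ?D = "cmod a ^ n + \<bar>\<epsilon>\<bar> * (2 * cmod c) / (1 - cmod a)"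
  \<comment> \<open>The third-order remainder of the exponential of the first difference.\<close>
  define r where "r z = cis (\<epsilon> * \<eta> c z) - (1 + \<i> * of_real (\<epsilon> * \<eta> c z) - of_real ((\<epsilon> * \<eta> c z)\<^sup>2) / 2)" for z
  have [measurable]: "r \<in> borel_measurable borel" unfolding r_def by measurable
  have r: "cmod (r z) \<le> ?d ^ 3 / 6" if z: "cmod z = 1" for z
  proof -
    have "cmod (r z) \<le> \<bar>\<epsilon> * \<eta> c z\<bar> ^ 3 / 6"
      using cmod_cis_taylor2[of "\<epsilon> * \<eta> c z"] by (simp add: r_def)
    also have "\<bar>\<epsilon> * \<eta> c z\<bar> ^ 3 \<le> ?d ^ 3"
      using abs_\<eta>[OF z] by (intro power_mono) (auto simp: abs_mult intro: mult_left_mono)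
    finally show ?thesis by simp
  qed
  have int: "integrable M (\<lambda>z. ?E (F z))" "integrable M (\<lambda>z. of_real (\<eta> c z) * ?E (F z))"
    "integrable M (\<lambda>z. of_real ((\<eta> c z)\<^sup>2) * ?E (F z))" "integrable M (\<lambda>z. r z * ?E (F z))"
  proof -
    show "integrable M (\<lambda>z. ?E (F z))" by (rule integrable_circle[where B = 1]) auto
    show "integrable M (\<lambda>z. of_real (\<eta> c z) * ?E (F z))"
      by (rule integrable_circle[where B = "2 * cmod c"]) (auto simp: norm_mult abs_\<eta>)
    show "integrable M (\<lambda>z. of_real ((\<eta> c z)\<^sup>2) * ?E (F z))"
    proof (rule integrable_circle[where B = "(2 * cmod c)\<^sup>2"])
      fix z assume "cmod z = 1"
      then have "\<bar>\<eta> c z\<bar>\<^sup>2 \<le> (2 * cmod c)\<^sup>2" using abs_\<eta> by (intro power_mono) auto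
      then show "cmod (of_real ((\<eta> c z)\<^sup>2) * ?E (F z)) \<le> (2 * cmod c)\<^sup>2"
        by (simp add: norm_mult norm_power)
    qed measurable
    show "integrable M (\<lambda>z. r z * ?E (F z))"
      by (rule integrable_circle[where B = "?d ^ 3 / 6"]) (use r in \<open>auto simp: norm_mult\<close>)
  qed
  have "(\<integral>z. cis (\<epsilon> * proj_sum c (Suc n) z) \<partial>M)
      = (\<integral>z. ?E (F z) + \<i> * of_real \<epsilon> * (of_real (\<eta> c z) * ?E (F z))
      - of_real (\<epsilon>\<^sup>2 / 2) * (of_real ((\<eta> c z)\<^sup>2) * ?E (F z)) + r z * ?E (F z) \<partial>M)"
  proof (rule Bochner_Integration.integral_cong[OF refl])
    fix z
    have "cis (\<epsilon> * proj_sum c (Suc n) z) = cis (\<epsilon> * \<eta> c z) * ?E (F z)"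
      by (simp add: proj_sum_Suc cis_mult distrib_left)
    then show "cis (\<epsilon> * proj_sum c (Suc n) z) = ?E (F z) + \<i> * of_real \<epsilon> * (of_real (\<eta> c z) * ?E (F z))
      - of_real (\<epsilon>\<^sup>2 / 2) * (of_real ((\<eta> c z)\<^sup>2) * ?E (F z)) + r z * ?E (F z)"
      by (simp add: r_def algebra_simps power_mult_distrib)
  qed
  also have "\<dots> = (\<integral>z. ?E (F z) \<partial>M) + \<i> * of_real \<epsilon> * (\<integral>z. of_real (\<eta> c z) * ?E (F z) \<partial>M)
      - of_real (\<epsilon>\<^sup>2 / 2) * (\<integral>z. of_real ((\<eta> c z)\<^sup>2) * ?E (F z) \<partial>M) + (\<integral>z. r z * ?E (F z) \<partial>M)"
    using int by simp
  also have "(\<integral>z. ?E (F z) \<partial>M) = (\<integral>z. ?E z \<partial>M)"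
    by (rule transfer0) measurable
  also have "(\<integral>z. of_real (\<eta> c z) * ?E (F z) \<partial>M) = 0"
    by (rule integral_\<eta>[where B = 1]) auto
  also have "(\<integral>z. of_real ((\<eta> c z)\<^sup>2) * ?E (F z) \<partial>M)
      = of_real ((cmod c)\<^sup>2 * (1 - (cmod a)\<^sup>2) / 2) * (\<integral>z. ?E z \<partial>M)
      + c\<^sup>2 * cnj b / 4 * (\<integral>z. z * ?E z \<partial>M) + (cnj c)\<^sup>2 * b / 4 * (\<integral>z. cnj z * ?E z \<partial>M)"
    by (rule integral_\<eta>_square[where B = 1]) auto
  finally have expansion: "(\<integral>z. cis (\<epsilon> * proj_sum c (Suc n) z) \<partial>M)
      = (\<integral>z. ?E z \<partial>M) + \<i> * of_real \<epsilon> * 0 - of_real (\<epsilon>\<^sup>2 / 2)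
          * (of_real ((cmod c)\<^sup>2 * (1 - (cmod a)\<^sup>2) / 2) * (\<integral>z. ?E z \<partial>M)
          + c\<^sup>2 * cnj b / 4 * (\<integral>z. z * ?E z \<partial>M) + (cnj c)\<^sup>2 * b / 4 * (\<integral>z. cnj z * ?E z \<partial>M))
          + (\<integral>z. r z * ?E (F z) \<partial>M)" .
  have alg: "A' - (1 - E * s) * A = R - (E * u + E * v)"
    if "A' = A + e * 0 - E * (s * A + u + v) + R" for A' A e E s u v R :: complex
    unfolding that by (simp add: algebra_simps)
  have "complex_of_real (1 - variance_rate c * \<epsilon>\<^sup>2 / 2)
      = 1 - of_real (\<epsilon>\<^sup>2 / 2) * of_real ((cmod c)\<^sup>2 * (1 - (cmod a)\<^sup>2) / 2)"
    by (simp add: variance_rate_def)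
  then have error: "(\<integral>z. cis (\<epsilon> * proj_sum c (Suc n) z) \<partial>M)
      - of_real (1 - variance_rate c * \<epsilon>\<^sup>2 / 2) * (\<integral>z. ?E z \<partial>M)
      = (\<integral>z. r z * ?E (F z) \<partial>M) - (of_real (\<epsilon>\<^sup>2 / 2) * (c\<^sup>2 * cnj b / 4) * (\<integral>z. z * ?E z \<partial>M)
          + of_real (\<epsilon>\<^sup>2 / 2) * ((cnj c)\<^sup>2 * b / 4) * (\<integral>z. cnj z * ?E z \<partial>M))"
    using alg[OF expansion] by (simp only: mult.assoc)
  have "cmod ((\<integral>z. cis (\<epsilon> * proj_sum c (Suc n) z) \<partial>M)
      - of_real (1 - variance_rate c * \<epsilon>\<^sup>2 / 2) * (\<integral>z. ?E z \<partial>M))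
      \<le> cmod (\<integral>z. r z * ?E (F z) \<partial>M) + (cmod (of_real (\<epsilon>\<^sup>2 / 2) * (c\<^sup>2 * cnj b / 4) * (\<integral>z. z * ?E z \<partial>M))
          + cmod (of_real (\<epsilon>\<^sup>2 / 2) * ((cnj c)\<^sup>2 * b / 4) * (\<integral>z. cnj z * ?E z \<partial>M)))"
    unfolding error by (rule order_trans[OF norm_triangle_ineq4 add_left_mono[OF norm_triangle_ineq]])
  also have "\<dots> \<le> ?d ^ 3 / 6 + (\<epsilon>\<^sup>2 / 2 * ((cmod c)\<^sup>2 * cmod b / 4) * ?D
      + \<epsilon>\<^sup>2 / 2 * ((cmod c)\<^sup>2 * cmod b / 4) * ?D)"
  proof (intro add_mono)
    show "cmod (\<integral>z. r z * ?E (F z) \<partial>M) \<le> ?d ^ 3 / 6"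
      by (rule norm_integral_circle) (use r in \<open>auto simp: norm_mult\<close>)
    have coeff: "cmod (of_real (\<epsilon>\<^sup>2 / 2) * (c\<^sup>2 * cnj b / 4)) = \<epsilon>\<^sup>2 / 2 * ((cmod c)\<^sup>2 * cmod b / 4)"
      "cmod (of_real (\<epsilon>\<^sup>2 / 2) * ((cnj c)\<^sup>2 * b / 4)) = \<epsilon>\<^sup>2 / 2 * ((cmod c)\<^sup>2 * cmod b / 4)"
      by (simp_all add: norm_mult norm_power norm_divide)
    have nonneg: "0 \<le> \<epsilon>\<^sup>2 / 2 * ((cmod c)\<^sup>2 * cmod b / 4)" by simp
    show "cmod (of_real (\<epsilon>\<^sup>2 / 2) * (c\<^sup>2 * cnj b / 4) * (\<integral>z. z * ?E z \<partial>M))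
        \<le> \<epsilon>\<^sup>2 / 2 * ((cmod c)\<^sup>2 * cmod b / 4) * ?D"
      unfolding norm_mult[of _ "integral\<^sup>L M _"] coeff by (rule mult_left_mono[OF correlation_decay nonneg])
    show "cmod (of_real (\<epsilon>\<^sup>2 / 2) * ((cnj c)\<^sup>2 * b / 4) * (\<integral>z. cnj z * ?E z \<partial>M))
        \<le> \<epsilon>\<^sup>2 / 2 * ((cmod c)\<^sup>2 * cmod b / 4) * ?D"
      unfolding norm_mult[of _ "integral\<^sup>L M _"] coeff
          by (rule mult_left_mono[OF correlation_decay_cnj nonneg])
  qed
  also have "\<dots> = step_error c \<epsilon> n" by (simp add: step_error_def)
  finally show ?thesis .
qed

lemma charfun_bound:
  assumes "\<bar>1 - variance_rate c * \<epsilon>\<^sup>2 / 2\<bar> \<le> 1"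
  shows "cmod ((\<integral>z. cis (\<epsilon> * proj_sum c n z) \<partial>M) - of_real ((1 - variance_rate c * \<epsilon>\<^sup>2 / 2) ^ n))
    \<le> (\<Sum>k<n. step_error c \<epsilon> k)"
proof (induction n)
  case 0
  then show ?case by (simp add: prob_space)
next
  case (Suc n)
  let ?q = "1 - variance_rate c * \<epsilon>\<^sup>2 / 2" and ?A = "\<lambda>n. \<integral>z. cis (\<epsilon> * proj_sum c n z) \<partial>M"
  have split: "?A (Suc n) - of_real (?q ^ Suc n) = (?A (Suc n) - of_real ?q * ?A n)
      + of_real ?q * (?A n - of_real (?q ^ n))"
    by (simp add: algebra_simps)
  have "cmod (?A (Suc n) - of_real (?q ^ Suc n)) \<le> cmod (?A (Suc n) - of_real ?q * ?A n)
      + \<bar>?q\<bar> * cmod (?A n - of_real (?q ^ n))"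
    unfolding split by (rule order_trans[OF norm_triangle_ineq])
        (simp only: norm_mult norm_of_real order_refl)
  also have "\<dots> \<le> step_error c \<epsilon> n + 1 * (\<Sum>k<n. step_error c \<epsilon> k)"
    using charfun_step[of \<epsilon> c n] mult_mono[OF assms Suc.IH] by simp
  finally show ?case by simp
qed

lemma sum_step_error:
  "(\<Sum>k<n. step_error c \<epsilon> k) \<le> \<epsilon>\<^sup>2 * (cmod c)\<^sup>2 * cmod b / 4 * (1 + real n * (\<bar>\<epsilon>\<bar> * (2 * cmod c))) / (1
      - cmod a)
     + real n * (\<bar>\<epsilon>\<bar> * (2 * cmod c)) ^ 3 / 6"
proof -
  have "(\<Sum>k<n. cmod a ^ k) \<le> 1 / (1 - cmod a)"
    using sum_le_suminf[of "\<lambda>k. cmod a ^ k" "{..<n}"] cmod_a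
        by (simp add: summable_geometric suminf_geometric)
  then have geo: "\<epsilon>\<^sup>2 * (cmod c)\<^sup>2 * cmod b / 4 * (\<Sum>k<n. cmod a ^ k)
      \<le> \<epsilon>\<^sup>2 * (cmod c)\<^sup>2 * cmod b / 4 * (1 / (1 - cmod a))"
    by (intro mult_left_mono) auto
  have split: "(\<Sum>k<n. K * (x ^ k + D) + T) = K * (\<Sum>k<n. x ^ k) + K * (real n * D) + real n * T"
      for K x D T :: real
    by (simp add: sum.distrib sum_distrib_left distrib_left)
  have "\<epsilon>\<^sup>2 * (cmod c)\<^sup>2 * cmod b / 4 * (1 + real n * (\<bar>\<epsilon>\<bar> * (2 * cmod c))) / (1 - cmod a)
      = \<epsilon>\<^sup>2 * (cmod c)\<^sup>2 * cmod b / 4 * (1 / (1 - cmod a))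
        + \<epsilon>\<^sup>2 * (cmod c)\<^sup>2 * cmod b / 4 * (real n * (\<bar>\<epsilon>\<bar> * (2 * cmod c) / (1 - cmod a)))"
    by (simp add: distrib_left add_divide_distrib)
  then show ?thesis
    unfolding step_error_def split using geo by simp
qed

text \<open>With \<open>\<epsilon> = 1 / sqrt n\<close> the accumulated error is \<open>O(1 / sqrt n)\<close>, while the product of the \<open>n\<close>
factors is \<open>(1 - s / (2 * n)) ^ n\<close>.\<close>

theorem charfun_limit:
  "(\<lambda>n. \<integral>z. cis (proj_sum c n z / sqrt n) \<partial>M) \<longlonglongrightarrow> of_real (exp (- variance_rate c / 2))"
proof -
  let ?s = "variance_rate c" and ?\<epsilon> = "\<lambda>n. 1 / sqrt (real n)"
  let ?q = "\<lambda>n. (1 + (- ?s / 2) / real n) ^ n"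
  let ?err = "\<lambda>n. ((cmod c)\<^sup>2 * cmod b / 4 / (1 - cmod a)) * (1 / real n + ?\<epsilon> n * (2 * cmod c))
      + (2 * cmod c) ^ 3 / 6 * ?\<epsilon> n"
  have s0: "?s \<ge> 0"
    using cmod_a by (simp add: variance_rate_def power_le_one)
  have "?err \<longlonglongrightarrow> ((cmod c)\<^sup>2 * cmod b / 4 / (1 - cmod a)) * (0 + 0 * (2 * cmod c)) + (2 * cmod c) ^ 3 / 6 * 0"
    by (intro tendsto_intros real_tendsto_divide_at_top[OF tendsto_const] filterlim_compose[OF sqrt_at_top]
        filterlim_real_sequentially)
  then have err: "?err \<longlonglongrightarrow> 0" by simp
  have "(\<lambda>n. (\<integral>z. cis (proj_sum c n z / sqrt n) \<partial>M) - of_real (?q n)) \<longlonglongrightarrow> 0"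
  proof (rule Lim_null_comparison[OF _ err])
    show "\<forall>\<^sub>F n in sequentially. norm ((\<integral>z. cis (proj_sum c n z / sqrt n) \<partial>M) - complex_of_real (?q n))
        \<le> ?err n"
      using eventually_gt_at_top[of "nat \<lceil>?s\<rceil>"]
    proof eventually_elim
      case (elim n)
      then have n: "real n > ?s" "n > 0" by linarith+
      have sq: "(?\<epsilon> n)\<^sup>2 = 1 / real n" by (simp add: power_divide)
      have "?s / real n < 1" using n by (simp add: field_simps)
      then have "\<bar>1 - ?s * (?\<epsilon> n)\<^sup>2 / 2\<bar> \<le> 1"
        using s0 n by (simp add: sq abs_le_iff)
      note bound = order_trans[OF charfun_bound[OF this, of n] sum_step_error]
      have eps: "\<bar>?\<epsilon> n\<bar> = ?\<epsilon> n" and scale: "?\<epsilon> n * x = x / sqrt n" for x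
        by simp_all
      have base: "1 - ?s * (?\<epsilon> n)\<^sup>2 / 2 = 1 + (- ?s / 2) / real n"
        by (simp add: sq)
      have "cmod ((\<integral>z. cis (proj_sum c n z / sqrt n) \<partial>M) - of_real (?q n))
        \<le> (?\<epsilon> n)\<^sup>2 * (cmod c)\<^sup>2 * cmod b / 4 * (1 + real n * (?\<epsilon> n * (2 * cmod c))) / (1 - cmod a)
          + real n * (?\<epsilon> n * (2 * cmod c)) ^ 3 / 6"
        using bound unfolding eps base scale[of "proj_sum c n _"] .
      also have "\<dots> = ?err n"
      proof -
        have "real n * (?\<epsilon> n * (2 * cmod c)) ^ 3 = (real n * (?\<epsilon> n)\<^sup>2) * ?\<epsilon> n * (2 * cmod c) ^ 3"
          by (simp add: power_mult_distrib power3_eq_cube power2_eq_square)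
        also have "real n * (?\<epsilon> n)\<^sup>2 = 1" using n by (simp add: sq)
        finally have 3: "real n * (?\<epsilon> n * (2 * cmod c)) ^ 3 = ?\<epsilon> n * (2 * cmod c) ^ 3" by simp
        have regroup: "x * u * v / 4 * w / t = (u * v / 4 / t) * (x * w)" for x u v w t :: real
          by simp
        have "1 / real n * (1 + real n * y) = 1 / real n + y" for y
          using n by (simp add: distrib_left)
        then have 4: "1 / real n * (cmod c)\<^sup>2 * cmod b / 4 * (1 + real n * y) / (1 - cmod a)
            = ((cmod c)\<^sup>2 * cmod b / 4 / (1 - cmod a)) * (1 / real n + y)" for y
          using regroup[of "1 / real n" "(cmod c)\<^sup>2" "cmod b" "1 + real n * y" "1 - cmod a"] by (simp only:)
        show ?thesis unfolding 3 sq 4 by simp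
      qed
      finally show ?case by simp
    qed
  qed
  from tendsto_add[OF this tendsto_of_real[OF tendsto_exp_limit_sequentially[of "- ?s / 2"]]]
  show ?thesis by simp
qed

definition \<Xi> :: "nat \<Rightarrow> complex \<Rightarrow> complex" where "\<Xi> n z = (\<Sum>k<n. \<xi> ((F ^^ k) z))"

lemma measurable_\<Xi> [measurable]: "\<Xi> n \<in> borel_measurable borel"
  unfolding \<Xi>_def by measurable

lemma \<Xi>_Suc: "\<Xi> (Suc n) z = \<xi> z + \<Xi> n (F z)"
  unfolding \<Xi>_def by (subst sum.lessThan_Suc_shift, simp add: funpow_Suc_right del: funpow.simps(2))

lemma proj_sum_eq_\<Xi>: "proj_sum c n z = Re (c * \<Xi> n z)"
  by (simp add: proj_sum_def \<Xi>_def \<eta>_def sum_distrib_left)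

lemma cmod_\<Xi>: "cmod z = 1 \<Longrightarrow> cmod (\<Xi> n z) \<le> 2 * real n"
proof (induction n arbitrary: z)
  case 0
  then show ?case by (simp add: \<Xi>_def)
next
  case (Suc n)
  then show ?case
    using norm_triangle_ineq[of "\<xi> z" "\<Xi> n (F z)"] cmod_\<xi>[of z] Suc.IH[OF cmod_F[of z]]
    unfolding \<Xi>_Suc by simp
qed

text \<open>Pythagoras: the first difference is orthogonal to all later ones, and by invariance the later ones
have the second moment of the sum with one term less.\<close>

lemma second_moment_\<Xi>: "(\<integral>z. (cmod (\<Xi> n z))\<^sup>2 \<partial>M) = real n * (1 - (cmod a)\<^sup>2)"
proof (induction n)
  case 0
  then show ?case by (simp add: \<Xi>_def)
next
  case (Suc n)
  have eq: "(cmod (\<Xi> (Suc n) z))\<^sup>2 = (cmod (\<xi> z))\<^sup>2 + (cmod (\<Xi> n (F z)))\<^sup>2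
      + 2 * Re (\<xi> z * cnj (\<Xi> n (F z)))" for z
    unfolding \<Xi>_Suc cmod_power2 by (simp add: power2_eq_square algebra_simps)
  have b: "(cmod (\<xi> z))\<^sup>2 \<le> 4" "(cmod (\<Xi> n (F z)))\<^sup>2 \<le> (2 * real n)\<^sup>2"
     "cmod (\<xi> z * cnj (\<Xi> n (F z))) \<le> 2 * (2 * real n)" if "cmod z = 1" for z
    using power_mono[OF cmod_\<xi>[OF that], of 2] power_mono[OF cmod_\<Xi>[OF cmod_F, of n z], of 2]
      mult_mono[OF cmod_\<xi>[OF that] cmod_\<Xi>[OF cmod_F, of n z]] by (simp_all add: norm_mult)
  have int: "integrable M (\<lambda>z. (cmod (\<xi> z))\<^sup>2)" "integrable M (\<lambda>z. (cmod (\<Xi> n (F z)))\<^sup>2)"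
      "integrable M (\<lambda>z. \<xi> z * cnj (\<Xi> n (F z)))"
  proof -
    show "integrable M (\<lambda>z. (cmod (\<xi> z))\<^sup>2)"
      by (rule integrable_circle[where B = 4]) (simp_all add: b)
    show "integrable M (\<lambda>z. (cmod (\<Xi> n (F z)))\<^sup>2)"
      by (rule integrable_circle[where B =
          "(2 * real n)\<^sup>2"]) (measurable, simp only: real_norm_def abs_power2 b(2))
    show "integrable M (\<lambda>z. \<xi> z * cnj (\<Xi> n (F z)))"
      by (rule integrable_circle[where B = "2 * (2 * real n)"]) (measurable, simp only: b)
  qed
  have split: "(\<integral>z. u z + v z + 2 * Re (w z) \<partial>M) = (\<integral>z. u z \<partial>M) + (\<integral>z. v z \<partial>M) + 2 * Re (\<integral>z. w z \<partial>M)"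
    if "integrable M u" "integrable M v" "integrable M w" for u v :: "complex \<Rightarrow> real" and w
    using that by simp
  have "(\<integral>z. (cmod (\<Xi> (Suc n) z))\<^sup>2 \<partial>M) = (\<integral>z. (cmod (\<xi> z))\<^sup>2 \<partial>M) + (\<integral>z. (cmod (\<Xi> n (F z)))\<^sup>2 \<partial>M)
      + 2 * Re (\<integral>z. \<xi> z * cnj (\<Xi> n (F z)) \<partial>M)"
    unfolding eq by (rule split[OF int])
  also have "(\<integral>z. \<xi> z * cnj (\<Xi> n (F z)) \<partial>M) = 0"
    by (rule martingale_difference[where B = "2 * real n"]) (auto simp: cmod_\<Xi>)
  also have "(\<integral>z. (cmod (\<xi> z))\<^sup>2 \<partial>M) = 1 - (cmod a)\<^sup>2"
  proof -
    have "(\<integral>z. complex_of_real ((cmod (\<xi> z))\<^sup>2) * 1 \<partial>M) = of_real (1 - (cmod a)\<^sup>2) * (\<integral>z. 1 \<partial>M)"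
      by (rule conditional_norm[where B = 1]) auto
    then have "complex_of_real (\<integral>z. (cmod (\<xi> z))\<^sup>2 \<partial>M) = of_real (1 - (cmod a)\<^sup>2)"
      by (simp add: prob_space flip: integral_complex_of_real del: of_real_power)
    then show ?thesis by (simp only: of_real_eq_iff)
  qed
  also have "(\<integral>z. (cmod (\<Xi> n (F z)))\<^sup>2 \<partial>M) = (\<integral>z. (cmod (\<Xi> n z))\<^sup>2 \<partial>M)"
    by (subst (2) invariant[symmetric], subst integral_distr) auto
  finally show ?case by (simp add: Suc.IH algebra_simps)
qed

end

section \<open>The central limit theorem for maps with the transfer relations\<close>

context circle_transfer begin

definition orbit_sum :: "nat \<Rightarrow> complex \<Rightarrow> complex" where "orbit_sum n z = (\<Sum>k=1..n. (F ^^ k) z)"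

lemma measurable_orbit_sum [measurable]: "orbit_sum n \<in> borel_measurable borel"
  unfolding orbit_sum_def by measurable

text \<open>The sum of the differences telescopes to a multiple of the orbit sum and two boundary terms of
modulus 1.\<close>

lemma \<Xi>_eq_orbit_sum: "\<Xi> n z = (1 - cnj a) * orbit_sum n z + z - (F ^^ n) z"
proof (induction n)
  case 0
  then show ?case by (simp add: \<Xi>_def orbit_sum_def)
next
  case (Suc n)
  have "\<Xi> (Suc n) z = \<Xi> n z + \<xi> ((F ^^ n) z)" by (simp add: \<Xi>_def)
  then show ?case by (simp add: Suc.IH orbit_sum_def \<xi>_def algebra_simps)
qed

lemma a_neq_1: "1 - a \<noteq> 0" "1 - cnj a \<noteq> 0"
proof -
  have "a \<noteq> 1" "cnj a \<noteq> 1" using cmod_a complex_mod_cnj[of a] by (metis less_irrefl norm_one)+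
  then show "1 - a \<noteq> 0" "1 - cnj a \<noteq> 0" by simp_all
qed

lemma cmod_1_minus_cnj: "cmod (1 - cnj a) = cmod (1 - a)"
  by (metis complex_cnj_diff complex_cnj_one complex_mod_cnj)

lemma cmod_funpow_F: "cmod z = 1 \<Longrightarrow> cmod ((F ^^ n) z) = 1"
  by (cases n) (auto simp: cmod_F)

definition scaled_sum :: "nat \<Rightarrow> complex \<Rightarrow> complex" where "scaled_sum n z
    = of_real (sqrt (2 / real n)) * orbit_sum n z"

lemma measurable_scaled_sum [measurable]: "scaled_sum n \<in> borel_measurable borel"
  unfolding scaled_sum_def by measurable

text \<open>The variance \<open>1 - \<bar>a\<bar>\<^sup>2\<close> of a martingale difference, divided by the squared modulus of the factor
\<open>1 - cnj a\<close> that relates the orbit sum to the martingale.\<close>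

definition limit_variance :: real where "limit_variance = (1 - (cmod a)\<^sup>2) / (cmod (1 - a))\<^sup>2"

lemma limit_variance_pos: "limit_variance > 0"
  using cmod_a a_neq_1 by (simp add: limit_variance_def power_less_one_iff abs_square_less_1)

lemma limit_variance_eq: "limit_variance = Re ((1 + a) / (1 - a))"
proof -
  have "(1 + a) / (1 - a) = ((1 + a) * cnj (1 - a)) / of_real ((cmod (1 - a))\<^sup>2)"
    unfolding complex_norm_square using a_neq_1
    by (subst nonzero_mult_divide_mult_cancel_right) auto
  then have "Re ((1 + a) / (1 - a)) = Re ((1 + a) * cnj (1 - a)) / (cmod (1 - a))\<^sup>2"
    by (simp only: Re_divide_of_real)
  also have "Re ((1 + a) * cnj (1 - a)) = 1 - (cmod a)\<^sup>2"
    unfolding cmod_power2 by (simp add: power2_eq_square algebra_simps)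
  finally show ?thesis by (simp add: limit_variance_def)
qed

text \<open>For \<open>c = cnj \<tau> * sqrt 2 / (1 - cnj a)\<close> the projection of the scaled sum onto \<open>\<tau>\<close> is that of the
martingale up to the two boundary terms, which disappear after division by \<open>sqrt n\<close>.\<close>

lemma charfun_scaled_sum_limit:
  "(\<lambda>n. \<integral>z. cis (\<tau> \<bullet> scaled_sum n z) \<partial>M) \<longlonglongrightarrow> of_real (exp (- limit_variance * (cmod \<tau>)\<^sup>2 / 2))"
proof -
  define c where "c = cnj \<tau> * of_real (sqrt 2) / (1 - cnj a)"
  have c: "variance_rate c = limit_variance * (cmod \<tau>)\<^sup>2"
    by (simp add: variance_rate_def limit_variance_def c_def norm_mult norm_divide cmod_1_minus_cnj
        power_mult_distrib power_divide)
  have X: "\<tau> \<bullet> scaled_sum n z = proj_sum c n z / sqrt n + Re (c * ((F ^^ n) z - z)) / sqrt n" for n z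
  proof -
    have "orbit_sum n z = (\<Xi> n z + ((F ^^ n) z - z)) / (1 - cnj a)"
      using a_neq_1 by (simp add: \<Xi>_eq_orbit_sum)
    then have "cnj \<tau> * scaled_sum n z = (c * \<Xi> n z + c * ((F ^^ n) z - z)) / of_real (sqrt n)"
      by (simp add: scaled_sum_def c_def real_sqrt_divide add_divide_distrib distrib_left mult_ac)
    moreover have "\<tau> \<bullet> scaled_sum n z = Re (cnj \<tau> * scaled_sum n z)"
      by (simp add: inner_complex_def)
    ultimately show ?thesis
      by (simp only: Re_divide_of_real plus_complex.sel proj_sum_eq_\<Xi> add_divide_distrib)
  qed
  have "(\<lambda>n. (\<integral>z. cis (\<tau> \<bullet> scaled_sum n z) \<partial>M) - (\<integral>z. cis (proj_sum c n z / sqrt n) \<partial>M)) \<longlonglongrightarrow> 0"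
  proof (rule Lim_null_comparison)
    show "(\<lambda>n. 2 * cmod c * (1 / sqrt (real n))) \<longlonglongrightarrow> 0"
      by (intro tendsto_mult_right_zero real_tendsto_divide_at_top[OF tendsto_const]
          filterlim_compose[OF sqrt_at_top] filterlim_real_sequentially)
    show "\<forall>\<^sub>F n in sequentially. norm ((\<integral>z. cis (\<tau> \<bullet> scaled_sum n z) \<partial>M)
        - (\<integral>z. cis (proj_sum c n z / sqrt n) \<partial>M))
        \<le> 2 * cmod c * (1 / sqrt (real n))"
    proof (intro always_eventually allI)
      fix n
      have "(\<integral>z. cis (\<tau> \<bullet> scaled_sum n z) \<partial>M) - (\<integral>z. cis (proj_sum c n z / sqrt n) \<partial>M)
          = (\<integral>z. cis (\<tau> \<bullet> scaled_sum n z) - cis (proj_sum c n z / sqrt n) \<partial>M)"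
        by (rule Bochner_Integration.integral_diff[symmetric]; rule integrable_circle[where B = 1]) auto
      moreover have "norm (\<integral>z. cis (\<tau> \<bullet> scaled_sum n z) - cis (proj_sum c n z / sqrt n) \<partial>M)
          \<le> 2 * cmod c * (1 / sqrt (real n))"
      proof (rule norm_integral_circle)
        fix z assume z: "cmod z = 1"
        have "cmod (cis (\<tau> \<bullet> scaled_sum n z) - cis (proj_sum c n z / sqrt n))
            \<le> \<bar>Re (c * ((F ^^ n) z - z)) / sqrt n\<bar>"
          using cmod_cis_diff_le[of "\<tau> \<bullet> scaled_sum n z" "proj_sum c n z / sqrt n"] by (simp add: X)
        also have "\<dots> \<le> cmod (c * ((F ^^ n) z - z)) / sqrt n"
          using abs_Re_le_cmod[of "c * ((F ^^ n) z - z)"] by (simp add: divide_right_mono)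
        also have "\<dots> \<le> cmod c * 2 / sqrt n"
        proof -
          have "cmod ((F ^^ n) z - z) \<le> 2"
            using norm_triangle_ineq4[of "(F ^^ n) z" z] cmod_funpow_F[OF z] z by simp
          then show ?thesis by (simp add: norm_mult divide_right_mono mult_left_mono)
        qed
        finally show "cmod (cis (\<tau> \<bullet> scaled_sum n z) - cis (proj_sum c n z / sqrt n))
            \<le> 2 * cmod c * (1 / sqrt (real n))"
          by (simp add: mult.commute)
      qed measurable
      ultimately show "norm ((\<integral>z. cis (\<tau> \<bullet> scaled_sum n z) \<partial>M) - (\<integral>z. cis (proj_sum c n z / sqrt n) \<partial>M))
        \<le> 2 * cmod c * (1 / sqrt (real n))" by simp
    qed
  qed
  from tendsto_add[OF this charfun_limit[of c]] show ?thesis by (simp add: c)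
qed

lemma cmod_scaled_sum_square_le:
  assumes z: "cmod z = 1"
  shows "(cmod (scaled_sum n z))\<^sup>2 \<le> 4 / (cmod (1 - a))\<^sup>2 * (((cmod (\<Xi> n z))\<^sup>2 + 4) / real n)"
proof -
  have "(1 - cnj a) * orbit_sum n z = \<Xi> n z + ((F ^^ n) z - z)" by (simp add: \<Xi>_eq_orbit_sum)
  then have "cmod (1 - a) * cmod (orbit_sum n z) = cmod (\<Xi> n z + ((F ^^ n) z - z))"
    by (simp only: norm_mult[symmetric] cmod_1_minus_cnj[symmetric])
  also have "\<dots> \<le> cmod (\<Xi> n z) + 2"
    using norm_triangle_ineq[of "\<Xi> n z" "(F ^^ n) z - z"] norm_triangle_ineq4[of "(F ^^ n) z" z]
      cmod_funpow_F[OF z] z by simp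
  finally have "(cmod (1 - a) * cmod (orbit_sum n z))\<^sup>2 \<le> (cmod (\<Xi> n z) + 2)\<^sup>2"
    by (intro power_mono) auto
  also have "\<dots> \<le> 2 * ((cmod (\<Xi> n z))\<^sup>2 + 4)"
    using zero_le_power2[of "cmod (\<Xi> n z) - 2"] by (simp add: power2_eq_square algebra_simps)
  finally have "(cmod (orbit_sum n z))\<^sup>2 \<le> 2 * ((cmod (\<Xi> n z))\<^sup>2 + 4) / (cmod (1 - a))\<^sup>2"
    using a_neq_1 by (simp add: power_mult_distrib pos_le_divide_eq mult.commute)
  then have "2 / real n * (cmod (orbit_sum n z))\<^sup>2
      \<le> 2 / real n * (2 * ((cmod (\<Xi> n z))\<^sup>2 + 4) / (cmod (1 - a))\<^sup>2)"
    by (intro mult_left_mono) auto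
  then show ?thesis by (simp add: scaled_sum_def norm_mult power_mult_distrib mult_ac)
qed

lemma tail_scaled_sum:
  assumes "R > 0"
  shows "measure M {z. R < cmod (scaled_sum n z)} \<le> 20 / (cmod (1 - a))\<^sup>2 / R\<^sup>2"
proof (cases "n = 0")
  case True
  then have "{z. R < cmod (scaled_sum n z)} = {}" using assms by (simp add: scaled_sum_def)
  then show ?thesis by simp
next
  case False
  let ?A = "{z. R < cmod (scaled_sum n z)}" and ?K = "4 / (cmod (1 - a))\<^sup>2"
  have sp: "space M = UNIV" using sets_eq_imp_space_eq[OF sets_M] by simp
  have A: "?A \<in> sets M" unfolding sets_M by measurable
  have b: "(cmod (\<Xi> n z))\<^sup>2 \<le> (2 * real n)\<^sup>2" if "cmod z = 1" for z
    using power_mono[OF cmod_\<Xi>[OF that, of n], of 2] by simp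
  have int: "integrable M (\<lambda>z. (cmod (\<Xi> n z))\<^sup>2)"
    by (rule integrable_circle[where B =
        "(2 * real n)\<^sup>2"]) (measurable, simp only: real_norm_def abs_power2 b)
  have "measure M ?A = (\<integral>z. indicator ?A z \<partial>M)" using A sp by simp
  also have "\<dots> \<le> (\<integral>z. ?K * (((cmod (\<Xi> n z))\<^sup>2 + 4) / real n) / R\<^sup>2 \<partial>M)"
  proof (rule integral_mono_AE)
    show "integrable M (indicator ?A :: complex \<Rightarrow> real)"
      using A by (intro integrable_real_indicator) (auto simp: emeasure_eq_measure)
    show "integrable M (\<lambda>z. ?K * (((cmod (\<Xi> n z))\<^sup>2 + 4) / real n) / R\<^sup>2)"
      using int by simp
    show "AE z in M. indicator ?A z \<le> ?K * (((cmod (\<Xi> n z))\<^sup>2 + 4) / real n) / R\<^sup>2"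
      using circle
    proof eventually_elim
      case (elim z)
      show ?case
      proof (cases "R < cmod (scaled_sum n z)")
        case True
        then have "R\<^sup>2 \<le> (cmod (scaled_sum n z))\<^sup>2" using assms by (intro power_mono) auto
        also have "\<dots> \<le> ?K * (((cmod (\<Xi> n z))\<^sup>2 + 4) / real n)" by (rule cmod_scaled_sum_square_le[OF elim])
        finally have "1 \<le> ?K * (((cmod (\<Xi> n z))\<^sup>2 + 4) / real n) / R\<^sup>2"
          using assms by (subst pos_le_divide_eq) auto
        then show ?thesis using True by simp
      qed simp
    qed
  qed
  also have "\<dots> = ?K * ((real n * (1 - (cmod a)\<^sup>2) + 4) / real n) / R\<^sup>2"
    using int by (simp add: second_moment_\<Xi> prob_space)
  also have "\<dots> \<le> ?K * 5 / R\<^sup>2"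
  proof -
    have "real n * (1 - (cmod a)\<^sup>2) \<le> real n * 1" by (intro mult_left_mono) auto
    then have "real n * (1 - (cmod a)\<^sup>2) + 4 \<le> 5 * real n" using False by linarith
    then have "(real n * (1 - (cmod a)\<^sup>2) + 4) / real n \<le> 5" using False by (subst pos_divide_le_eq) auto
    then show ?thesis by (intro divide_right_mono mult_left_mono) auto
  qed
  finally show ?thesis by simp
qed

theorem weak_limit:
  assumes "continuous_on UNIV g" "bounded (range g)"
  shows "(\<lambda>n. \<integral>w. (g w :: real) \<partial>distr M borel (scaled_sum n)) \<longlonglongrightarrow> (\<integral>w. g w \<partial>complex_normal limit_variance)"
proof (rule levy_continuity_plane[OF _ _ _ _ _ _ assms])
  show "prob_space (distr M borel (scaled_sum n))" for n
    by (rule prob_space_distr) measurable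
  show "prob_space (complex_normal limit_variance)"
    by (rule prob_space_complex_normal[OF limit_variance_pos])
  show "(\<lambda>n. \<integral>w. cis (\<tau> \<bullet> w) \<partial>distr M borel (scaled_sum n))
      \<longlonglongrightarrow> (\<integral>w. cis (\<tau> \<bullet> w) \<partial>complex_normal limit_variance)" for \<tau>
    using charfun_scaled_sum_limit[of \<tau>]
        by (simp add: char_complex_normal[OF limit_variance_pos] integral_distr)
  show "\<exists>R. \<forall>R'\<ge>R. \<forall>n. measure (distr M borel (scaled_sum n)) {w. R' < cmod w} \<le> \<epsilon>" if "\<epsilon> > 0" for \<epsilon>
  proof (intro exI allI impI)
    let ?C = "20 / (cmod (1 - a))\<^sup>2"
    fix R' n assume R': "R' \<ge> max 1 (?C / \<epsilon>)"
    have "measure (distr M borel (scaled_sum n)) {w. R' < cmod w}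
        = measure M {z. R' < cmod (scaled_sum n z)}"
      using sets_eq_imp_space_eq[OF sets_M] by (subst measure_distr) (auto simp: vimage_def)
    also have "\<dots> \<le> ?C / R'\<^sup>2" using R' by (intro tail_scaled_sum) auto
    also have "\<dots> \<le> ?C / R'"
      using R' by (intro divide_left_mono) (auto simp: power2_eq_square)
    also have "\<dots> \<le> \<epsilon>"
    proof -
      have "?C \<le> R' * \<epsilon>" using R' that by (simp only: pos_divide_le_eq[symmetric])
      moreover have "R' > 0" using R' by simp
      ultimately show ?thesis by (simp only: pos_divide_le_eq mult.commute)
    qed
    finally show "measure (distr M borel (scaled_sum n)) {w. R' < cmod w} \<le> \<epsilon>" .
  qed
qed auto

end

section \<open>Transfer relations need only be checked on monomials\<close>

definition circle_monomials :: "(complex \<Rightarrow> complex) set" where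
  "circle_monomials = {e. \<exists>i k. e = (\<lambda>z. z ^ i * cnj z ^ k)}"

context circle_map begin

lemma char_span_circle_bounded:
  assumes "e \<in> char_span circle_monomials"
  shows "e \<in> borel_measurable borel \<and> (\<exists>C. \<forall>z. cmod z = 1 \<longrightarrow> cmod (e z) \<le> C)"
  using assms
proof induction
  case (base e c)
  then show ?case
    by (auto simp: circle_monomials_def norm_mult norm_power intro!: exI[of _ "cmod c"])
next
  case (add u v)
  then obtain C C' where "\<And>z. cmod z = 1 \<Longrightarrow> cmod (u z) \<le> C" "\<And>z. cmod z = 1 \<Longrightarrow> cmod (v z) \<le> C'"
    by auto
  then have "\<And>z. cmod z = 1 \<Longrightarrow> cmod (u z + v z) \<le> C + C'"
    by (meson add_mono norm_triangle_le)
  with add show ?case by auto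
qed

lemma integrable_circle_mult:
  assumes [measurable]: "u \<in> borel_measurable borel" "v \<in> borel_measurable borel"
    and u: "\<And>z. cmod z = 1 \<Longrightarrow> cmod (u z) \<le> C" and v: "\<And>z. cmod z = 1 \<Longrightarrow> cmod (v z) \<le> D"
  shows "integrable M (\<lambda>z. u z * v z)"
proof (rule integrable_circle[where B = "C * D"])
  fix z :: complex assume z: "cmod z = 1"
  show "cmod (u z * v z) \<le> C * D"
    unfolding norm_mult by (rule mult_mono) (use u[OF z] v[OF z] norm_ge_zero order_trans in blast)+
qed measurable

context
  fixes u l :: "complex \<Rightarrow> complex" and C :: real
  assumes u [measurable]: "u \<in> borel_measurable borel" and l [measurable]: "l \<in> borel_measurable borel"
    and uC: "\<And>z. cmod z = 1 \<Longrightarrow> cmod (u z) \<le> C" and lC: "\<And>z. cmod z = 1 \<Longrightarrow> cmod (l z) \<le> C"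
begin

lemma transfer_char_span:
  assumes mono: "\<And>i k. (\<integral>z. u z * (F z ^ i * cnj (F z) ^ k) \<partial>M) = (\<integral>z. l z * (z ^ i * cnj z ^ k) \<partial>M)"
    and e: "e \<in> char_span circle_monomials"
  shows "(\<integral>z. u z * e (F z) \<partial>M) = (\<integral>z. l z * e z \<partial>M)"
  using e
proof induction
  case (base e c)
  then obtain i k where e: "e = (\<lambda>z. z ^ i * cnj z ^ k)" by (auto simp: circle_monomials_def)
  have "(\<integral>z. c * (u z * (F z ^ i * cnj (F z) ^ k)) \<partial>M) = (\<integral>z. c * (l z * (z ^ i * cnj z ^ k)) \<partial>M)"
    unfolding integral_mult_right_zero mono ..
  then show ?case by (simp add: e mult_ac)
next
  case (add v w)
  have int: "integrable M (\<lambda>z. u z * e (F z))" "integrable M (\<lambda>z. l z * e z)"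
    if "e \<in> char_span circle_monomials" for e
  proof -
    obtain D where D: "\<And>z. cmod z = 1 \<Longrightarrow> cmod (e z) \<le> D" and [measurable]: "e \<in> borel_measurable borel"
      using char_span_circle_bounded[OF \<open>e \<in> _\<close>] by auto
    show "integrable M (\<lambda>z. u z * e (F z))"
      by (rule integrable_circle_mult[OF _ _ uC D[OF cmod_F]]) auto
    show "integrable M (\<lambda>z. l z * e z)"
      by (rule integrable_circle_mult[OF _ _ lC D]) auto
  qed
  show ?case
    unfolding distrib_left using add by (simp add: int)
qed

text \<open>Real polynomials in \<open>Re z\<close> and \<open>Im z\<close> are combinations of monomials in \<open>z\<close> and \<open>cnj z\<close>, and by
Stone-Weierstrass they are uniformly dense on the circle.\<close>

lemma transfer_continuous:
  fixes g :: "complex \<Rightarrow> real"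
  assumes mono: "\<And>i k. (\<integral>z. u z * (F z ^ i * cnj (F z) ^ k) \<partial>M) = (\<integral>z. l z * (z ^ i * cnj z ^ k) \<partial>M)"
    and g: "continuous_on UNIV g"
  shows "(\<integral>z. u z * of_real (g (F z)) \<partial>M) = (\<integral>z. l z * of_real (g z) \<partial>M)"
proof -
  have C0: "C \<ge> 0" using order_trans[OF norm_ge_zero uC[of 1]] by simp
  have [measurable]: "g \<in> borel_measurable borel" by (rule borel_measurable_continuous_onI[OF g])
  obtain D where D: "\<And>z. cmod z = 1 \<Longrightarrow> \<bar>g z\<bar> \<le> D"
  proof -
    have "bounded (g ` sphere 0 1)"
      by (intro compact_imp_bounded compact_continuous_image continuous_on_subset[OF g]) auto
    then obtain D where "\<forall>z\<in>sphere 0 1. \<bar>g z\<bar> \<le> D" unfolding bounded_iff by auto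
    then show thesis by (intro that) auto
  qed
  have "cmod ((\<integral>z. u z * of_real (g (F z)) \<partial>M) - (\<integral>z. l z * of_real (g z) \<partial>M)) \<le> 2 * C * \<epsilon>"
    if \<epsilon>: "\<epsilon> > 0" for \<epsilon>
  proof -
    obtain p where p: "real_polynomial_function p" "\<And>z. z \<in> sphere 0 1 \<Longrightarrow> \<bar>g z - p z\<bar> < \<epsilon>"
      using Stone_Weierstrass_real_polynomial_function[OF compact_sphere continuous_on_subset[OF g
          subset_UNIV] \<epsilon>]
      by blast
    define e where "e z = complex_of_real (p z)" for z
    have mult: "(\<lambda>z. e z * e' z) \<in> circle_monomials" if ee: "e \<in> circle_monomials" "e'
        \<in> circle_monomials" for e e'
    proof -
      obtain i k where "e = (\<lambda>z. z ^ i * cnj z ^ k)"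
        using ee(1) unfolding circle_monomials_def by blast
      moreover obtain i' k' where "e' = (\<lambda>z. z ^ i' * cnj z ^ k')"
        using ee(2) unfolding circle_monomials_def by blast
      ultimately have "(\<lambda>z. e z * e' z) = (\<lambda>z. z ^ (i + i') * cnj z ^ (k + k'))"
        by (simp add: power_add mult_ac)
      then show ?thesis unfolding circle_monomials_def by blast
    qed
    have mem: "(\<lambda>z. 1) \<in> circle_monomials" "(\<lambda>z. z) \<in> circle_monomials" "(\<lambda>z. cnj z) \<in> circle_monomials"
    proof -
      have "(\<lambda>z. z ^ i * cnj z ^ k) \<in> circle_monomials" for i k
        unfolding circle_monomials_def by blast
      from this[of 0 0] this[of 1 0] this[of 0 1]
      show "(\<lambda>z. 1) \<in> circle_monomials" "(\<lambda>z. z) \<in> circle_monomials" "(\<lambda>z. cnj z) \<in> circle_monomials"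
        by simp_all
    qed
    have e: "e \<in> char_span circle_monomials"
      unfolding e_def
    proof (rule real_polynomial_in_char_span[OF p(1) mult mem(1), where \<phi> = "\<lambda>z. z"])
      have "(\<lambda>z. 1 / 2 * z + 1 / 2 * cnj z) \<in> char_span circle_monomials"
        by (intro char_span.add char_span.base mem)
      moreover have "1 / 2 * z + 1 / 2 * cnj z = of_real (Re z)" for z by (simp add: complex_eq_iff)
      ultimately show "(\<lambda>z. complex_of_real (Re z)) \<in> char_span circle_monomials" by simp
      have "(\<lambda>z. (- \<i> / 2) * z + (\<i> / 2) * cnj z) \<in> char_span circle_monomials"
        by (intro char_span.add char_span.base mem)
      moreover have "(- \<i> / 2) * z + (\<i> / 2) * cnj z = of_real (Im z)" for z by (simp add: complex_eq_iff)
      ultimately show "(\<lambda>z. complex_of_real (Im z)) \<in> char_span circle_monomials" by simp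
    qed
    obtain D' where D': "\<And>z. cmod z = 1 \<Longrightarrow> cmod (e z) \<le> D'" and [measurable]: "e \<in> borel_measurable borel"
      using char_span_circle_bounded[OF e] by auto
    have close: "cmod ((\<integral>z. v z * of_real (g (G z)) \<partial>M) - (\<integral>z. v z * e (G z) \<partial>M)) \<le> C * \<epsilon>"
      if [measurable]: "v \<in> borel_measurable borel" "G \<in> borel_measurable borel"
        and vC: "\<And>z. cmod z = 1 \<Longrightarrow> cmod (v z) \<le> C" and G: "\<And>z. cmod z = 1 \<Longrightarrow> cmod (G z) = 1" for v G
    proof -
      have diff: "(\<integral>z. v z * of_real (g (G z)) \<partial>M) - (\<integral>z. v z * e (G z) \<partial>M)
          = (\<integral>z. v z * of_real (g (G z)) - v z * e (G z) \<partial>M)"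
      proof (rule Bochner_Integration.integral_diff[symmetric])
        show "integrable M (\<lambda>z. v z * of_real (g (G z)))"
          by (rule integrable_circle_mult[OF _ _ vC, where D = D]) (auto simp: D G)
        show "integrable M (\<lambda>z. v z * e (G z))"
          by (rule integrable_circle_mult[OF _ _ vC, where D = D']) (auto simp: D' G)
      qed
      show ?thesis unfolding diff
      proof (rule norm_integral_circle)
        fix z :: complex assume z: "cmod z = 1"
        have "cmod (of_real (g (G z)) - e (G z)) \<le> \<epsilon>"
          using p(2)[of "G z"] G[OF z] by (simp add: e_def flip: of_real_diff)
        then show "cmod (v z * of_real (g (G z)) - v z * e (G z)) \<le> C * \<epsilon>"
          unfolding right_diff_distrib[symmetric] norm_mult by (intro mult_mono vC z C0) auto
      qed measurable
    qed
    let ?I = "\<integral>z. u z * of_real (g (F z)) \<partial>M" and ?J = "\<integral>z. l z * of_real (g z) \<partial>M"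
    have "cmod (?I - (\<integral>z. u z * e (F z) \<partial>M)) \<le> C * \<epsilon>"
      by (rule close) (auto simp: uC cmod_F)
    moreover have "cmod (?J - (\<integral>z. u z * e (F z) \<partial>M)) \<le> C * \<epsilon>"
      unfolding transfer_char_span[OF mono e] by (rule close[of l "\<lambda>z. z"]) (auto simp: lC)
    moreover have "cmod (?I - ?J) \<le> cmod (?I - (\<integral>z. u z * e (F z) \<partial>M)) + cmod (?J - (\<integral>z. u z * e (F z) \<partial>M))"
      using norm_triangle_ineq4[of "?I - (\<integral>z. u z * e (F z) \<partial>M)" "?J - (\<integral>z. u z * e (F z) \<partial>M)"] by simp
    ultimately show ?thesis by simp
  qed
  note bound = this
  let ?d = "cmod ((\<integral>z. u z * of_real (g (F z)) \<partial>M) - (\<integral>z. l z * of_real (g z) \<partial>M))"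
  have "?d \<le> \<epsilon>" if "\<epsilon> > 0" for \<epsilon>
  proof -
    have "?d \<le> 2 * C * (\<epsilon> / (2 * C + 1))" using that C0 by (intro bound) simp
    also have "\<dots> \<le> \<epsilon>" using that C0 by (simp add: field_simps)
    finally show ?thesis .
  qed
  then have "?d \<le> 0" by (rule field_le_epsilon[of _ 0, simplified])
  then show ?thesis by simp
qed

end

text \<open>Adding the constant \<open>C\<close> turns \<open>u\<close> and \<open>l\<close> into nonnegative densities. The claim then says that the
image under \<open>F\<close> of the measure with density \<open>C + u\<close> is the measure with density \<open>C + l\<close>, and
finite measures are determined by continuous test functions.\<close>

lemma transfer_borel_real:
  fixes u l h :: "complex \<Rightarrow> real"
  assumes inv: "distr M borel F = M"
    and [measurable]: "u \<in> borel_measurable borel" "l \<in> borel_measurable borel" "h \<in> borel_measurable borel"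
    and uC: "\<And>z. cmod z = 1 \<Longrightarrow> \<bar>u z\<bar> \<le> C" and lC: "\<And>z. cmod z = 1 \<Longrightarrow> \<bar>l z\<bar> \<le> C"
    and hB: "\<And>z. cmod z = 1 \<Longrightarrow> \<bar>h z\<bar> \<le> B"
    and test: "\<And>g. continuous_on UNIV g \<Longrightarrow> bounded (range g) \<Longrightarrow>
      (\<integral>z. u z * g (F z) \<partial>M) = (\<integral>z. l z * g z \<partial>M)"
  shows "(\<integral>z. u z * h (F z) \<partial>M) = (\<integral>z. l z * h z \<partial>M)"
proof -
  define \<nu> where "\<nu> v G = distr (density M (\<lambda>z. ennreal (max 0 (C + v z)))) borel G" for v and G ::
      "complex \<Rightarrow> complex"
  have fin: "finite_measure (\<nu> v G)"
    if [measurable]: "v \<in> borel_measurable borel" "G \<in> borel_measurable borel" and vC: "\<And>z. cmod z = 1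
        \<Longrightarrow> \<bar>v z\<bar> \<le> C"
    for v and G :: "complex \<Rightarrow> complex"
  proof -
    have "integrable M (\<lambda>z. max 0 (C + v z))"
    proof (rule integrable_circle[where B = "2 * C"])
      fix z :: complex assume "cmod z = 1"
      from vC[OF this] show "norm (max 0 (C + v z)) \<le> 2 * C" by simp
    qed measurable
    then have "(\<integral>\<^sup>+ z. ennreal (max 0 (C + v z)) \<partial>M) < \<infinity>"
      using integrableD(2) by (simp add: integrable_iff_bounded)
    then have "finite_measure (density M (\<lambda>z. ennreal (max 0 (C + v z))))"
      by (intro finite_measureI) (simp add: emeasure_density less_top[symmetric] cong: nn_integral_cong)
    then show ?thesis unfolding \<nu>_def
      by (rule finite_measure.finite_measure_distr) measurable
  qed
  have int: "(\<integral>z. k z \<partial>\<nu> v G) = C * (\<integral>z. k (G z) \<partial>M) + (\<integral>z. v z * k (G z) \<partial>M)"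
    if [measurable]: "v \<in> borel_measurable borel" "G \<in> borel_measurable borel" "k \<in> borel_measurable borel"
      and vC: "\<And>z. cmod z = 1 \<Longrightarrow> \<bar>v z\<bar> \<le> C" and kD: "\<And>z. cmod z = 1 \<Longrightarrow> \<bar>k z\<bar> \<le> D"
      and G: "\<And>z. cmod z = 1 \<Longrightarrow> cmod (G z) = 1" for v k D and G :: "complex \<Rightarrow> complex"
  proof -
    have "(\<integral>z. k z \<partial>\<nu> v G) = (\<integral>z. k (G z) \<partial>density M (\<lambda>z. ennreal (max 0 (C + v z))))"
      unfolding \<nu>_def by (rule integral_distr) measurable
    also have "\<dots> = (\<integral>z. max 0 (C + v z) *\<^sub>R k (G z) \<partial>M)"
      by (rule integral_density) auto
    also have "\<dots> = (\<integral>z. C * k (G z) + v z * k (G z) \<partial>M)"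
    proof (rule integral_circle_cong)
      fix z :: complex assume "cmod z = 1"
      from vC[OF this] have "max 0 (C + v z) = C + v z" by simp
      then show "max 0 (C + v z) *\<^sub>R k (G z) = C * k (G z) + v z * k (G z)"
        by (simp add: distrib_right)
    qed measurable
    also have "\<dots> = C * (\<integral>z. k (G z) \<partial>M) + (\<integral>z. v z * k (G z) \<partial>M)"
    proof -
      have "integrable M (\<lambda>z. k (G z))"
        by (rule integrable_circle[where B = D]) (auto simp: kD G)
      moreover have "integrable M (\<lambda>z. v z * k (G z))"
      proof (rule integrable_circle[where B = "C * D"])
        fix z :: complex assume z: "cmod z = 1"
        show "norm (v z * k (G z)) \<le> C * D"
          unfolding real_norm_def abs_mult
          by (rule mult_mono) (use vC[OF z] kD[OF G[OF z]] in auto)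
      qed measurable
      ultimately show ?thesis by simp
    qed
    finally show ?thesis .
  qed
  have inv': "(\<integral>z. k (F z) \<partial>M) = (\<integral>z. k z \<partial>M)" if [measurable]: "k \<in> borel_measurable borel" for k ::
      "complex \<Rightarrow> real"
    by (subst (2) inv[symmetric], subst integral_distr) auto
  have "\<nu> u F = \<nu> l (\<lambda>z. z)"
  proof (rule finite_measure_eqI_continuous)
    fix g :: "complex \<Rightarrow> real" assume g: "continuous_on UNIV g" "bounded (range g)"
    have [measurable]: "g \<in> borel_measurable borel" by (rule borel_measurable_continuous_onI[OF g(1)])
    obtain D where D: "\<And>z. \<bar>g z\<bar> \<le> D" using g(2) by (auto simp: bounded_iff)
    show "(\<integral>z. g z \<partial>\<nu> u F) = (\<integral>z. g z \<partial>\<nu> l (\<lambda>z. z))"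
      using int[of u F g D] int[of l "\<lambda>z. z" g D] uC lC D cmod_F test[OF g] inv'[of g] by simp
  qed (use fin uC lC in \<open>auto simp: \<nu>_def\<close>)
  then have "C * (\<integral>z. h (F z) \<partial>M) + (\<integral>z. u z * h (F z) \<partial>M) = C * (\<integral>z. h z \<partial>M) + (\<integral>z. l z * h z \<partial>M)"
    using int[of u F h B] int[of l "\<lambda>z. z" h B] uC lC hB cmod_F by simp
  then show ?thesis using inv'[of h] by simp
qed

lemma transfer_borel:
  fixes u l h :: "complex \<Rightarrow> complex"
  assumes inv: "distr M borel F = M"
    and u [measurable]: "u \<in> borel_measurable borel" and l [measurable]: "l \<in> borel_measurable borel"
    and h [measurable]: "h \<in> borel_measurable borel"
    and uC: "\<And>z. cmod z = 1 \<Longrightarrow> cmod (u z) \<le> C" and lC: "\<And>z. cmod z = 1 \<Longrightarrow> cmod (l z) \<le> C"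
    and hB: "\<And>z. cmod z = 1 \<Longrightarrow> cmod (h z) \<le> B"
    and mono: "\<And>i k. (\<integral>z. u z * (F z ^ i * cnj (F z) ^ k) \<partial>M) = (\<integral>z. l z * (z ^ i * cnj z ^ k) \<partial>M)"
  shows "(\<integral>z. u z * h (F z) \<partial>M) = (\<integral>z. l z * h z \<partial>M)"
proof -
  have parts: "(\<integral>z. Re (u z) * k (F z) \<partial>M) = (\<integral>z. Re (l z) * k z \<partial>M)"
      "(\<integral>z. Im (u z) * k (F z) \<partial>M) = (\<integral>z. Im (l z) * k z \<partial>M)"
    if [measurable]: "k \<in> borel_measurable borel" and kB: "\<And>z. cmod z = 1 \<Longrightarrow> \<bar>k z\<bar> \<le> B" for k ::
        "complex \<Rightarrow> real"
  proof -
    have test: "(\<integral>z. Re (u z) * g (F z) \<partial>M) = (\<integral>z. Re (l z) * g z \<partial>M)"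
        "(\<integral>z. Im (u z) * g (F z) \<partial>M) = (\<integral>z. Im (l z) * g z \<partial>M)"
      if g: "continuous_on UNIV g" "bounded (range g)" for g :: "complex \<Rightarrow> real"
    proof -
      have [measurable]: "g \<in> borel_measurable borel" by (rule borel_measurable_continuous_onI[OF g(1)])
      obtain D where D: "\<And>z. \<bar>g z\<bar> \<le> D" using g(2) by (auto simp: bounded_iff)
      have int: "integrable M (\<lambda>z. u z * of_real (g (F z)))" "integrable M (\<lambda>z. l z * of_real (g z))"
        by (rule integrable_circle_mult[where C = C and D = D]; use uC lC D in simp)+
      have eq: "(\<integral>z. u z * of_real (g (F z)) \<partial>M) = (\<integral>z. l z * of_real (g z) \<partial>M)"
        by (rule transfer_continuous[OF u l uC lC mono g(1)])
      show "(\<integral>z. Re (u z) * g (F z) \<partial>M) = (\<integral>z. Re (l z) * g z \<partial>M)"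
        using arg_cong[OF eq, of Re] by (simp flip: integral_Re[OF int(1)] integral_Re[OF int(2)])
      show "(\<integral>z. Im (u z) * g (F z) \<partial>M) = (\<integral>z. Im (l z) * g z \<partial>M)"
        using arg_cong[OF eq, of Im] by (simp flip: integral_Im[OF int(1)] integral_Im[OF int(2)])
    qed
    have bounds: "\<bar>Re w\<bar> \<le> C" "\<bar>Im w\<bar> \<le> C" if "cmod w \<le> C" for w
      using that abs_Re_le_cmod[of w] abs_Im_le_cmod[of w] by linarith+
    show "(\<integral>z. Re (u z) * k (F z) \<partial>M) = (\<integral>z. Re (l z) * k z \<partial>M)"
      by (rule transfer_borel_real[OF inv _ _ _ _ _ kB test(1)]) (auto intro: bounds(1) uC lC)
    show "(\<integral>z. Im (u z) * k (F z) \<partial>M) = (\<integral>z. Im (l z) * k z \<partial>M)"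
      by (rule transfer_borel_real[OF inv _ _ _ _ _ kB test(2)]) (auto intro: bounds(2) uC lC)
  qed
  have hRe: "\<bar>Re (h z)\<bar> \<le> B" "\<bar>Im (h z)\<bar> \<le> B" if "cmod z = 1" for z
    using hB[OF that] abs_Re_le_cmod[of "h z"] abs_Im_le_cmod[of "h z"] by linarith+
  have int: "integrable M (\<lambda>z. u z * h (F z))" "integrable M (\<lambda>z. l z * h z)"
    by (rule integrable_circle_mult[where C = C and D = B]; use uC lC hB cmod_F in simp)+
  have real_int: "integrable M (\<lambda>z. p (v z) * q (k z))"
    if [measurable]: "v \<in> borel_measurable borel" "k \<in> borel_measurable borel"
      and "\<And>z. cmod z = 1 \<Longrightarrow> cmod (v z) \<le> C" "\<And>z. cmod z = 1 \<Longrightarrow> cmod (k z) \<le> B"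
      and "p = Re \<or> p = Im" "q = Re \<or> q = Im" for v k p q
  proof (rule integrable_circle[where B = "C * B"])
    have "\<bar>p w\<bar> \<le> cmod w" "\<bar>q w\<bar> \<le> cmod w" for w
      using that(5,6) abs_Re_le_cmod abs_Im_le_cmod by auto
    then have pq: "\<bar>p w\<bar> \<le> K" "\<bar>q w\<bar> \<le> K" if "cmod w \<le> K" for w K
      using that order_trans by blast+
    fix z :: complex assume z: "cmod z = 1"
    show "norm (p (v z) * q (k z)) \<le> C * B"
      unfolding real_norm_def abs_mult
      by (rule mult_mono[OF pq(1)[OF that(3)[OF z]] pq(2)[OF that(4)[OF z]] order_trans[OF norm_ge_zero
          that(3)[OF z]]]) simp
  qed (use that(5,6) in auto)
  have p: "(\<integral>z. Re (u z) * Re (h (F z)) \<partial>M) = (\<integral>z. Re (l z) * Re (h z) \<partial>M)"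
    "(\<integral>z. Re (u z) * Im (h (F z)) \<partial>M) = (\<integral>z. Re (l z) * Im (h z) \<partial>M)"
    "(\<integral>z. Im (u z) * Re (h (F z)) \<partial>M) = (\<integral>z. Im (l z) * Re (h z) \<partial>M)"
    "(\<integral>z. Im (u z) * Im (h (F z)) \<partial>M) = (\<integral>z. Im (l z) * Im (h z) \<partial>M)"
    by (rule parts; use hRe in simp)+
  show ?thesis
  proof (rule complex_eqI)
    show "Re (\<integral>z. u z * h (F z) \<partial>M) = Re (\<integral>z. l z * h z \<partial>M)"
      unfolding integral_Re[OF int(1), symmetric] integral_Re[OF int(2), symmetric] times_complex.sel
      using p(1,4)
      by (subst (1 2) Bochner_Integration.integral_diff) (auto intro!: real_int uC lC hB hRe simp: cmod_F)
    show "Im (\<integral>z. u z * h (F z) \<partial>M) = Im (\<integral>z. l z * h z \<partial>M)"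
      unfolding integral_Im[OF int(1), symmetric] integral_Im[OF int(2), symmetric] times_complex.sel
      using p(2,3)
      by (subst (1 2) Bochner_Integration.integral_add) (auto intro!: real_int uC lC hB hRe simp: cmod_F)
  qed
qed

end

context circle_map begin

lemma monomial_cases:
  assumes "cmod w = 1"
  shows "w ^ i * cnj w ^ k = (if k \<le> i then w ^ (i - k) else cnj w ^ (k - i))"
proof -
  have 1: "w * cnj w = 1" using assms by (simp add: complex_norm_square[symmetric])
  have "w ^ i * cnj w ^ k = w ^ (i - k) * (w * cnj w) ^ k" if "k \<le> i"
    using that by (simp add: power_mult_distrib mult.assoc flip: power_add)
  moreover have "w ^ i * cnj w ^ k = (w * cnj w) ^ i * cnj w ^ (k - i)" if "i \<le> k"
    using that by (simp add: power_mult_distrib mult.assoc flip: power_add)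
  ultimately show ?thesis by (auto simp: 1)
qed

text \<open>On the circle \<open>cnj z\<close> is inverse to \<open>z\<close>, so every mixed monomial is a pure power.\<close>

lemma monomials_reduce:
  assumes [measurable]: "u \<in> borel_measurable borel" "l \<in> borel_measurable borel"
    and pos: "\<And>k. (\<integral>z. u z * F z ^ k \<partial>M) = (\<integral>z. l z * z ^ k \<partial>M)"
    and neg: "\<And>k. (\<integral>z. u z * cnj (F z) ^ k \<partial>M) = (\<integral>z. l z * cnj z ^ k \<partial>M)"
  shows "(\<integral>z. u z * (F z ^ i * cnj (F z) ^ k) \<partial>M) = (\<integral>z. l z * (z ^ i * cnj z ^ k) \<partial>M)"
proof -
  have "(\<integral>z. l z * (z ^ i * cnj z ^ k) \<partial>M)
      = (\<integral>z. l z * (if k \<le> i then z ^ (i - k) else cnj z ^ (k - i)) \<partial>M)"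
    by (rule integral_circle_cong) (auto simp: monomial_cases)
  then show ?thesis
    using pos[of "i - k"] neg[of "k - i"] by (cases "k \<le> i") (simp_all add: monomial_cases[OF cmod_F])
qed

end

section \<open>Radial limits and means on the circle\<close>

lemma measurable_circle_continuous:
  fixes g :: "complex \<Rightarrow> 'b::topological_space"
  assumes "continuous_on (sphere 0 1) g"
  shows "g \<in> borel_measurable circle_measure"
  using borel_measurable_continuous_on_restrict[OF assms]
  by (simp cong: measurable_cong_sets add: sets_circle_measure)

lemma integral_circle_measure:
  fixes g :: "complex \<Rightarrow> complex"
  assumes g: "continuous_on (sphere 0 1) g"
  shows "(\<integral>z. g z \<partial>circle_measure) = integral {0..2 * pi} (\<lambda>t. g (cis t)) / of_real (2 * pi)"
proof -
  let ?U = "uniform_measure lborel {0..<2 * pi}"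
  have cis: "cis \<in> ?U \<rightarrow>\<^sub>M restrict_space borel (sphere 0 1)"
  proof (rule measurable_restrict_space2)
    have "cis \<in> borel_measurable borel"
      by (intro borel_measurable_continuous_onI continuous_intros)
    then show "cis \<in> borel_measurable ?U"
      by (simp cong: measurable_cong_sets)
  qed auto
  have cont: "continuous_on UNIV (\<lambda>t. g (cis t))"
    by (rule continuous_on_compose2[OF g]) (auto intro!: continuous_intros)
  have [measurable]: "(\<lambda>t. g (cis t)) \<in> borel_measurable borel"
    by (rule borel_measurable_continuous_onI[OF cont])
  have "(\<integral>z. g z \<partial>circle_measure) = (\<integral>t. g (cis t) \<partial>?U)"
    unfolding circle_measure_def
    by (rule integral_distr[OF cis borel_measurable_continuous_on_restrict[OF g]])
  also have "?U = density lborel (\<lambda>t. ennreal (indicator {0..<2 * pi} t / (2 * pi)))"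
    unfolding uniform_measure_def
    by (rule arg_cong[where f = "density lborel"])
        (auto simp: divide_ennreal[symmetric] split: split_indicator)
  also have "(\<integral>t. g (cis t) \<partial>\<dots>) = (\<integral>t. (indicator {0..<2 * pi} t / (2 * pi)) *\<^sub>R g (cis t) \<partial>lborel)"
    by (rule integral_density) auto
  also have "\<dots> = (\<integral>t. (1 / (2 * pi)) *\<^sub>R (indicator {0..2 * pi} t *\<^sub>R g (cis t)) \<partial>lborel)"
  proof (rule integral_cong_AE)
    show "AE t in lborel. (indicator {0..<2 * pi} t / (2 * pi)) *\<^sub>R g (cis t)
        = (1 / (2 * pi)) *\<^sub>R (indicator {0..2 * pi} t *\<^sub>R g (cis t))"
      using AE_lborel_singleton[of "2 * pi"]
      by eventually_elim (auto simp: indicator_def)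
  qed measurable
  also have "\<dots> = (1 / (2 * pi)) *\<^sub>R (LINT t:{0..2 * pi}|lborel. g (cis t))"
    unfolding set_lebesgue_integral_def by (rule integral_scaleR_right)
  also have "(LINT t:{0..2 * pi}|lborel. g (cis t)) = integral {0..2 * pi} (\<lambda>t. g (cis t))"
    by (intro set_borel_integral_eq_integral(2))
      (unfold set_integrable_def, intro borel_integrable_compact continuous_on_subset[OF cont], auto)
  finally show ?thesis by (simp add: scaleR_conv_of_real field_simps)
qed

text \<open>Cauchy's formula at the centre of the circle of radius \<open>r\<close>.\<close>

lemma circle_mean_value:
  assumes G: "G holomorphic_on ball 0 1" and r: "0 < r" "r < 1"
  shows "(\<integral>z. G (of_real r * z) \<partial>circle_measure) = G 0"
proof -
  have sub: "cball 0 r \<subseteq> ball (0::complex) 1" using r by auto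
  have "((\<lambda>u. G u / (u - 0)) has_contour_integral 2 * of_real pi * \<i> * G 0) (circlepath 0 r)"
    by (rule Cauchy_integral_circlepath_simple) (use holomorphic_on_subset[OF G sub] r in auto)
  then have "((\<lambda>t. G (of_real r * cis t) / (of_real r * cis t) * r * \<i> * cis t) has_integral 2
      * of_real pi * \<i> * G 0) {0..2 * pi}"
    unfolding circlepath_def by (subst (asm) has_contour_integral_part_circlepath_iff) auto
  moreover have "(\<lambda>t. G (of_real r * cis t) / (of_real r * cis t) * r * \<i> * cis t)
      = (\<lambda>t. \<i> * G (of_real r * cis t))"
    using r by (auto simp: fun_eq_iff)
  ultimately have "((\<lambda>t. \<i> * G (of_real r * cis t)) has_integral 2 * of_real pi * \<i> * G 0) {0..2 * pi}"
    by simp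
  then have "((\<lambda>t. - \<i> * (\<i> * G (of_real r * cis t))) has_integral
      - \<i> * (2 * of_real pi * \<i> * G 0)) {0..2 * pi}"
    by (rule has_integral_mult_right)
  moreover have "- \<i> * (\<i> * w) = w" "- \<i> * (2 * of_real pi * \<i> * w) = 2 * of_real pi * w" for w
    by (simp_all add: complex_eq_iff)
  ultimately have "((\<lambda>t. G (of_real r * cis t)) has_integral 2 * of_real pi * G 0) {0..2 * pi}"
    by (simp only:)
  moreover have "continuous_on (sphere 0 1) (\<lambda>z. G (of_real r * z))"
    by (rule continuous_on_compose2[OF holomorphic_on_imp_continuous_on[OF G]])
      (use r in \<open>auto intro!: continuous_intros simp: norm_mult\<close>)
  ultimately show ?thesis
    by (simp add: integral_circle_measure integral_unique)
qed

lemma radial_sequence: "filterlim (\<lambda>n. 1 - 1 / real (n + 2)) (at_left 1) sequentially"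
  unfolding filterlim_at
proof
  have "(\<lambda>n. 1 - 1 / real (n + 2)) \<longlonglongrightarrow> 1 - 0"
    by (intro tendsto_diff tendsto_const real_tendsto_divide_at_top[OF tendsto_const]
        filterlim_compose[OF filterlim_real_sequentially] filterlim_add_const_nat_at_top)
  then show "(\<lambda>n. 1 - 1 / real (n + 2)) \<longlonglongrightarrow> 1" by simp
qed auto

text \<open>The mean value property on circles of radius below 1 passes to the radial limit by dominated
convergence.\<close>

lemma boundary_mean_value:
  assumes G: "G holomorphic_on ball 0 1" and B: "\<And>z. z \<in> ball 0 1 \<Longrightarrow> cmod (G z) \<le> B"
    and g: "g \<in> borel_measurable circle_measure"
    and lim: "AE z in circle_measure. ((\<lambda>r. G (of_real r * z)) \<longlongrightarrow> g z) (at_left (1::real))"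
  shows "(\<integral>z. g z \<partial>circle_measure) = G 0"
proof -
  interpret prob_space circle_measure by (rule prob_space_circle_measure)
  let ?r = "\<lambda>n. 1 - 1 / real (n + 2)"
  have r: "0 < ?r n" "?r n < 1" for n by (auto simp: field_simps)
  have inball: "of_real (?r n) * z \<in> ball 0 1" if "z \<in> sphere 0 1" for n and z :: complex
    using that r[of n] by (simp only: mem_ball_0 mem_sphere_0 norm_mult norm_of_real) auto
  have "(\<lambda>n. \<integral>z. G (of_real (?r n) * z) \<partial>circle_measure) \<longlonglongrightarrow> (\<integral>z. g z \<partial>circle_measure)"
  proof (rule integral_dominated_convergence[where w = "\<lambda>_. B"])
    show "(\<lambda>z. G (of_real (?r n) * z)) \<in> borel_measurable circle_measure" for n
    proof (rule measurable_circle_continuous, rule continuous_on_compose2[OF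
        holomorphic_on_imp_continuous_on[OF G]])
      show "(\<lambda>z::complex. of_real (?r n) * z) ` sphere 0 1 \<subseteq> ball 0 1" using inball by blast
    qed (intro continuous_intros)
    show "AE z in circle_measure. (\<lambda>n. G (of_real (?r n) * z)) \<longlonglongrightarrow> g z"
      using lim by eventually_elim (rule filterlim_compose[OF _ radial_sequence])
    show "AE z in circle_measure. norm (G (of_real (?r n) * z)) \<le> B" for n
      using AE_space by eventually_elim (use B inball in auto)
  qed (use g in auto)
  moreover have "(\<integral>z. G (of_real (?r n) * z) \<partial>circle_measure) = G 0" for n
    by (rule circle_mean_value[OF G r])
  ultimately show ?thesis by (simp add: LIMSEQ_const_iff)
qed

text \<open>Dividing out the zero of \<open>G - G 0\<close> at the origin keeps the function bounded: away from the origin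
the divisor has modulus at least \<open>1/2\<close>, and near the origin continuity on a compact disc suffices.\<close>

lemma divided_difference_holomorphic:
  assumes G: "G holomorphic_on ball 0 1" and B: "\<And>z. z \<in> ball 0 1 \<Longrightarrow> cmod (G z) \<le> B"
  obtains H C where "H holomorphic_on ball 0 1" "\<And>z. z \<in> ball 0 1 \<Longrightarrow> cmod (H z) \<le> C"
    "\<And>z. z \<in> ball 0 1 \<Longrightarrow> G z = G 0 + z * H z" "H 0 = deriv G 0"
proof -
  define H where "H z = (if z = 0 then deriv G 0 else (G z - G 0) / (z - 0))" for z
  have H: "H holomorphic_on ball 0 1"
    unfolding H_def by (rule pole_lemma_open[OF G open_ball])
  have "bounded (H ` cball 0 (1 / 2))"
  proof (intro compact_imp_bounded compact_continuous_image compact_cball)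
    show "continuous_on (cball 0 (1 / 2)) H"
      by (rule continuous_on_subset[OF holomorphic_on_imp_continuous_on[OF H]]) auto
  qed
  then obtain C where C: "\<And>z. cmod z \<le> 1 / 2 \<Longrightarrow> cmod (H z) \<le> C"
    unfolding bounded_iff by force
  show thesis
  proof (rule that[OF H, of "max C (4 * B)"])
    fix z :: complex assume z: "z \<in> ball 0 1"
    show "G z = G 0 + z * H z" by (simp add: H_def)
    show "cmod (H z) \<le> max C (4 * B)"
    proof (cases "cmod z \<le> 1 / 2")
      case True
      then show ?thesis using C by fastforce
    next
      case False
      have "cmod (G z - G 0) \<le> 2 * B"
        using norm_triangle_ineq4[of "G z" "G 0"] B[OF z] B[of 0] by simp
      moreover have "cmod (H z) * cmod z = cmod (G z - G 0)"
        using False by (auto simp: H_def norm_divide)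
      moreover have "cmod (H z) * (1 / 2) \<le> cmod (H z) * cmod z"
        using False by (intro mult_left_mono) auto
      ultimately show ?thesis by simp
    qed
  qed (simp add: H_def)
qed

text \<open>The Cauchy criterion, with bounds in a countable family. Its point is that for a continuous
function the condition for fixed \<open>k\<close> and \<open>n\<close> defines a closed set of directions, an intersection
of closed sets, so that the set on which the radial limit exists is Borel.\<close>

lemma radial_limit_exists_iff:
  fixes u :: "real \<Rightarrow> complex"
  shows "(\<exists>w. (u \<longlongrightarrow> w) (at_left 1)) \<longleftrightarrow>
    (\<forall>k::nat. \<exists>n::nat. \<forall>p\<in>{1 - 1 / real (n + 2)<..<1}. \<forall>q\<in>{1 - 1 / real (n + 2)<..<1}.
       dist (u p) (u q) \<le> 1 / real (k + 1))" (is "?L \<longleftrightarrow> (\<forall>k. \<exists>n. ?C k n)")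
proof (intro iffI allI)
  fix k :: nat
  assume ?L
  then obtain w where w: "(u \<longlongrightarrow> w) (at_left 1)" by blast
  have "\<forall>\<^sub>F r in at_left 1. dist (u r) w < 1 / real (2 * (k + 1))"
    by (rule tendstoD[OF w]) simp
  then obtain b where b: "b < 1" "\<And>r. b < r \<Longrightarrow> r < 1 \<Longrightarrow> dist (u r) w < 1 / real (2 * (k + 1))"
    using eventually_at_left[of 0 "1::real"] by (auto simp: eventually_at_left_field)
  obtain n :: nat where n: "1 / (1 - b) < real n" using reals_Archimedean2 by blast
  have "b \<le> 1 - 1 / real (n + 2)"
  proof -
    have "1 / (1 - b) < real (n + 2)" using n by simp
    then have "1 < real (n + 2) * (1 - b)" using b(1) by (simp add: pos_divide_less_eq)
    then have "1 / real (n + 2) < 1 - b" by (subst pos_divide_less_eq) (auto simp: mult.commute)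
    then show ?thesis by simp
  qed
  then have "dist (u p) (u q) \<le> 1 / real (k + 1)"
    if "p \<in> {1 - 1 / real (n + 2)<..<1}" "q \<in> {1 - 1 / real (n + 2)<..<1}" for p q
  proof -
    have "dist (u p) (u q) \<le> dist (u p) w + dist (u q) w" by (rule dist_triangle2)
    also have "\<dots> \<le> 1 / real (2 * (k + 1)) + 1 / real (2 * (k + 1))"
      using b(2)[of p] b(2)[of q] that \<open>b \<le> _\<close> by simp
    also have "\<dots> = 1 / real (k + 1)" by (simp add: field_simps)
    finally show ?thesis .
  qed
  then show "\<exists>n. ?C k n" by blast
next
  assume C: "\<forall>k. \<exists>n. ?C k n"
  let ?r = "\<lambda>n. 1 - 1 / real (n + 2)"
  have mono: "?r n < ?r m" if "n < m" for n m using that by (simp add: frac_less2)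
  have "Cauchy (\<lambda>m. u (?r m))"
  proof (rule metric_CauchyI)
    fix e :: real assume "e > 0"
    then obtain k :: nat where k: "1 / real (k + 1) < e" using nat_approx_posE[of e] by auto
    obtain n where n: "?C k n" using C by blast
    have "dist (u (?r m)) (u (?r m')) < e" if "m \<ge> Suc n" "m' \<ge> Suc n" for m m'
    proof -
      have "dist (u (?r m)) (u (?r m')) \<le> 1 / real (k + 1)"
        using n mono[of n m] mono[of n m'] that by simp
      then show ?thesis using k by simp
    qed
    then show "\<exists>n. \<forall>m\<ge>n. \<forall>m'\<ge>n. dist (u (?r m)) (u (?r m')) < e" by blast
  qed
  then obtain w where w: "(\<lambda>m. u (?r m)) \<longlonglongrightarrow> w"
    using Cauchy_convergent_iff convergent_def by blast
  have "(u \<longlongrightarrow> w) (at_left 1)"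
  proof (rule tendstoI)
    fix e :: real assume "e > 0"
    then obtain k :: nat where k: "1 / real (k + 1) < e" using nat_approx_posE[of e] by auto
    obtain n where n: "?C k n" using C by blast
    have "dist (u p) w \<le> 1 / real (k + 1)" if p: "p \<in> {?r n<..<1}" for p
    proof (rule LIMSEQ_le_const2)
      show "(\<lambda>m. dist (u p) (u (?r m))) \<longlonglongrightarrow> dist (u p) w" by (intro tendsto_intros w)
      show "\<exists>N. \<forall>m\<ge>N. dist (u p) (u (?r m)) \<le> 1 / real (k + 1)"
      proof (intro exI allI impI)
        fix m assume "m \<ge> Suc n"
        then have "?r m \<in> {?r n<..<1}" using mono[of n m] by simp
        then show "dist (u p) (u (?r m)) \<le> 1 / real (k + 1)" using n p by blast
      qed
    qed
    then have "\<And>p. ?r n < p \<Longrightarrow> p < 1 \<Longrightarrow> dist (u p) w < e" using k by fastforce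
    moreover have "?r n < 1" by simp
    ultimately show "\<forall>\<^sub>F p in at_left 1. dist (u p) w < e"
      unfolding eventually_at_left_field by blast
  qed
  then show ?L by blast
qed

lemma of_real_radius_in_ball:
  assumes "z \<in> cball 0 1" "0 < r" "r < 1"
  shows "complex_of_real r * z \<in> ball 0 1"
proof -
  have "r * cmod z \<le> r * 1" using assms by (intro mult_left_mono) auto
  then have "r * cmod z < 1" using assms(3) by linarith
  then show ?thesis using assms by (simp add: norm_mult)
qed

lemma measurable_boundary:
  assumes f: "continuous_on (ball 0 1) f"
  shows "boundary f \<in> borel_measurable (restrict_space borel (cball 0 1))"
proof -
  let ?D = "cball (0::complex) 1" and ?r = "\<lambda>n::nat. 1 - 1 / real (n + 2)"
  let ?M = "restrict_space borel (cball (0::complex) 1)"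
  have rpos: "0 < p" if "?r n < p" for n and p :: real
  proof -
    have "0 < ?r n" by (simp add: field_simps)
    then show ?thesis using that by linarith
  qed
  have cont: "continuous_on ?D (\<lambda>z. f (of_real p * z))" if "0 < p" "p < 1" for p :: real
    by (rule continuous_on_compose2[OF f])
        (use of_real_radius_in_ball that in \<open>auto intro!: continuous_intros\<close>)
  \<comment> \<open>The sets of the Cauchy criterion for radial limits, with the radii ranging over a whole interval:
    closed as intersections of closed sets.\<close>
  define C where "C k n = (\<Inter>p\<in>{?r n<..<1}. \<Inter>q\<in>{?r n<..<1}.
      {z \<in> ?D. dist (f (of_real p * z)) (f (of_real q * z)) \<le> 1 / real (k + 1)})" for k n :: nat
  have "closed (C k n)" for k n
    unfolding C_def
    by (intro closed_INT ballI continuous_on_closed_Collect_le continuous_intros cont closed_cball)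
      (auto intro: rpos)
  then have C [measurable]: "C k n \<in> sets borel" for k n by simp
  define E where "E = (\<Inter>k. \<Union>n. C k n)"
  have [measurable]: "E \<in> sets borel" unfolding E_def by measurable
  have E: "z \<in> E \<longleftrightarrow> (\<exists>w. ((\<lambda>r. f (of_real r * z)) \<longlongrightarrow> w) (at_left (1::real)))" if z: "z \<in> ?D" for z
  proof -
    have "z \<in> C k n \<longleftrightarrow> (\<forall>p\<in>{?r n<..<1}. \<forall>q\<in>{?r n<..<1}.
        dist (f (of_real p * z)) (f (of_real q * z)) \<le> 1 / real (k + 1))" for k n
      using z unfolding C_def INT_iff mem_Collect_eq by blast
    then show ?thesis
      unfolding radial_limit_exists_iff E_def INT_iff UN_iff by (simp only: ball_UNIV bex_UNIV)
  qed
  have meas: "(\<lambda>z. if z \<in> E then lim (\<lambda>n. f (of_real (?r n) * z)) else 0) \<in> borel_measurable ?M"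
  proof (rule measurable_If)
    show "(\<lambda>z. lim (\<lambda>n. f (of_real (?r n) * z))) \<in> borel_measurable ?M"
    proof (rule borel_measurable_lim_metric)
      show "(\<lambda>z. f (of_real (?r n) * z)) \<in> borel_measurable ?M" for n
        by (rule borel_measurable_continuous_on_restrict, rule cont) (auto simp: field_simps)
    qed
    show "{z \<in> space ?M. z \<in> E} \<in> sets ?M"
      by (auto simp: space_restrict_space sets_restrict_space Collect_conj_eq Int_commute intro!: imageI)
  qed simp
  have eq: "(if z \<in> E then lim (\<lambda>n. f (of_real (?r n) * z)) else 0) = boundary f z" if z: "z \<in> space ?M"
      for z
  proof (cases "z \<in> E")
    case True
    have zD: "z \<in> ?D" using z by (simp add: space_restrict_space)
    with True obtain w where w: "((\<lambda>r. f (of_real r * z)) \<longlongrightarrow> w) (at_left (1::real))"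
      using E by blast
    have "(\<lambda>n. f (of_real (?r n) * z)) \<longlonglongrightarrow> w"
      by (rule filterlim_compose[OF w radial_sequence])
    then have "lim (\<lambda>n. f (of_real (?r n) * z)) = w" by (rule limI)
    moreover have "Lim (at_left 1) (\<lambda>r. f (of_real r * z)) = w"
      by (rule tendsto_Lim[OF _ w]) simp
    ultimately show ?thesis using True w by (auto simp: boundary_def)
  next
    case False
    then show ?thesis using E z by (auto simp: boundary_def space_restrict_space)
  qed
  show ?thesis by (rule iffD1[OF measurable_cong[OF eq] meas])
qed

lemma boundary_eq_limit:
  assumes "((\<lambda>r. f (of_real r * z)) \<longlongrightarrow> w) (at_left (1::real))"
  shows "boundary f z = w"
  using assms tendsto_Lim[OF _ assms] by (auto simp: boundary_def)

lemma boundary_in_cball: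
  assumes f: "f ` ball 0 1 \<subseteq> ball 0 1" and z: "z \<in> cball 0 1"
  shows "boundary f z \<in> cball 0 1"
proof (cases "\<exists>w. ((\<lambda>r. f (of_real r * z)) \<longlongrightarrow> w) (at_left (1::real))")
  case True
  then obtain w where w: "((\<lambda>r. f (of_real r * z)) \<longlongrightarrow> w) (at_left (1::real))" by blast
  have "\<forall>\<^sub>F r in at_left (1::real). f (of_real r * z) \<in> cball 0 1"
    unfolding eventually_at_left_field
  proof (intro exI[of _ 0] conjI allI impI)
    fix r :: real assume "0 < r" "r < 1"
    then show "f (of_real r * z) \<in> cball 0 1"
      using f of_real_radius_in_ball[OF z] ball_subset_cball by blast
  qed simp
  then have "w \<in> cball 0 1"
    by (rule Lim_in_closed_set[OF closed_cball _ _ w]) simp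
  then show ?thesis by (simp add: boundary_eq_limit[OF w])
next
  case False
  then show ?thesis by (simp add: boundary_def)
qed

text \<open>Boundary values may leave the circle but never the closed disc, so the boundary function is
iterated as a Borel map of the closed disc into itself.\<close>

lemma measurable_boundary_funpow:
  assumes f: "continuous_on (ball 0 1) f" "f ` ball 0 1 \<subseteq> ball 0 1"
  shows "(boundary f ^^ n) \<in> borel_measurable circle_measure"
proof -
  let ?M = "restrict_space borel (cball (0::complex) 1)"
  have b: "boundary f \<in> ?M \<rightarrow>\<^sub>M ?M"
    by (rule measurable_restrict_space2)
      (use measurable_boundary[OF f(1)] boundary_in_cball[OF f(2)] in \<open>auto simp: space_restrict_space\<close>)
  have "(boundary f ^^ n) \<in> ?M \<rightarrow>\<^sub>M ?M"
  proof (induction n)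
    case (Suc n)
    show ?case unfolding funpow.simps by (rule measurable_comp[OF Suc.IH b])
  qed (simp add: id_def)
  then have "(boundary f ^^ n) \<in> borel_measurable ?M"
    using measurable_restrict_space2_iff by blast
  then have "(boundary f ^^ n) \<in> borel_measurable (restrict_space borel (sphere 0 1))"
    by (rule measurable_restrict_mono) auto
  then show ?thesis by (simp cong: measurable_cong_sets add: sets_circle_measure)
qed

section \<open>Inner functions satisfy the transfer relations\<close>

text \<open>The carrier is the whole plane, as the setting of \<open>circle_map\<close> requires.\<close>

definition circle_borel :: "complex measure" where
  "circle_borel = distr circle_measure borel (\<lambda>z. z)"

lemma measurable_circle_id: "(\<lambda>z. z) \<in> circle_measure \<rightarrow>\<^sub>M borel"
  by (rule measurable_circle_continuous) (rule continuous_on_id)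

lemma integral_circle_borel:
  fixes g :: "complex \<Rightarrow> 'b::{banach, second_countable_topology}"
  assumes "g \<in> borel_measurable borel"
  shows "(\<integral>z. g z \<partial>circle_borel) = (\<integral>z. g z \<partial>circle_measure)"
  unfolding circle_borel_def by (rule integral_distr[OF measurable_circle_id assms])

lemma measurable_circle_borel: "g \<in> borel_measurable borel \<Longrightarrow> g \<in> borel_measurable circle_measure"
  by (rule measurable_compose[OF measurable_circle_id])

text \<open>With \<open>f z = z * q z\<close>, \<open>q z = a + z * p z\<close>, and \<open>F = z * Q\<close>, \<open>Q = a + z * P\<close> for the radial limits,
negative powers of \<open>z\<close> cancel against the factors of \<open>F\<close>: for \<open>k \<ge> j\<close> the integrand
\<open>(cnj z) ^ j * F z ^ k\<close> equals \<open>z ^ (k - j) * Q z ^ k\<close> on the circle and has the mean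
\<open>0 ^ (k - j) * a ^ k\<close>. The single remaining interesting case \<open>j = 2\<close>, \<open>k = 1\<close> gives
\<open>(cnj z)\<^sup>2 * F z = P z + a * cnj z\<close> with mean \<open>b = p 0\<close>. The map \<open>F\<close> is the boundary function,
redefined as 1 on the null set where it is not unimodular.\<close>

theorem inner_function_circle_transfer:
  assumes inner: "inner_function f" and f0: "f 0 = 0" and rot: "\<not> is_rotation f"
  obtains F b where "circle_transfer circle_borel F (deriv f 0) b"
    "{z. cmod z = 1 \<and> boundary f z = F z} \<in> sets borel"
    "AE z in circle_borel. cmod z = 1 \<and> boundary f z = F z"
proof -
  have hol: "f holomorphic_on ball 0 1" and ball: "f ` ball 0 1 \<subseteq> ball 0 1"
    and lim: "AE z in circle_measure. \<exists>w. ((\<lambda>r. f (of_real r * z)) \<longlongrightarrow> w) (at_left (1::real)) \<and> cmod w = 1"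
    using inner by (auto simp: inner_function_def)
  define a where "a = deriv f 0"
  have fb: "cmod (f z) \<le> 1" if "z \<in> ball 0 1" for z using ball that by fastforce
  obtain q Cq where q: "q holomorphic_on ball 0 1" "\<And>z. z \<in> ball 0 1 \<Longrightarrow> cmod (q z) \<le> Cq"
    "\<And>z. z \<in> ball 0 1 \<Longrightarrow> f z = f 0 + z * q z" "q 0 = deriv f 0"
    by (rule divided_difference_holomorphic[OF hol]) (rule fb, assumption, blast intro: that)
  obtain p Cp where p: "p holomorphic_on ball 0 1" "\<And>z. z \<in> ball 0 1 \<Longrightarrow> cmod (p z) \<le> Cp"
    "\<And>z. z \<in> ball 0 1 \<Longrightarrow> q z = q 0 + z * p z" "p 0 = deriv q 0"
    by (rule divided_difference_holomorphic[OF q(1)]) (rule q(2), assumption, blast intro: that)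
  define b where "b = p 0"
  have a1: "cmod a < 1"
  proof -
    have no: "\<And>z. cmod z < 1 \<Longrightarrow> cmod (f z) < 1" using ball by fastforce
    have "cmod a \<le> 1" unfolding a_def by (rule Schwarz_Lemma(2)[OF hol f0 no, of 0]) auto
    moreover have "cmod a \<noteq> 1"
    proof
      assume "cmod a = 1"
      then have "\<exists>\<alpha>. (\<forall>z. cmod z < 1 \<longrightarrow> f z = \<alpha> * z) \<and> cmod \<alpha> = 1"
        unfolding a_def by (intro Schwarz_Lemma(3)[OF hol f0 no, of 0]) auto
      then show False using rot by (auto simp: is_rotation_def)
    qed
    ultimately show ?thesis by simp
  qed
  have cont: "continuous_on (ball 0 1) f" by (rule holomorphic_on_imp_continuous_on[OF hol])
  \<comment> \<open>Outside the closed disc \<open>boundary f\<close> depends on arbitrary values of \<open>f\<close>.\<close>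
  define B0 where "B0 z = (if z \<in> cball 0 1 then boundary f z else 0)" for z
  have [measurable]: "B0 \<in> borel_measurable borel"
    unfolding B0_def using measurable_boundary[OF cont]
    by (subst (asm) measurable_restrict_space_iff[where c = 0]) auto
  define F where "F z = (if cmod z = 1 \<and> cmod (B0 z) = 1 then B0 z else 1)" for z
  have F [measurable]: "F \<in> borel_measurable borel" unfolding F_def by measurable
  have Fnorm: "cmod (F z) = 1" for z by (simp add: F_def)
  have Flim: "AE z in circle_measure. ((\<lambda>r. f (of_real r * z)) \<longlongrightarrow> F z) (at_left (1::real)) \<and> boundary f z
      = F z"
    using lim AE_space
  proof eventually_elim
    case (elim z)
    then obtain w where w: "((\<lambda>r. f (of_real r * z)) \<longlongrightarrow> w) (at_left (1::real))" "cmod w = 1" by blast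
    then have "boundary f z = w" by (intro boundary_eq_limit)
    moreover have "F z = w" using elim calculation w(2) by (simp add: F_def B0_def)
    ultimately show ?case using w(1) by simp
  qed
  interpret CM: prob_space circle_measure by (rule prob_space_circle_measure)
  interpret M: circle_map circle_borel F
  proof (intro circle_map.intro circle_map_axioms.intro)
    show "prob_space circle_borel" unfolding circle_borel_def
      by (rule CM.prob_space_distr[OF measurable_circle_id])
    show "sets circle_borel = sets borel" by (simp add: circle_borel_def)
    show "AE z in circle_borel. cmod z = 1"
      unfolding circle_borel_def
      by (subst AE_distr_iff[OF measurable_circle_id]) (use AE_space in \<open>auto elim: AE_mp\<close>)
  qed (use Fnorm in auto)
  let ?M = circle_borel
  have cauchy: "(\<integral>z. g z \<partial>?M) = G 0"
    if "G holomorphic_on ball 0 1" "\<And>z. z \<in> ball 0 1 \<Longrightarrow> cmod (G z) \<le> C" "g \<in> borel_measurable borel"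
      "AE z in circle_measure. ((\<lambda>r. G (of_real r * z)) \<longlongrightarrow> g z) (at_left (1::real))" for G g C
    unfolding integral_circle_borel[OF that(3)]
    by (rule boundary_mean_value[OF that(1,2) measurable_circle_borel[OF that(3)] that(4)])
  have id_lim: "((\<lambda>r. of_real r * z) \<longlongrightarrow> z) (at_left (1::real))" for z :: complex
    by (rule tendsto_eq_rhs[OF tendsto_mult[OF tendsto_of_real[OF tendsto_ident_at] tendsto_const]]) simp
  have inside: "\<forall>\<^sub>F r in at_left (1::real). of_real r * z \<in> ball 0 1 - {0}" if z: "cmod z = 1"
      for z :: complex
    unfolding eventually_at_left_field
    using z by (intro exI[of _ 0]) (auto simp: norm_mult)
  define Q where "Q z = cnj z * F z" for z
  define P where "P z = cnj z * (Q z - a)" for z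
  have [measurable]: "Q \<in> borel_measurable borel" "P \<in> borel_measurable borel"
    unfolding P_def Q_def by measurable
  have Qlim: "AE z in circle_measure. ((\<lambda>r. q (of_real r * z)) \<longlongrightarrow> Q z) (at_left (1::real))"
    using Flim AE_space
  proof eventually_elim
    case (elim z)
    then have z: "cmod z = 1" by simp
    have "((\<lambda>r. f (of_real r * z) / (of_real r * z)) \<longlongrightarrow> F z / z) (at_left (1::real))"
      using z by (intro tendsto_divide id_lim conjunct1[OF elim(1)]) auto
    moreover have "\<forall>\<^sub>F r in at_left (1::real). f (of_real r * z) / (of_real r * z) = q (of_real r * z)"
      using inside[OF z]
    proof eventually_elim
      case (elim r)
      then show ?case using q(3)[of "of_real r * z"] by (simp add: f0)
    qed
    moreover have "F z / z = Q z"
      using z by (subst complex_div_cnj) (simp add: Q_def mult.commute)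
    ultimately show ?case using Lim_transform_eventually by fastforce
  qed
  have Plim: "AE z in circle_measure. ((\<lambda>r. p (of_real r * z)) \<longlongrightarrow> P z) (at_left (1::real))"
    using Qlim AE_space
  proof eventually_elim
    case (elim z)
    then have z: "cmod z = 1" by simp
    have "((\<lambda>r. (q (of_real r * z) - a) / (of_real r * z)) \<longlongrightarrow> (Q z - a) / z) (at_left (1::real))"
      using z by (intro tendsto_divide tendsto_diff id_lim tendsto_const elim(1)) auto
    moreover have "\<forall>\<^sub>F r in at_left (1::real). (q (of_real r * z) - a) / (of_real r * z)
        = p (of_real r * z)"
      using inside[OF z]
    proof eventually_elim
      case (elim r)
      then show ?case using p(3)[of "of_real r * z"] by (simp add: q(4) a_def)
    qed
    moreover have "(Q z - a) / z = P z"
      using z by (subst complex_div_cnj) (simp add: P_def mult.commute)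
    ultimately show ?case using Lim_transform_eventually by fastforce
  qed
  have zF: "(\<integral>z. z ^ j * F z ^ k \<partial>?M) = 0 ^ j * 0 ^ k" for j k
  proof -
    have "(\<integral>z. z ^ j * F z ^ k \<partial>?M) = 0 ^ j * f 0 ^ k"
    proof (rule cauchy)
      show "(\<lambda>z. z ^ j * f z ^ k) holomorphic_on ball 0 1" by (intro holomorphic_intros hol)
      show "AE z in circle_measure. ((\<lambda>r. (of_real r * z) ^ j * f (of_real r * z) ^ k) \<longlongrightarrow> z ^ j
          * F z ^ k) (at_left (1::real))"
        using Flim by eventually_elim (intro tendsto_mult tendsto_power id_lim, simp)
      show "cmod (z ^ j * f z ^ k) \<le> 1 * 1" if "z \<in> ball 0 1" for z
        unfolding norm_mult norm_power using that fb[OF that] by (intro mult_mono power_le_one) auto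
    qed measurable
    then show ?thesis by (simp add: f0)
  qed
  have zQ: "(\<integral>z. z ^ j * Q z ^ k \<partial>?M) = 0 ^ j * a ^ k" for j k
  proof -
    have "(\<integral>z. z ^ j * Q z ^ k \<partial>?M) = 0 ^ j * q 0 ^ k"
    proof (rule cauchy)
      show "(\<lambda>z. z ^ j * q z ^ k) holomorphic_on ball 0 1" by (intro holomorphic_intros q)
      show "AE z in circle_measure. ((\<lambda>r. (of_real r * z) ^ j * q (of_real r * z) ^ k) \<longlongrightarrow> z ^ j
          * Q z ^ k) (at_left (1::real))"
        using Qlim by eventually_elim (intro tendsto_mult tendsto_power id_lim, simp)
      show "cmod (z ^ j * q z ^ k) \<le> 1 * Cq ^ k" if "z \<in> ball 0 1" for z
        unfolding norm_mult norm_power using that q(2)[OF that]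
            by (intro mult_mono power_le_one power_mono) auto
    qed measurable
    then show ?thesis by (simp add: q(4) a_def)
  qed
  have P_int: "(\<integral>z. P z \<partial>?M) = b"
    unfolding b_def by (rule cauchy[OF p(1,2)]) (use Plim in auto)
  have cz: "(\<integral>z. cnj z ^ j * z ^ k \<partial>?M) = (if j = k then 1 else 0)" for j k
  proof -
    have "(\<integral>z. cnj z ^ j * z ^ k \<partial>?M) = (\<integral>z. (if j \<le> k then z ^ (k - j) else cnj z ^ (j - k)) \<partial>?M)"
      by (rule M.integral_circle_cong) (auto simp: M.monomial_cases mult.commute[of "cnj _ ^ _"])
    moreover have "(\<integral>z. z ^ n \<partial>?M) = 0 ^ n" for n using zF[of n 0] by simp
    moreover have "(\<integral>z. cnj z ^ n \<partial>?M) = 0 ^ n" for n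
    proof -
      have "(\<integral>z. cnj (z ^ n) \<partial>?M) = cnj (\<integral>z. z ^ n \<partial>?M)" by (rule Bochner_Integration.integral_cnj)
      then show ?thesis using zF[of n 0] by simp
    qed
    ultimately show ?thesis
      by (cases j k rule: linorder_cases) (auto simp: M.prob_space power_0_left)
  qed
  have zc: "(\<integral>z. z ^ j * cnj z ^ k \<partial>?M) = (if j = k then 1 else 0)" for j k
    using cz[of k j] by (auto simp: mult.commute)
  have FQ: "F z = z * Q z" and zz: "cnj z * z = 1" if "cmod z = 1" for z
    using that by (simp_all add: Q_def mult.assoc[symmetric] complex_norm_square[symmetric]
        mult.commute[of "cnj z"])
  have conj: "(\<integral>z. z ^ j * cnj (F z) ^ k \<partial>?M) = cnj (\<integral>z. cnj z ^ j * F z ^ k \<partial>?M)" for j k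
  proof -
    have "(\<integral>z. cnj (cnj z ^ j * F z ^ k) \<partial>?M) = cnj (\<integral>z. cnj z ^ j * F z ^ k \<partial>?M)"
      by (rule Bochner_Integration.integral_cnj)
    then show ?thesis by simp
  qed
  have c: "(\<integral>z. cnj z ^ j * F z ^ (j + n) \<partial>?M) = 0 ^ n * a ^ (j + n)" for j n
  proof -
    have "(\<integral>z. cnj z ^ j * F z ^ (j + n) \<partial>?M) = (\<integral>z. z ^ n * Q z ^ (j + n) \<partial>?M)"
    proof (rule M.integral_circle_cong)
      fix z :: complex assume z: "cmod z = 1"
      have "cnj z ^ j * F z ^ (j + n) = (cnj z * z) ^ j * (z ^ n * Q z ^ (j + n))"
        by (simp add: FQ[OF z] power_mult_distrib power_add mult_ac)
      then show "cnj z ^ j * F z ^ (j + n) = z ^ n * Q z ^ (j + n)" by (simp add: zz[OF z])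
    qed measurable
    then show ?thesis by (simp add: zQ)
  qed
  have c1: "(\<integral>z. cnj z * F z ^ k \<partial>?M) = (if k = 1 then a else 0)" for k
  proof (cases k)
    case 0
    then show ?thesis using cz[of 1 0] by simp
  next
    case (Suc n)
    then show ?thesis using c[of 1 n] by (simp add: power_0_left)
  qed
  have c2: "(\<integral>z. (cnj z)\<^sup>2 * F z ^ k \<partial>?M) = (if k = 2 then a\<^sup>2 else if k = 1 then b else 0)" for k
  proof -
    consider "k = 0" | "k = 1" | n where "k = 2 + n" using nat_le_iff_add[of 2 k] by fastforce
    then show ?thesis
    proof cases
      case 1
      then show ?thesis using cz[of 2 0] by simp
    next
      case 2
      have "(\<integral>z. (cnj z)\<^sup>2 * F z ^ k \<partial>?M) = (\<integral>z. P z + a * cnj z \<partial>?M)"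
      proof (rule M.integral_circle_cong)
        fix z :: complex assume z: "cmod z = 1"
        have "(cnj z)\<^sup>2 * F z = cnj z * (cnj z * z) * Q z"
          by (simp add: FQ[OF z] power2_eq_square)
        also have "\<dots> = P z + a * cnj z"
          unfolding zz[OF z] P_def by (simp add: algebra_simps)
        finally show "(cnj z)\<^sup>2 * F z ^ k = P z + a * cnj z"
          using 2 by simp
      qed measurable
      also have "\<dots> = (\<integral>z. P z \<partial>?M) + a * (\<integral>z. cnj z \<partial>?M)"
      proof (subst Bochner_Integration.integral_add)
        show "integrable ?M P"
        proof (rule M.integrable_circle[where B = "1 + cmod a"])
          fix z :: complex assume z: "cmod z = 1"
          then show "cmod (P z) \<le> 1 + cmod a"
            using norm_triangle_ineq4[of "Q z" a]
                by (simp add: P_def norm_mult) (simp add: Q_def norm_mult Fnorm)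
        qed measurable
        show "integrable ?M (\<lambda>z. a * cnj z)"
          by (rule M.integrable_circle[where B = "cmod a"]) (auto simp: norm_mult)
      qed simp
      finally show ?thesis using 2 cz[of 1 0] by (simp add: P_int)
    next
      case 3
      then show ?thesis using c[of 2 n] by (auto simp: power_0_left power2_eq_square)
    qed
  qed
  have inv: "distr ?M borel F = ?M"
  proof (rule finite_measure_eqI_continuous)
    show "finite_measure (distr ?M borel F)"
      by (intro prob_space.finite_measure M.prob_space_distr)
          (simp cong: measurable_cong_sets add: M.sets_M)
    fix g :: "complex \<Rightarrow> real" assume g: "continuous_on UNIV g" "bounded (range g)"
    have [measurable]: "g \<in> borel_measurable borel" by (rule borel_measurable_continuous_onI[OF g(1)])
    have "(\<integral>z. 1 * of_real (g (F z)) \<partial>?M) = (\<integral>z. 1 * complex_of_real (g z) \<partial>?M)"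
    proof (rule M.transfer_continuous[where C = 1, OF _ _ _ _ M.monomials_reduce g(1)])
      show "(\<integral>z. 1 * F z ^ k \<partial>?M) = (\<integral>z. 1 * z ^ k \<partial>?M)" for k
        using zF[of 0 k] zF[of k 0] by simp
      show "(\<integral>z. 1 * cnj (F z) ^ k \<partial>?M) = (\<integral>z. 1 * cnj z ^ k \<partial>?M)" for k
        using conj[of 0 k] zF[of 0 k] zc[of 0 k] by (cases "k = 0") (auto simp: power_0_left)
    qed auto
    then have "complex_of_real (\<integral>z. g (F z) \<partial>?M) = of_real (\<integral>z. g z \<partial>?M)" by simp
    then have "(\<integral>z. g (F z) \<partial>?M) = (\<integral>z. g z \<partial>?M)" by (simp only: of_real_eq_iff)
    then show "(\<integral>z. g z \<partial>distr ?M borel F) = (\<integral>z. g z \<partial>?M)"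
      by (subst integral_distr) (auto cong: measurable_cong_sets simp: M.sets_M)
  qed (auto simp: M.sets_M M.finite_measure_axioms)
  have "circle_transfer ?M F a b"
  proof (intro circle_transfer.intro circle_transfer_axioms.intro M.circle_map_axioms a1 inv)
    fix h :: "complex \<Rightarrow> complex" and B :: real
    assume h: "h \<in> borel_measurable borel" "\<And>z. cmod z = 1 \<Longrightarrow> cmod (h z) \<le> B"
    have "(\<integral>z. z * h (F z) \<partial>?M) = (\<integral>z. (cnj a * z) * h z \<partial>?M)"
    proof (rule M.transfer_borel[where C = 1 and B = B, OF inv _ _ h(1) _ _ h(2) M.monomials_reduce])
      show "(\<integral>z. z * F z ^ k \<partial>?M) = (\<integral>z. cnj a * z * z ^ k \<partial>?M)" for k
        using zF[of 1 k] zF[of "Suc k" 0] by (simp add: mult.assoc)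
      show "(\<integral>z. z * cnj (F z) ^ k \<partial>?M) = (\<integral>z. cnj a * z * cnj z ^ k \<partial>?M)" for k
        using conj[of 1 k] c1[of k] zc[of 1 k] by (cases "k = 1") (auto simp: mult.assoc)
    qed (use a1 in \<open>auto simp: norm_mult\<close>)
    then show "(\<integral>z. z * h (F z) \<partial>?M) = cnj a * (\<integral>z. z * h z \<partial>?M)" by (simp add: mult.assoc)
    show "(\<integral>z. z\<^sup>2 * h (F z) \<partial>?M) = (\<integral>z. ((cnj a)\<^sup>2 * z\<^sup>2 + cnj b * z) * h z \<partial>?M)"
    proof (rule M.transfer_borel[where C = "2 + cmod b" and B
        = B, OF inv _ _ h(1) _ _ h(2) M.monomials_reduce])
      have lin: "(\<integral>z. ((cnj a)\<^sup>2 * z\<^sup>2 + cnj b * z) * e z \<partial>?M)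
          = (cnj a)\<^sup>2 * (\<integral>z. z\<^sup>2 * e z \<partial>?M) + cnj b * (\<integral>z. z * e z \<partial>?M)"
        if [measurable]: "e \<in> borel_measurable borel" and "\<And>z. cmod z = 1 \<Longrightarrow> cmod (e z) = 1" for e
      proof -
        have "integrable ?M (\<lambda>z. z\<^sup>2 * e z)" "integrable ?M (\<lambda>z. z * e z)"
          by (rule M.integrable_circle[where B = 1]; use that in \<open>simp add: norm_mult norm_power\<close>)+
        then show ?thesis by (simp add: distrib_right mult.assoc)
      qed
      show "(\<integral>z. z\<^sup>2 * F z ^ k \<partial>?M) = (\<integral>z. ((cnj a)\<^sup>2 * z\<^sup>2 + cnj b * z) * z ^ k \<partial>?M)" for k
        using zF[of 2 k] zF[of "Suc k" 0] zF[of "Suc (Suc k)" 0]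
        by (subst lin) (auto simp: norm_power power2_eq_square mult.assoc)
      show "(\<integral>z. z\<^sup>2 * cnj (F z) ^ k \<partial>?M) = (\<integral>z. ((cnj a)\<^sup>2 * z\<^sup>2 + cnj b * z) * cnj z ^ k \<partial>?M)" for k
        using conj[of 2 k] c2[of k] zc[of 2 k] zc[of 1 k]
        by (subst lin) (auto simp: norm_power)
      show "cmod ((cnj a)\<^sup>2 * z\<^sup>2 + cnj b * z) \<le> 2 + cmod b" if "cmod z = 1" for z
        using norm_triangle_ineq[of "(cnj a)\<^sup>2 * z\<^sup>2" "cnj b * z"] that power_le_one[of "cmod a" 2] a1
        by (simp add: norm_mult norm_power)
    qed (auto simp: norm_power)
  qed
  moreover have "{z. cmod z = 1 \<and> boundary f z = F z} \<in> sets borel"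
  proof -
    have "{z. cmod z = 1 \<and> boundary f z = F z} = {z. cmod z = 1 \<and> B0 z = F z}"
      by (auto simp: B0_def)
    also have "\<dots> \<in> sets borel" by measurable
    finally show ?thesis .
  qed
  moreover have "AE z in ?M. cmod z = 1 \<and> boundary f z = F z"
    unfolding circle_borel_def
  proof (subst AE_distr_iff[OF measurable_circle_id])
    show "{z \<in> space borel. cmod z = 1 \<and> boundary f z = F z} \<in> sets borel" using calculation(2) by simp
    show "AE z in circle_measure. cmod z = 1 \<and> boundary f z = F z"
      using Flim AE_space by eventually_elim simp
  qed
  ultimately show thesis by (intro that[of F b]) (simp_all add: a_def)
qed

section \<open>The central limit theorem for inner functions\<close>

lemma (in circle_transfer) distr_funpow: "distr M borel (F ^^ n) = M"
proof (induction n)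
  case 0
  then show ?case using sets_M by (simp add: distr_id2 id_def)
next
  case (Suc n)
  have "distr M borel (F ^^ Suc n) = distr (distr M borel (F ^^ n)) borel F"
    unfolding funpow.simps by (subst distr_distr) auto
  then show ?case by (simp only: Suc.IH invariant)
qed

text \<open>As \<open>F\<close> preserves the measure, almost every orbit under \<open>F\<close> avoids the null set on which the two
maps differ.\<close>

lemma (in circle_transfer) AE_funpow_eq:
  assumes meas: "{z. cmod z = 1 \<and> h z = F z} \<in> sets borel"
    and AE: "AE z in M. cmod z = 1 \<and> h z = F z"
  shows "AE z in M. \<forall>n. (h ^^ n) z = (F ^^ n) z"
proof -
  have "AE z in M. cmod ((F ^^ n) z) = 1 \<and> h ((F ^^ n) z) = F ((F ^^ n) z)" for n
  proof -
    have "AE z in distr M borel (F ^^ n). cmod z = 1 \<and> h z = F z"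
      unfolding distr_funpow by (rule AE)
    then show ?thesis by (subst (asm) AE_distr_iff) (use meas in auto)
  qed
  then have "AE z in M. \<forall>n. cmod ((F ^^ n) z) = 1 \<and> h ((F ^^ n) z) = F ((F ^^ n) z)"
    by (simp add: AE_all_countable)
  then show ?thesis
  proof eventually_elim
    case (elim z)
    have "(h ^^ n) z = (F ^^ n) z" for n by (induction n) (use elim in auto)
    then show ?case by blast
  qed
qed

theorem corollary2:
  fixes f :: "complex \<Rightarrow> complex" and sigma_sq :: real
  assumes "inner_function f" and "f 0 = 0" and "\<not> is_rotation f"
    and "sigma_sq = Re ((1 + deriv f 0) / (1 - deriv f 0))"
  shows "converges_in_distribution circle_measure
           (\<lambda>N z. of_real (sqrt (2 / real N)) * (\<Sum>n=1..N. (boundary f ^^ n) z))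
           (complex_normal sigma_sq) \<and>
         (\<forall>K. K \<in> sets borel \<and> frontier K \<in> null_sets lborel \<longrightarrow>
           (\<lambda>N. measure circle_measure
              {z \<in> sphere 0 1. of_real (sqrt (2 / real N)) * (\<Sum>n=1..N. (boundary f ^^ n) z) \<in> K})
           \<longlonglongrightarrow> 1 / (2 * pi * sigma_sq) * (LINT w:K|lborel. exp (- (cmod w)\<^sup>2 / (2 * sigma_sq))))"
proof -
  obtain F b where transfer: "circle_transfer circle_borel F (deriv f 0) b"
    and good: "{z. cmod z = 1 \<and> boundary f z = F z} \<in> sets borel"
      "AE z in circle_borel. cmod z = 1 \<and> boundary f z = F z"
    using inner_function_circle_transfer[OF assms(1-3)] by blast
  interpret T: circle_transfer circle_borel F "deriv f 0" b by (rule transfer)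
  interpret CM: prob_space circle_measure by (rule prob_space_circle_measure)
  let ?Y = "\<lambda>N z. complex_of_real (sqrt (2 / real N)) * (\<Sum>n=1..N. (boundary f ^^ n) z)"
  have var: "sigma_sq = T.limit_variance" "sigma_sq > 0"
    using assms(4) T.limit_variance_eq T.limit_variance_pos by simp_all
  have meas_Y: "?Y N \<in> borel_measurable circle_measure" for N
  proof -
    have "continuous_on (ball 0 1) f" "f ` ball 0 1 \<subseteq> ball 0 1"
      using assms(1) holomorphic_on_imp_continuous_on by (auto simp: inner_function_def)
    from measurable_boundary_funpow[OF this] show ?thesis by measurable
  qed
  have meas_scaled_sum: "T.scaled_sum N \<in> borel_measurable circle_measure" for N
    by (rule measurable_circle_borel) measurable
  have "AE z in circle_measure. \<forall>n. (boundary f ^^ n) z = (F ^^ n) z"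
    using AE_distrD[OF measurable_circle_id T.AE_funpow_eq[OF good, unfolded circle_borel_def]] .
  then have AE_eq: "AE z in circle_measure. ?Y N z = T.scaled_sum N z" for N
    by eventually_elim (simp add: T.scaled_sum_def T.orbit_sum_def)
  have distr_scaled_sum: "distr circle_borel borel (T.scaled_sum N)
      = distr circle_measure borel (T.scaled_sum N)" for N
    unfolding circle_borel_def
    by (subst distr_distr[OF _ measurable_circle_id]) (auto simp: comp_def)
  have weak: "(\<lambda>N. \<integral>w. g w \<partial>distr circle_measure borel (T.scaled_sum N))
      \<longlonglongrightarrow> (\<integral>w. g w \<partial>complex_normal sigma_sq)"
    if "continuous_on UNIV g" "bounded (range g)" for g :: "complex \<Rightarrow> real"
    using T.weak_limit[OF that] by (simp add: distr_scaled_sum var(1))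
  show ?thesis
  proof (intro conjI allI impI)
    show "converges_in_distribution circle_measure ?Y (complex_normal sigma_sq)"
      unfolding converges_in_distribution_def
    proof (intro allI impI)
      fix g :: "complex \<Rightarrow> real" assume g: "continuous_on UNIV g \<and> bounded (range g)"
      have [measurable]: "g \<in> borel_measurable borel"
        using g by (intro borel_measurable_continuous_onI) simp
      have "(\<integral>z. g (?Y N z) \<partial>circle_measure) = (\<integral>w. g w \<partial>distr circle_measure borel (T.scaled_sum N))" for N
      proof -
        have "(\<integral>z. g (?Y N z) \<partial>circle_measure) = (\<integral>z. g (T.scaled_sum N z) \<partial>circle_measure)"
        proof (rule integral_cong_AE)
          show "(\<lambda>z. g (?Y N z)) \<in> borel_measurable circle_measure"
            by (rule measurable_compose[OF meas_Y]) measurable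
          show "(\<lambda>z. g (T.scaled_sum N z)) \<in> borel_measurable circle_measure"
            by (rule measurable_compose[OF meas_scaled_sum]) measurable
          show "AE z in circle_measure. g (?Y N z) = g (T.scaled_sum N z)"
            using AE_eq[of N] by eventually_elim simp
        qed
        then show ?thesis by (simp add: integral_distr[OF meas_scaled_sum])
      qed
      then show "(\<lambda>N. \<integral>z. g (?Y N z) \<partial>circle_measure) \<longlonglongrightarrow> (\<integral>w. g w \<partial>complex_normal sigma_sq)"
        using weak[of g] g by simp
    qed
  next
    fix K :: "complex set" assume K: "K \<in> sets borel \<and> frontier K \<in> null_sets lborel"
    have "(\<lambda>N. measure (distr circle_measure borel (T.scaled_sum N)) K)
        \<longlonglongrightarrow> measure (complex_normal sigma_sq) K"
      by (rule portmanteau_frontier)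
        (use K weak var(2) in \<open>auto intro!: CM.prob_space_distr meas_scaled_sum
            prob_space_complex_normal null_sets_complex_normal\<close>)
    moreover have "measure (distr circle_measure borel (T.scaled_sum N)) K
        = measure circle_measure {z \<in> sphere 0 1. ?Y N z \<in> K}" for N
    proof -
      have Y: "{z \<in> sphere 0 1. ?Y N z \<in> K} = ?Y N -` K \<inter> space circle_measure" by auto
      have "measure (distr circle_measure borel (T.scaled_sum N)) K
          = measure circle_measure (T.scaled_sum N -` K \<inter> space circle_measure)"
        using K by (intro measure_distr meas_scaled_sum) simp
      also have "\<dots> = measure circle_measure {z \<in> sphere 0 1. ?Y N z \<in> K}"
        unfolding Y
      proof (rule measure_eq_AE)
        show "AE z in circle_measure. z \<in> T.scaled_sum N -` K \<inter> space circle_measure \<longleftrightarrow> z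
            \<in> ?Y N -` K \<inter> space circle_measure"
          using AE_eq[of N] by eventually_elim simp
      qed (use K measurable_sets[OF meas_scaled_sum] measurable_sets[OF meas_Y] in auto)
      finally show ?thesis .
    qed
    ultimately show "(\<lambda>N. measure circle_measure {z \<in> sphere 0 1. ?Y N z \<in> K})
        \<longlonglongrightarrow> 1 / (2 * pi * sigma_sq) * (LINT w:K|lborel. exp (- (cmod w)\<^sup>2 / (2 * sigma_sq)))"
      using measure_complex_normal[OF var(2)] K by simp
  qed
qed

end
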